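(* The linear map $F\colon G_0(\mathbf{\Pi},\wedge)\to\mathsf{NCSym}$ defined by $F(V_A)=\mathbf{x}_A$ for every $A\in\Pi_n$, $n\ge 0$, is an isomorphism of bialgebras, where $G_0(\mathbf{\Pi},\wedge)$ carries the induction product and the internal comultiplication $\Delta^{\odot}$, and $\mathsf{NCSym}$ carries its product and its internal comultiplication $\Delta^{\odot}$.
   Context: $\Bbbk$ is a field of characteristic zero. $\Pi_n$ is the set of set partitions of $[n]=\{1,\dots,n\}$ ($\Pi_0$ consists only of the empty set partition), ordered by $A\le B$ iff every part of $A$ is contained in a part of $B$. It is a lattice with meet $\wedge$, join $\vee$, minimal element $\mathbf{0}_n=\{\{1\},\dots,\{n\}\}$, maximal element $\mathbf{1}_n=\{[n]\}$, and Möbius function $\mu$. For $A\in\Pi_n$, $B\in\Pi_m$, the set partition $A|B\in\Pi_{n+m}$ consists of the parts of $A$ together with the parts of $B$ with every element shifted by $n$. **Modules.** $(\Bbbk\Pi_n,\wedge)$ is the $\Bbbk$-algebra with basis $\Pi_n$ and product extending $\wedge$ bilinearly (unit $\mathbf{1}_n$); it is commutative and semisimple, with primitive orthogonal idempotents $e_A=\sum_{B\le A}\mu(B,A)B$, $A\in\Pi_n$, and simple modules the one-dimensional spaces $V_A=\Bbbk\Pi_n\wedge e_A$ (left multiplication). $G_0(\Bbbk\Pi_n,\wedge)$ is the Grothendieck group of finite dimensional modules, regarded as the $\Bbbk$-vector space with basis the isomorphism classes of the simple modules $V_A$, $A\in\Pi_n$; and $G_0(\mathbf{\Pi},\wedge)=\bigoplus_{n\ge0}G_0(\Bbbk\Pi_n,\wedge)$.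 The product on $G_0(\mathbf{\Pi},\wedge)$ is given by induction: for $A\in\Pi_n,B\in\Pi_m$, $V_A\cdot V_B=\mathrm{Ind}_{n,m}V_A\otimes V_B=\Bbbk\Pi_{n+m}\otimes_{\Bbbk\Pi_n\otimes\Bbbk\Pi_m}(V_A\otimes V_B)$, where $\Bbbk\Pi_n\otimes\Bbbk\Pi_m$ is embedded (non-unitally) in $\Bbbk\Pi_{n+m}$ via $\rho_{n,m}(C\otimes D)=C|D$; one has $V_A\cdot V_B=V_{A|B}$. The internal comultiplication is dual to the tensor product of modules with diagonal action, and is given by $\Delta^{\odot}(V_C)=\sum_{A\vee B=C}V_A\otimes V_B$ for $C\in\Pi_n$ (sum over pairs $(A,B)\in\Pi_n\times\Pi_n$). With these, $G_0(\mathbf{\Pi},\wedge)$ is a bialgebra. **$\mathsf{NCSym}$.** $\mathsf{NCSym}=\bigoplus_{d\ge0}\mathsf{NCSym}_d$ is the $\Bbbk$-algebra of symmetric functions in noncommutative variables $x_1,x_2,\dots$. The space $\mathsf{NCSym}_d$ has basis $\{\mathbf{m}_A\}_{A\in\Pi_d}$, where $\mathbf{m}_A=\sum x_{i_1}\cdots x_{i_d}$ is the formal sum over all sequences of positive integers such that $i_a=i_b$ iff $a,b$ are in the same part of $A$ (and $\mathbf{m}_\emptyset=1$). The product is, for $A\in\Pi_d$, $B\in\Pi_m$, $\mathbf{m}_A\mathbf{m}_B=\sum_{C\in\Pi_{d+m},\,C\wedge(\mathbf{1}_d|\mathbf{1}_m)=A|B}\mathbf{m}_C$, and the internal comultiplication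 is $\Delta^{\odot}(\mathbf{m}_A)=\sum_{B\wedge C=A}\mathbf{m}_B\otimes\mathbf{m}_C$. With these, $\mathsf{NCSym}$ is a bialgebra. **The basis $\mathbf{x}_A$.** Put $\mathbf{p}_A=\sum_{B\ge A}\mathbf{m}_B$ and $\mathbf{x}_A=\sum_{B\le A}\mu(B,A)\,\mathbf{p}_B$ for $A\in\Pi_n$; the $\mathbf{x}_A$ form a basis of $\mathsf{NCSym}$. *)

theory Defs
  imports
    Complex_Main
    "HOL-Algebra.Module"
    "HOL-Algebra.AbelCoset"
    "HOL-Algebra.Lattice"
    "HOL-Library.Disjoint_Sets"
    "HOL-Library.Function_Algebras"
begin

section \<open>Vector spaces of functions\<close>

text \<open>
  All vector spaces over the field \<open>'k\<close> are realised as subspaces of spaces of functions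
  \<open>'x \<Rightarrow> 'k\<close> (with the pointwise operations), or as quotients of such subspaces. The function
  \<open>delta x\<close> is the basis vector attached to \<open>x\<close>. For subspaces \<open>V\<close> of \<open>'x \<Rightarrow> 'k\<close> and \<open>W\<close> of
  \<open>'y \<Rightarrow> 'k\<close>, the tensor product over \<open>'k\<close> is realised inside \<open>'x \<times> 'y \<Rightarrow> 'k\<close>, with
  \<open>f \<otimes> g\<close> being \<open>(x, y) \<mapsto> f x * g y\<close>; the canonical map from the abstract tensor product into
  this function space is injective.
\<close>

definition fscale :: "'k::field \<Rightarrow> ('x \<Rightarrow> 'k) \<Rightarrow> 'x \<Rightarrow> 'k"
  where "fscale c f = (\<lambda>x. c * f x)"

global_interpretation fvs: vector_space "fscale :: 'k::field \<Rightarrow> ('x \<Rightarrow> 'k) \<Rightarrow> 'x \<Rightarrow> 'k"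
  by unfold_locales (auto simp: fscale_def fun_eq_iff algebra_simps)

definition delta :: "'x \<Rightarrow> 'x \<Rightarrow> 'k::field"
  where "delta x = (\<lambda>y. if y = x then 1 else 0)"

definition tensor :: "('x \<Rightarrow> 'k::field) \<Rightarrow> ('y \<Rightarrow> 'k) \<Rightarrow> 'x \<times> 'y \<Rightarrow> 'k"
  where "tensor f g = (\<lambda>(x, y). f x * g y)"

definition tensor_space ::
    "('x \<Rightarrow> 'k::field) set \<Rightarrow> ('y \<Rightarrow> 'k) set \<Rightarrow> ('x \<times> 'y \<Rightarrow> 'k) set"
  where "tensor_space V W = fvs.span {tensor v w | v w. v \<in> V \<and> w \<in> W}"

text \<open>\<open>s1\<close> and \<open>s2\<close> are the scalar multiplications of the source and of the target.\<close>

definition linear_on ::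
    "('k \<Rightarrow> 'a \<Rightarrow> 'a) \<Rightarrow> ('k \<Rightarrow> 'b \<Rightarrow> 'b) \<Rightarrow> 'a::ab_group_add set \<Rightarrow> ('a \<Rightarrow> 'b::ab_group_add) \<Rightarrow> bool"
  where "linear_on s1 s2 V f \<longleftrightarrow>
    (\<forall>v\<in>V. \<forall>w\<in>V. f (v + w) = f v + f w) \<and> (\<forall>c. \<forall>v\<in>V. f (s1 c v) = s2 c (f v))"

text \<open>The map \<open>F \<otimes> F\<close> on \<open>V \<otimes> V\<close>. Its values outside \<open>V \<otimes> V\<close> are unspecified.\<close>

definition tensor_map ::
    "('x \<Rightarrow> 'k::field) set \<Rightarrow> (('x \<Rightarrow> 'k) \<Rightarrow> 'y \<Rightarrow> 'k) \<Rightarrow> ('x \<times> 'x \<Rightarrow> 'k) \<Rightarrow> 'y \<times> 'y \<Rightarrow> 'k"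
  where "tensor_map V F = (SOME h. linear_on fscale fscale (tensor_space V V) h \<and>
    (\<forall>v\<in>V. \<forall>w\<in>V. h (tensor v w) = tensor (F v) (F w)))"

text \<open>The bilinear extension of an operation \<open>opn\<close> defined on the finite bases \<open>I\<close> and \<open>J\<close>.\<close>

definition bilin_ext ::
    "'x set \<Rightarrow> 'y set \<Rightarrow> ('x \<Rightarrow> 'y \<Rightarrow> 'z) \<Rightarrow> ('x \<Rightarrow> 'k::field) \<Rightarrow> ('y \<Rightarrow> 'k) \<Rightarrow> 'z \<Rightarrow> 'k"
  where "bilin_ext I J opn f g = (\<Sum>x\<in>I. \<Sum>y\<in>J. fscale (f x * g y) (delta (opn x y)))"


section \<open>Bialgebras\<close>

text \<open>The comultiplication takes values in the tensor square, viewed inside \<open>'x \<times> 'x \<Rightarrow> 'k\<close>.\<close>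

record ('x, 'k) bialg =
  bspace :: "('x \<Rightarrow> 'k) set"
  bmult :: "('x \<Rightarrow> 'k) \<Rightarrow> ('x \<Rightarrow> 'k) \<Rightarrow> 'x \<Rightarrow> 'k"
  bunit :: "'x \<Rightarrow> 'k"
  bcomult :: "('x \<Rightarrow> 'k) \<Rightarrow> 'x \<times> 'x \<Rightarrow> 'k"
  bcounit :: "('x \<Rightarrow> 'k) \<Rightarrow> 'k"

definition bialg_iso ::
    "('x, 'k::field) bialg \<Rightarrow> ('y, 'k) bialg \<Rightarrow> (('x \<Rightarrow> 'k) \<Rightarrow> 'y \<Rightarrow> 'k) \<Rightarrow> bool"
  where "bialg_iso H K F \<longleftrightarrow>
    linear_on fscale fscale (bspace H) F \<and>
    bij_betw F (bspace H) (bspace K) \<and>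
    (\<forall>v\<in>bspace H. \<forall>w\<in>bspace H. F (bmult H v w) = bmult K (F v) (F w)) \<and>
    F (bunit H) = bunit K \<and>
    (\<forall>v\<in>bspace H. tensor_map (bspace H) F (bcomult H v) = bcomult K (F v)) \<and>
    (\<forall>v\<in>bspace H. bcounit K (F v) = bcounit H v)"


section \<open>The lattice of set partitions\<close>

type_synonym setpart = "nat set set"

definition set_partitions :: "nat \<Rightarrow> setpart set"
  where "set_partitions n = {A. partition_on {1..n} A}"

definition part_lattice :: "nat \<Rightarrow> setpart gorder"
  where "part_lattice n = \<lparr>carrier = set_partitions n, eq = (=), le = refines {1..n}\<rparr>"

text \<open>
  Meet, top and bottom are the order-theoretic ones of the library:
  \<open>A \<sqinter>\<^bsub>part_lattice n\<^esub> B\<close>, \<open>\<top>\<^bsub>part_lattice n\<^esub>\<close>, \<open>\<bottom>\<^bsub>part_lattice n\<^esub>\<close>.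
  For \<open>n = 0\<close> top and bottom are both the empty set partition.
\<close>

definition part_concat :: "nat \<Rightarrow> setpart \<Rightarrow> setpart \<Rightarrow> setpart"
  where "part_concat n A B = A \<union> (\<lambda>P. (\<lambda>i. i + n) ` P) ` B"

lemma finite_set_partitions: "finite (set_partitions n)"
  unfolding set_partitions_def by (rule finitely_many_partition_on) simp

lemma refines_in_set_partitions:
  "refines {1..n} A B \<Longrightarrow> A \<in> set_partitions n \<and> B \<in> set_partitions n"
  by (simp add: refines_def set_partitions_def)

lemma refines_trans':
  "refines S A B \<Longrightarrow> refines S B C \<Longrightarrow> refines S A C"
  unfolding refines_def by (meson subset_trans)

text \<open>The Moebius function of \<open>\<Pi>\<^sub>n\<close>, with value \<open>0\<close> at pairs that are not comparable.\<close>

function moebius :: "nat \<Rightarrow> setpart \<Rightarrow> setpart \<Rightarrow> int"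
  where "moebius n A B =
    (if \<not> refines {1..n} A B then 0
     else if A = B then 1
     else - (\<Sum>C \<in> {C. refines {1..n} A C \<and> refines {1..n} C B \<and> C \<noteq> B}. moebius n A C))"
  by pat_completeness auto
termination
proof (relation "measure (\<lambda>(n, A, B). card {C. refines {1..n} C B})", goal_cases)
  case 1
  then show ?case by simp
next
  case (2 n A B C)
  have fin: "finite {C. refines {1..n} C B}"
    by (rule finite_subset[OF _ finite_set_partitions[of n]])
      (use refines_in_set_partitions in blast)
  have CB: "refines {1..n} C B" "C \<noteq> B"
    using 2 by auto
  have "{D. refines {1..n} D C} \<subseteq> {D. refines {1..n} D B}"
    using refines_trans' CB(1) by blast
  moreover have "refines {1..n} B B"
    using CB(1) unfolding refines_def by blast
  moreover have "\<not> refines {1..n} B C"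
    using refines_asym CB by blast
  ultimately have "{D. refines {1..n} D C} \<subset> {D. refines {1..n} D B}"
    by blast
  then show ?case
    using psubset_card_mono[OF fin] by simp
qed

declare moebius.simps [simp del]


section \<open>The algebra of \<open>\<Pi>\<^sub>n\<close> with the meet product, and its modules\<close>

type_synonym 'k part_vec = "setpart \<Rightarrow> 'k"
type_synonym 'k part_vec2 = "setpart \<times> setpart \<Rightarrow> 'k"

definition part_algebra :: "nat \<Rightarrow> ('k::field part_vec) ring"
  where "part_algebra n = \<lparr>
    carrier = fvs.span (delta ` set_partitions n),
    mult = bilin_ext (set_partitions n) (set_partitions n) (\<lambda>A B. A \<sqinter>\<^bsub>part_lattice n\<^esub> B),
    one = delta \<top>\<^bsub>part_lattice n\<^esub>,
    zero = 0,
    add = (+)\<rparr>"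

text \<open>The algebra \<open>\<bbbk>\<Pi>\<^sub>n \<otimes> \<bbbk>\<Pi>\<^sub>m\<close>, with basis the pairs \<open>(C, D)\<close>, i.e. \<open>C \<otimes> D\<close>.\<close>

definition part_algebra2 :: "nat \<Rightarrow> nat \<Rightarrow> ('k::field part_vec2) ring"
  where "part_algebra2 n m = \<lparr>
    carrier = tensor_space (carrier (part_algebra n)) (carrier (part_algebra m)),
    mult = bilin_ext (set_partitions n \<times> set_partitions m) (set_partitions n \<times> set_partitions m)
      (\<lambda>(A, B) (C, D). (A \<sqinter>\<^bsub>part_lattice n\<^esub> C, B \<sqinter>\<^bsub>part_lattice m\<^esub> D)),
    one = tensor (one (part_algebra n)) (one (part_algebra m)),
    zero = 0,
    add = (+)\<rparr>"

text \<open>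
  The library record for modules extends the one for rings; the fields \<^const>\<open>mult\<close> and
  \<^const>\<open>one\<close> of a module play no role and are left unspecified.
\<close>

definition fun_module ::
    "('x \<Rightarrow> 'k::field) set \<Rightarrow> ('a \<Rightarrow> ('x \<Rightarrow> 'k) \<Rightarrow> 'x \<Rightarrow> 'k) \<Rightarrow> ('a, 'x \<Rightarrow> 'k) module"
  where "fun_module V act =
    \<lparr>carrier = V, mult = undefined, one = undefined, zero = 0, add = (+), smult = act\<rparr>"

definition quotient_module :: "('a, 'b) module \<Rightarrow> 'b set \<Rightarrow> ('a, 'b set) module"
  where "quotient_module M K =
    \<lparr>carrier = a_rcosets\<^bsub>M\<^esub> K, mult = undefined, one = undefined, zero = K, add = set_add M,
     smult = (\<lambda>a U. \<Union>u\<in>U. K +>\<^bsub>M\<^esub> (a \<odot>\<^bsub>M\<^esub> u))\<rparr>"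

definition mod_hom :: "'a ring \<Rightarrow> ('a, 'b) module \<Rightarrow> ('a, 'c) module \<Rightarrow> ('b \<Rightarrow> 'c) set"
  where "mod_hom R M N = {h \<in> hom (add_monoid M) (add_monoid N).
    \<forall>a\<in>carrier R. \<forall>x\<in>carrier M. h (a \<odot>\<^bsub>M\<^esub> x) = a \<odot>\<^bsub>N\<^esub> h x}"

definition mod_isomorphic :: "'a ring \<Rightarrow> ('a, 'b) module \<Rightarrow> ('a, 'c) module \<Rightarrow> bool"
  where "mod_isomorphic R M N \<longleftrightarrow> (\<exists>h \<in> mod_hom R M N. bij_betw h (carrier M) (carrier N))"

definition prim_idem :: "nat \<Rightarrow> setpart \<Rightarrow> 'k::field_char_0 part_vec"
  where "prim_idem n A = (\<Sum>B \<in> {B. refines {1..n} B A}. fscale (of_int (moebius n B A)) (delta B))"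

text \<open>The simple module \<open>V\<^sub>A = \<bbbk>\<Pi>\<^sub>n \<and> e\<^sub>A\<close>, for \<open>A \<in> \<Pi>\<^sub>n\<close>.\<close>

definition simple_module ::
    "nat \<Rightarrow> setpart \<Rightarrow> ('k::field_char_0 part_vec, 'k part_vec) module"
  where "simple_module n A =
    fun_module ((\<lambda>f. f \<otimes>\<^bsub>part_algebra n\<^esub> prim_idem n A) ` carrier (part_algebra n))
      (mult (part_algebra n))"

text \<open>\<open>V\<^sub>A \<otimes> V\<^sub>B\<close> as a module over \<open>\<bbbk>\<Pi>\<^sub>n \<otimes> \<bbbk>\<Pi>\<^sub>m\<close>, for \<open>A \<in> \<Pi>\<^sub>n\<close>, \<open>B \<in> \<Pi>\<^sub>m\<close>.\<close>

definition outer_tensor ::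
    "nat \<Rightarrow> nat \<Rightarrow> setpart \<Rightarrow> setpart \<Rightarrow> ('k::field_char_0 part_vec2, 'k part_vec2) module"
  where "outer_tensor n m A B =
    fun_module (tensor_space (carrier (simple_module n A)) (carrier (simple_module m B)))
      (mult (part_algebra2 n m))"

text \<open>
  \<open>V\<^sub>A \<otimes> V\<^sub>B\<close> as a module over \<open>\<bbbk>\<Pi>\<^sub>n\<close> with the diagonal action, for \<open>A, B \<in> \<Pi>\<^sub>n\<close>:
  \<open>C \<in> \<Pi>\<^sub>n\<close> acts as \<open>C \<otimes> C\<close>.
\<close>

definition inner_tensor ::
    "nat \<Rightarrow> setpart \<Rightarrow> setpart \<Rightarrow> ('k::field_char_0 part_vec, 'k part_vec2) module"
  where "inner_tensor n A B =
    fun_module (tensor_space (carrier (simple_module n A)) (carrier (simple_module n B)))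
      (bilin_ext (set_partitions n) (set_partitions n \<times> set_partitions n)
        (\<lambda>C (D, E). (C \<sqinter>\<^bsub>part_lattice n\<^esub> D, C \<sqinter>\<^bsub>part_lattice n\<^esub> E)))"

text \<open>The non-unital embedding of \<open>\<bbbk>\<Pi>\<^sub>n \<otimes> \<bbbk>\<Pi>\<^sub>m\<close> into \<open>\<bbbk>\<Pi>\<^bsub>n+m\<^esub>\<close> given by \<open>C \<otimes> D \<mapsto> C|D\<close>.\<close>

definition rho :: "nat \<Rightarrow> nat \<Rightarrow> 'k::field part_vec2 \<Rightarrow> 'k part_vec"
  where "rho n m s =
    (\<Sum>(C, D) \<in> set_partitions n \<times> set_partitions m. fscale (s (C, D)) (delta (part_concat n C D)))"

text \<open>
  The induced module \<open>\<bbbk>\<Pi>\<^bsub>n+m\<^esub> \<otimes>\<^sub>S N\<close> with \<open>S = \<bbbk>\<Pi>\<^sub>n \<otimes> \<bbbk>\<Pi>\<^sub>m\<close>, constructed as the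
  quotient of \<open>\<bbbk>\<Pi>\<^bsub>n+m\<^esub> \<otimes> N\<close> (tensor product over \<open>\<bbbk>\<close>) by the subspace spanned by the elements
  \<open>p\<cdot>\<rho>(s) \<otimes> t - p \<otimes> s\<cdot>t\<close>. The algebra \<open>\<bbbk>\<Pi>\<^bsub>n+m\<^esub>\<close> acts by multiplication on the first factor.
  Here \<open>N\<close> is an \<open>S\<close>-submodule of \<open>S\<close>.
\<close>

definition induced_pre ::
    "nat \<Rightarrow> nat \<Rightarrow> ('k::field part_vec2, 'k part_vec2) module \<Rightarrow>
      ('k part_vec, setpart \<times> setpart \<times> setpart \<Rightarrow> 'k) module"
  where "induced_pre n m N =
    fun_module (tensor_space (carrier (part_algebra (n + m))) (carrier N))
      (bilin_ext (set_partitions (n + m))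
        (set_partitions (n + m) \<times> set_partitions n \<times> set_partitions m)
        (\<lambda>C (D, q). (C \<sqinter>\<^bsub>part_lattice (n + m)\<^esub> D, q)))"

definition induced_rel ::
    "nat \<Rightarrow> nat \<Rightarrow> ('k::field part_vec2, 'k part_vec2) module \<Rightarrow>
      (setpart \<times> setpart \<times> setpart \<Rightarrow> 'k) set"
  where "induced_rel n m N = fvs.span
    {tensor (p \<otimes>\<^bsub>part_algebra (n + m)\<^esub> rho n m s) t - tensor p (s \<odot>\<^bsub>N\<^esub> t) | p s t.
      p \<in> carrier (part_algebra (n + m)) \<and> s \<in> carrier (part_algebra2 n m) \<and> t \<in> carrier N}"

definition induced_module ::
    "nat \<Rightarrow> nat \<Rightarrow> ('k::field part_vec2, 'k part_vec2) module \<Rightarrow>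
      ('k part_vec, (setpart \<times> setpart \<times> setpart \<Rightarrow> 'k) set) module"
  where "induced_module n m N = quotient_module (induced_pre n m N) (induced_rel n m N)"


section \<open>The bialgebra \<open>G\<^sub>0(\<Pi>, \<and>)\<close>\<close>

type_synonym 'k mod_class = "('k part_vec, 'k part_vec) module set"
type_synonym 'k G0_vec = "nat \<times> 'k mod_class \<Rightarrow> 'k"

definition iso_class :: "nat \<Rightarrow> setpart \<Rightarrow> 'k::field_char_0 mod_class"
  where "iso_class n A =
    {M. Module.module (part_algebra n) M \<and> mod_isomorphic (part_algebra n) M (simple_module n A)}"

text \<open>
  The basis vector of \<open>G\<^sub>0(\<Pi>, \<and>)\<close> given by the isomorphism class of \<open>V\<^sub>A\<close>, \<open>A \<in> \<Pi>\<^sub>n\<close>; the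
  first component of the index records the degree \<open>n\<close>.
\<close>

definition simple_class :: "nat \<Rightarrow> setpart \<Rightarrow> 'k::field_char_0 G0_vec"
  where "simple_class n A = delta (n, iso_class n A)"

definition G0_space :: "'k::field_char_0 G0_vec set"
  where "G0_space = fvs.span {simple_class n A | n A. A \<in> set_partitions n}"

text \<open>
  \<open>comp_class n M N v\<close>: the submodule \<open>N\<close> of the \<open>\<bbbk>\<Pi>\<^sub>n\<close>-module \<open>M\<close> has a finite composition
  series, and \<open>v\<close> is the sum of the classes of its composition factors. Each step is a short
  exact sequence \<open>0 \<rightarrow> N \<rightarrow> N' \<rightarrow> V\<^sub>A \<rightarrow> 0\<close>.
\<close>

inductive comp_class ::
    "nat \<Rightarrow> ('k::field_char_0 part_vec, 'b) module \<Rightarrow> 'b set \<Rightarrow> 'k G0_vec \<Rightarrow> bool"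
  for n :: nat and M :: "('k::field_char_0 part_vec, 'b) module"
  where
    zero: "comp_class n M {\<zero>\<^bsub>M\<^esub>} 0"
  | step: "comp_class n M N v \<Longrightarrow> submodule N' (part_algebra n) M \<Longrightarrow> A \<in> set_partitions n \<Longrightarrow>
      h \<in> mod_hom (part_algebra n) (M\<lparr>carrier := N'\<rparr>) (simple_module n A) \<Longrightarrow>
      h ` N' = carrier (simple_module n A) \<Longrightarrow>
      a_kernel (M\<lparr>carrier := N'\<rparr>) (simple_module n A) h = N \<Longrightarrow>
      comp_class n M N' (v + simple_class n A)"

text \<open>The class \<open>[M]\<close> in \<open>G\<^sub>0\<close> of a finite-dimensional \<open>\<bbbk>\<Pi>\<^sub>n\<close>-module \<open>M\<close>.\<close>

definition G0_class :: "nat \<Rightarrow> ('k::field_char_0 part_vec, 'b) module \<Rightarrow> 'k G0_vec"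
  where "G0_class n M = (THE v. comp_class n M (carrier M) v)"

text \<open>The induction product; values outside \<^const>\<open>G0_space\<close> are unspecified.\<close>

definition G0_mult :: "'k::field_char_0 G0_vec \<Rightarrow> 'k G0_vec \<Rightarrow> 'k G0_vec"
  where "G0_mult = (SOME h.
    (\<forall>v\<in>G0_space. linear_on fscale fscale G0_space (h v)) \<and>
    (\<forall>w\<in>G0_space. linear_on fscale fscale G0_space (\<lambda>v. h v w)) \<and>
    (\<forall>n m. \<forall>A\<in>set_partitions n. \<forall>B\<in>set_partitions m.
      h (simple_class n A) (simple_class m B) =
        G0_class (n + m) (induced_module n m (outer_tensor n m A B))))"

text \<open>
  The internal comultiplication, dual to the tensor product with diagonal action: the coefficient
  of \<open>V\<^sub>A \<otimes> V\<^sub>B\<close> in the image of \<open>V\<^sub>C\<close> is the multiplicity of \<open>V\<^sub>C\<close> in \<open>V\<^sub>A \<otimes> V\<^sub>B\<close>. As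
  \<open>V\<^sub>A \<otimes> V\<^sub>B\<close> is isomorphic to the simple module indexed by the join of \<open>A\<close> and \<open>B\<close>, this
  is the sum of \<open>V\<^sub>A \<otimes> V\<^sub>B\<close> over the pairs with \<open>A \<or> B = C\<close>.
\<close>

definition G0_comult :: "'k::field_char_0 G0_vec \<Rightarrow> (nat \<times> 'k mod_class) \<times> (nat \<times> 'k mod_class) \<Rightarrow> 'k"
  where "G0_comult = (SOME D. linear_on fscale fscale G0_space D \<and>
    (\<forall>n. \<forall>C\<in>set_partitions n. D (simple_class n C) =
      (\<Sum>A\<in>set_partitions n. \<Sum>B\<in>set_partitions n.
        fscale (G0_class n (inner_tensor n A B) (n, iso_class n C))
          (tensor (simple_class n A) (simple_class n B)))))"

text \<open>The counit of the internal comultiplication: the coefficient of the minimal partition.\<close>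

definition G0_counit :: "'k::field_char_0 G0_vec \<Rightarrow> 'k"
  where "G0_counit = (SOME e. linear_on fscale (*) G0_space e \<and>
    (\<forall>n. \<forall>A\<in>set_partitions n.
      e (simple_class n A) = (if A = \<bottom>\<^bsub>part_lattice n\<^esub> then 1 else 0)))"

definition G0_bialg :: "(nat \<times> 'k::field_char_0 mod_class, 'k) bialg"
  where "G0_bialg = \<lparr>bspace = G0_space, bmult = G0_mult, bunit = simple_class 0 {},
    bcomult = G0_comult, bcounit = G0_counit\<rparr>"


section \<open>The bialgebra NCSym\<close>

text \<open>
  A formal series in the noncommuting variables \<open>x\<^sub>1, x\<^sub>2, \<dots>\<close> is given by its coefficients: the
  word \<open>[i\<^sub>1, \<dots>, i\<^sub>d]\<close> of positive integers stands for the monomial \<open>x\<^bsub>i\<^sub>1\<^esub> \<cdots> x\<^bsub>i\<^sub>d\<^esub>\<close>. Words are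
  lists, which are indexed from 0, so the \<open>a\<close>-th letter of \<open>w\<close> is \<open>w ! (a - 1)\<close>.
\<close>

type_synonym 'k nc_series = "nat list \<Rightarrow> 'k"

definition ncsym_m :: "nat \<Rightarrow> setpart \<Rightarrow> 'k::field_char_0 nc_series"
  where "ncsym_m n A = (\<lambda>w.
    if length w = n \<and> (\<forall>i\<in>set w. 1 \<le> i) \<and>
       (\<forall>a\<in>{1..n}. \<forall>b\<in>{1..n}. w ! (a - 1) = w ! (b - 1) \<longleftrightarrow> (\<exists>P\<in>A. a \<in> P \<and> b \<in> P))
    then 1 else 0)"

definition ncsym_p :: "nat \<Rightarrow> setpart \<Rightarrow> 'k::field_char_0 nc_series"
  where "ncsym_p n A = (\<Sum>B \<in> {B. refines {1..n} A B}. ncsym_m n B)"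

definition ncsym_x :: "nat \<Rightarrow> setpart \<Rightarrow> 'k::field_char_0 nc_series"
  where "ncsym_x n A =
    (\<Sum>B \<in> {B. refines {1..n} B A}. fscale (of_int (moebius n B A)) (ncsym_p n B))"

definition ncsym_space :: "'k::field_char_0 nc_series set"
  where "ncsym_space = fvs.span {ncsym_m n A | n A. A \<in> set_partitions n}"

text \<open>
  The product of formal series in noncommuting variables. On the basis it reads
  \<open>m\<^sub>A m\<^sub>B = \<Sum> m\<^sub>C\<close>, the sum over all \<open>C\<close> whose meet with \<open>1\<^sub>d|1\<^sub>m\<close> is \<open>A|B\<close>.
\<close>

definition ncsym_mult :: "'k::field_char_0 nc_series \<Rightarrow> 'k nc_series \<Rightarrow> 'k nc_series"
  where "ncsym_mult f g = (\<lambda>w. \<Sum>i\<le>length w. f (take i w) * g (drop i w))"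

definition ncsym_comult :: "'k::field_char_0 nc_series \<Rightarrow> nat list \<times> nat list \<Rightarrow> 'k"
  where "ncsym_comult = (SOME D. linear_on fscale fscale ncsym_space D \<and>
    (\<forall>n. \<forall>A\<in>set_partitions n. D (ncsym_m n A) =
      (\<Sum>(B, C) \<in> {(B, C) \<in> set_partitions n \<times> set_partitions n.
          B \<sqinter>\<^bsub>part_lattice n\<^esub> C = A}. tensor (ncsym_m n B) (ncsym_m n C))))"

definition ncsym_counit :: "'k::field_char_0 nc_series \<Rightarrow> 'k"
  where "ncsym_counit = (SOME e. linear_on fscale (*) ncsym_space e \<and>
    (\<forall>n. \<forall>A\<in>set_partitions n.
      e (ncsym_m n A) = (if A = \<top>\<^bsub>part_lattice n\<^esub> then 1 else 0)))"

definition ncsym_bialg :: "(nat list, 'k::field_char_0) bialg"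
  where "ncsym_bialg = \<lparr>bspace = ncsym_space, bmult = ncsym_mult, bunit = ncsym_m 0 {},
    bcomult = ncsym_comult, bcounit = ncsym_counit\<rparr>"

definition is_F :: "('k::field_char_0 G0_vec \<Rightarrow> 'k nc_series) \<Rightarrow> bool"
  where "is_F F \<longleftrightarrow> linear_on fscale fscale G0_space F \<and>
    (\<forall>n. \<forall>A\<in>set_partitions n. F (simple_class n A) = ncsym_x n A)"

end

theory Submission
  imports Defs
begin

text \<open>
  The algebra \<open>\<bbbk>\<Pi>\<^sub>n\<close> is separated by the characters \<open>\<chi>\<^sub>A\<close> with \<open>\<chi>\<^sub>A(C) = 1\<close> if
  \<open>A \<le> C\<close> and \<open>0\<close> otherwise, and \<open>f \<and> e\<^sub>A = \<chi>\<^sub>A(f) e\<^sub>A\<close>, so \<open>V\<^sub>A\<close> is the line on which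
  \<open>\<bbbk>\<Pi>\<^sub>n\<close> acts through \<open>\<chi>\<^sub>A\<close>. A one-dimensional module is therefore identified by its character: the
  diagonal tensor product \<open>V\<^sub>A \<otimes> V\<^sub>B\<close> has character \<open>\<chi>\<close> at the join of \<open>A\<close> and \<open>B\<close>, and since
  \<open>\<rho>(e\<^sub>A \<otimes> e\<^sub>B) = e\<close> at \<open>A|B\<close>, the module induced from \<open>V\<^sub>A \<otimes> V\<^sub>B\<close> is a line with character \<open>\<chi>\<close> at
  \<open>A|B\<close>. On the side of NCSym, the power sums satisfy \<open>p\<^sub>A p\<^sub>B = p\<close> at \<open>A|B\<close> and
  \<open>\<Delta> p\<^sub>A = p\<^sub>A \<otimes> p\<^sub>A\<close>; Moebius inversion of \<open>p\<^sub>A = \<Sum> x\<^sub>B\<close> over \<open>B \<le> A\<close> turns these into the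
  same structure constants for the \<open>x\<^sub>A\<close>.
\<close>

section \<open>Order and shifted concatenation of set partitions\<close>

text \<open>Most operations to be compared are chosen by \<open>SOME\<close> or \<open>THE\<close>:
  \<open>G0_mult\<close>, both comultiplications and counits, \<open>tensor_map\<close> and
  \<open>G0_class\<close>. Nothing can be said about them before a witness is known. For the linear
  and bilinear ones this rests on linear independence, which is detected by evaluation at dual
  points: isomorphism classes for the \<open>simple_class\<close> vectors, words with prescribed
  kernel for the \<open>ncsym_m\<close> vectors. Hence lines with different characters must be shown
  non-isomorphic, and for \<open>G0_class\<close> the composition series of a line must be shown to
  determine its class. The lines to be treated consist of vectors, of tensors or of cosets, so all
  are described by one scalar coordinate. In the induced module the decisive relation is the one
  taken at the generator t = e_A \<otimes> e_B itself. Although \<open>rho\<close> is not unital, t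
  fixes itself and \<open>rho\<close> sends it to the idempotent e at A|B; so p \<otimes> t is
  identified with \<chi>(p) e \<otimes> t, and the quotient is at most a line.\<close>

declare One_nat_def [simp del]

text \<open>The equivalence relation of a set partition. Refinement becomes inclusion of relations,
  and equality and concatenation are also checked through it.\<close>

definition same_block :: "setpart \<Rightarrow> nat \<Rightarrow> nat \<Rightarrow> bool"
  where "same_block A a b \<longleftrightarrow> (\<exists>P\<in>A. a \<in> P \<and> b \<in> P)"

text \<open>The kernel of a map on [n], used as the common source of set partitions: constant maps
  give the top, the identity the bottom, words their kernels, and class maps the restrictions of a
  partition. The codomain is arbitrary because classes themselves occur as values.\<close>

definition fibre_partition :: "nat \<Rightarrow> (nat \<Rightarrow> 'b) \<Rightarrow> setpart"
  where "fibre_partition n f = (\<lambda>c. {a\<in>{1..n}. f a = f c}) ` {1..n}"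

lemma same_block_sym: "same_block A a b \<Longrightarrow> same_block A b a"
  by (auto simp: same_block_def)

lemma same_block_refl: "A \<in> set_partitions n \<Longrightarrow> a \<in> {1..n} \<Longrightarrow> same_block A a a"
  unfolding same_block_def set_partitions_def partition_on_def by auto

lemma same_block_bounds: "A \<in> set_partitions n \<Longrightarrow> same_block A a b \<Longrightarrow> a \<in> {1..n} \<and> b \<in> {1..n}"
  unfolding same_block_def set_partitions_def partition_on_def by auto

lemma block_unique:
  assumes "A \<in> set_partitions n" "P \<in> A" "Q \<in> A" "a \<in> P" "a \<in> Q"
  shows "P = Q"
proof -
  have "disjoint A"
    using assms(1) by (simp add: set_partitions_def partition_on_def)
  with assms show ?thesis
    using disjointD[of A P Q] by blast
qed

lemma same_block_trans:
  assumes "A \<in> set_partitions n" "same_block A a b" "same_block A b c"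
  shows "same_block A a c"
proof -
  obtain P Q where "P \<in> A" "a \<in> P" "b \<in> P" "Q \<in> A" "b \<in> Q" "c \<in> Q"
    using assms by (auto simp: same_block_def)
  moreover from this have "P = Q"
    by (intro block_unique[OF assms(1)])
  ultimately show ?thesis
    by (auto simp: same_block_def)
qed

text \<open>For the converse direction, a block of \<open>A\<close> is nonempty, and the block of
  \<open>B\<close> through one of its points must absorb all the others because the blocks of
  \<open>B\<close> are disjoint.\<close>

lemma refines_iff_same_block:
  assumes A: "A \<in> set_partitions n" and B: "B \<in> set_partitions n"
  shows "refines {1..n} A B \<longleftrightarrow> (\<forall>a b. same_block A a b \<longrightarrow> same_block B a b)"
proof
  assume r: "refines {1..n} A B"
  show "\<forall>a b. same_block A a b \<longrightarrow> same_block B a b"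
  proof (intro allI impI)
    fix a b assume "same_block A a b"
    then obtain P where "P \<in> A" "a \<in> P" "b \<in> P"
      by (auto simp: same_block_def)
    moreover from this r obtain Q where "Q \<in> B" "P \<subseteq> Q"
      by (auto simp: refines_def)
    ultimately show "same_block B a b"
      by (auto simp: same_block_def)
  qed
next
  assume r: "\<forall>a b. same_block A a b \<longrightarrow> same_block B a b"
  have "\<exists>Y\<in>B. X \<subseteq> Y" if X: "X \<in> A" for X
  proof -
    obtain a where a: "a \<in> X"
      using A X unfolding set_partitions_def partition_on_def by fastforce
    with X have "same_block A a a"
      by (auto simp: same_block_def)
    with r obtain Y where Y: "Y \<in> B" "a \<in> Y"
      by (auto simp: same_block_def)
    have "b \<in> Y" if "b \<in> X" for b
    proof -
      have "same_block A a b"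
        using X a that by (auto simp: same_block_def)
      with r obtain Z where "Z \<in> B" "a \<in> Z" "b \<in> Z"
        by (auto simp: same_block_def)
      with Y show ?thesis
        using block_unique[OF B, of Y Z a] by simp
    qed
    with Y show ?thesis
      by blast
  qed
  with A B show "refines {1..n} A B"
    unfolding refines_def set_partitions_def by blast
qed

lemma set_partition_eqI:
  assumes "A \<in> set_partitions n" "B \<in> set_partitions n"
    and "\<And>a b. same_block A a b \<longleftrightarrow> same_block B a b"
  shows "A = B"
  by (rule refines_asym[of "{1..n}"]) (use assms in \<open>simp_all add: refines_iff_same_block\<close>)

lemma fibre_partition_in: "fibre_partition n f \<in> set_partitions n"
  unfolding set_partitions_def fibre_partition_def
  by (auto intro!: partition_onI simp: disjnt_def)

lemma same_block_fibre_partition: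
  "same_block (fibre_partition n f) a b \<longleftrightarrow> a \<in> {1..n} \<and> b \<in> {1..n} \<and> f a = f b"
  unfolding same_block_def fibre_partition_def by auto

text \<open>The universal property of a kernel partition. It settles the top element at once and
  later reads off the coefficients of products of power sums.\<close>

lemma refines_fibre_partition_iff:
  assumes "A \<in> set_partitions n"
  shows "refines {1..n} A (fibre_partition n f) \<longleftrightarrow> (\<forall>a b. same_block A a b \<longrightarrow> f a = f b)"
  using assms same_block_bounds[OF assms]
  by (auto simp: refines_iff_same_block fibre_partition_in same_block_fibre_partition)

lemma refines_self: "A \<in> set_partitions n \<Longrightarrow> refines {1..n} A A"
  by (simp add: refines_refl set_partitions_def)

lemma finite_lower: "finite {B. refines {1..n::nat} B A}"
  by (rule finite_subset[OF _ finite_set_partitions[of n]]) (use refines_in_set_partitions in blast)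

lemma finite_upper: "finite {B. refines {1..n::nat} A B}"
  by (rule finite_subset[OF _ finite_set_partitions[of n]]) (use refines_in_set_partitions in blast)

lemma finite_interval: "finite {C. refines {1..n::nat} A C \<and> refines {1..n} C B}"
  by (rule finite_subset[OF _ finite_lower[of n B]]) blast

text \<open>The order-theoretic top is a choice among greatest elements, so a concrete greatest
  element has to be exhibited before the choice has any property. Bottom and meet are handled in the
  same way.\<close>

lemma part_lattice_top:
  "\<top>\<^bsub>part_lattice n\<^esub> \<in> set_partitions n \<and> (\<forall>A\<in>set_partitions n. refines {1..n} A \<top>\<^bsub>part_lattice n\<^esub>)"
proof -
  have "greatest (part_lattice n) (fibre_partition n (\<lambda>_. ())) (carrier (part_lattice n))"
    by (auto simp: greatest_def part_lattice_def fibre_partition_in refines_fibre_partition_iff)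
  then have "greatest (part_lattice n) \<top>\<^bsub>part_lattice n\<^esub> (carrier (part_lattice n))"
    unfolding top_def by (rule someI)
  then show ?thesis
    by (auto simp: greatest_def part_lattice_def)
qed

lemma part_lattice_bottom:
  "\<bottom>\<^bsub>part_lattice n\<^esub> \<in> set_partitions n \<and> (\<forall>A\<in>set_partitions n. refines {1..n} \<bottom>\<^bsub>part_lattice n\<^esub> A)"
proof -
  have "least (part_lattice n) (fibre_partition n id) (carrier (part_lattice n))"
    by (auto simp: least_def part_lattice_def fibre_partition_in refines_iff_same_block
        same_block_fibre_partition intro: same_block_refl)
  then have "least (part_lattice n) \<bottom>\<^bsub>part_lattice n\<^esub> (carrier (part_lattice n))"
    unfolding bottom_def by (rule someI)
  then show ?thesis
    by (auto simp: least_def part_lattice_def)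
qed

lemma part_lattice_meet:
  assumes A: "A \<in> set_partitions n" and B: "B \<in> set_partitions n"
  shows meet_in: "A \<sqinter>\<^bsub>part_lattice n\<^esub> B \<in> set_partitions n"
    and refines_meet_iff: "refines {1..n} C (A \<sqinter>\<^bsub>part_lattice n\<^esub> B) \<longleftrightarrow> refines {1..n} C A \<and> refines {1..n} C B"
proof -
  let ?L = "part_lattice n"
  let ?M = "common_refinement {A, B}"
  have part: "P \<in> {A, B} \<Longrightarrow> partition_on {1..n} P" for P
    using A B by (auto simp: set_partitions_def)
  have "?M \<in> set_partitions n"
    using partition_on_common_refinement[of "{A, B}"] part by (simp add: set_partitions_def)
  moreover have "refines {1..n} ?M A" "refines {1..n} ?M B"
    by (rule refines_common_refinement[OF part]; simp)+
  moreover have "refines {1..n} C ?M" if "refines {1..n} C A" "refines {1..n} C B" for C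
    using that by (intro common_refinement_coarsest[OF part]) (auto simp: refines_def)
  ultimately have "greatest ?L ?M (Lower ?L {A, B})"
    using A B by (auto simp: greatest_def part_lattice_def Lower_def)
  then have "greatest ?L (A \<sqinter>\<^bsub>?L\<^esub> B) (Lower ?L {A, B})"
    unfolding meet_def inf_def by (rule someI)
  then have g: "A \<sqinter>\<^bsub>?L\<^esub> B \<in> set_partitions n" "refines {1..n} (A \<sqinter>\<^bsub>?L\<^esub> B) A"
      "refines {1..n} (A \<sqinter>\<^bsub>?L\<^esub> B) B"
    and le: "\<And>C. refines {1..n} C A \<Longrightarrow> refines {1..n} C B \<Longrightarrow> refines {1..n} C (A \<sqinter>\<^bsub>?L\<^esub> B)"
    using A B refines_in_set_partitions by (auto simp: greatest_def part_lattice_def Lower_def)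
  show "A \<sqinter>\<^bsub>?L\<^esub> B \<in> set_partitions n"
    by (rule g)
  show "refines {1..n} C (A \<sqinter>\<^bsub>?L\<^esub> B) \<longleftrightarrow> refines {1..n} C A \<and> refines {1..n} C B"
    using g le refines_trans by blast
qed

text \<open>The infimum of all common upper bounds, a family that the top element keeps nonempty.
  This avoids computing the transitive closure of the union of two equivalence relations.\<close>

definition part_join :: "nat \<Rightarrow> setpart \<Rightarrow> setpart \<Rightarrow> setpart"
  where "part_join n A B = common_refinement {C. refines {1..n} A C \<and> refines {1..n} B C}"

lemma part_join:
  assumes A: "A \<in> set_partitions n" and B: "B \<in> set_partitions n"
  shows part_join_in: "part_join n A B \<in> set_partitions n"
    and part_join_refines_iff: "refines {1..n} (part_join n A B) C \<longleftrightarrow> refines {1..n} A C \<and> refines {1..n} B C"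
proof -
  let ?U = "{C. refines {1..n} A C \<and> refines {1..n} B C}"
  have part: "P \<in> ?U \<Longrightarrow> partition_on {1..n} P" for P
    by (auto simp: refines_def)
  have ne: "?U \<noteq> {}"
    using A B part_lattice_top[of n] by blast
  show "part_join n A B \<in> set_partitions n"
    using partition_on_common_refinement[of ?U, OF part ne] by (simp add: set_partitions_def part_join_def)
  have up: "refines {1..n} A (part_join n A B)" "refines {1..n} B (part_join n A B)"
    unfolding part_join_def using A B
    by (intro common_refinement_coarsest[OF part _ _ ne]; auto simp: set_partitions_def)+
  have low: "refines {1..n} (part_join n A B) C" if "refines {1..n} A C" "refines {1..n} B C"
    unfolding part_join_def by (rule refines_common_refinement[OF part]) (use that in auto)
  show "refines {1..n} (part_join n A B) C \<longleftrightarrow> refines {1..n} A C \<and> refines {1..n} B C"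
    using up low refines_trans by blast
qed

section \<open>Shifted concatenation as an order embedding onto a product of lower sets\<close>

lemma same_block_concat:
  "same_block (part_concat n A B) a b \<longleftrightarrow>
    same_block A a b \<or> (n \<le> a \<and> n \<le> b \<and> same_block B (a - n) (b - n))"
proof -
  \<comment> \<open>Truncated subtraction forces the guards \<open>n \<le> a\<close> and
    \<open>n \<le> b\<close>. The boundary value \<open>a = n\<close> does no harm for partitions of
    [m], since 0 lies in none of their blocks.\<close>
  have "(\<exists>P\<in>B. a \<in> (\<lambda>i. i + n) ` P \<and> b \<in> (\<lambda>i. i + n) ` P) \<longleftrightarrow>
      n \<le> a \<and> n \<le> b \<and> same_block B (a - n) (b - n)"
  proof -
    have "a \<in> (\<lambda>i. i + n) ` P \<longleftrightarrow> n \<le> a \<and> a - n \<in> P" for a and P :: "nat set"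
      by (auto simp: image_iff intro!: bexI[of _ "a - n"])
    then show ?thesis
      unfolding same_block_def by auto
  qed
  moreover have "same_block (part_concat n A B) a b \<longleftrightarrow>
      same_block A a b \<or> (\<exists>P\<in>B. a \<in> (\<lambda>i. i + n) ` P \<and> b \<in> (\<lambda>i. i + n) ` P)"
    unfolding part_concat_def same_block_def bex_Un by (simp only: bex_simps)
  ultimately show ?thesis
    by simp
qed

lemma part_concat_in:
  assumes A: "A \<in> set_partitions n" and B: "B \<in> set_partitions m"
  shows "part_concat n A B \<in> set_partitions (n + m)"
proof -
  have UA: "\<Union>A = {1..n}" "\<Union>B = {1..m}" and ne: "{} \<notin> A" "{} \<notin> B"
    using A B by (auto simp: set_partitions_def partition_on_def)
  have sub: "P \<in> A \<Longrightarrow> P \<subseteq> {1..n}" "P \<in> B \<Longrightarrow> P \<subseteq> {1..m}" for P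
    using UA by auto
  have "\<Union>(part_concat n A B) = {1..n} \<union> (\<lambda>i. i + n) ` {1..m}"
    unfolding part_concat_def UA[symmetric] by blast
  also have "\<dots> = {1..n + m}"
    by (auto simp: image_iff intro!: bexI[of _ "_ - n"])
  finally have U: "\<Union>(part_concat n A B) = {1..n + m}" .
  have "disjnt P Q" if "P \<in> part_concat n A B" "Q \<in> part_concat n A B" "P \<noteq> Q" for P Q
  proof -
    have dA: "disjnt P Q" if "P \<in> A" "Q \<in> A" "P \<noteq> Q" for P Q
      using A that by (auto simp: set_partitions_def partition_on_def disjoint_def disjnt_def)
    have dB: "disjnt P Q" if "P \<in> B" "Q \<in> B" "P \<noteq> Q" for P Q
      using B that by (auto simp: set_partitions_def partition_on_def disjoint_def disjnt_def)
    have dAB: "disjnt P ((\<lambda>i. i + n) ` Q)" if "P \<in> A" "Q \<in> B" for P Q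
      using sub(1)[OF that(1)] sub(2)[OF that(2)] by (fastforce simp: disjnt_def)
    have dBB: "disjnt ((\<lambda>i. i + n) ` P) ((\<lambda>i. i + n) ` Q)" if "P \<in> B" "Q \<in> B" "P \<noteq> Q" for P Q
      using dB[OF that] by (auto simp: disjnt_def)
    show ?thesis
      using that unfolding part_concat_def
      by (elim UnE imageE) (metis dA, metis dAB, metis dAB disjnt_sym, metis dBB)
  qed
  moreover have "{} \<notin> part_concat n A B"
    using ne by (auto simp: part_concat_def)
  ultimately show ?thesis
    using U unfolding set_partitions_def by (blast intro: partition_onI)
qed

lemma concat_refines_concat_iff:
  assumes A: "A \<in> set_partitions n" and B: "B \<in> set_partitions m"
    and C: "C \<in> set_partitions n" and D: "D \<in> set_partitions m"
  shows "refines {1..n + m} (part_concat n A B) (part_concat n C D) \<longleftrightarrow>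
    refines {1..n} A C \<and> refines {1..m} B D"
proof -
  \<comment> \<open>Labels related by \<open>A\<close> or \<open>C\<close> are at most
    \<open>n\<close>, while those related by \<open>B\<close> or \<open>D\<close> are at least 1 and
    hence exceed \<open>n\<close> after the shift. So the two alternatives for a concatenation never
    mix.\<close>
  have 1: "same_block A a b \<Longrightarrow> a \<le> n \<and> b \<le> n" "same_block C a b \<Longrightarrow> a \<le> n \<and> b \<le> n" for a b
    using same_block_bounds[OF A] same_block_bounds[OF C] by auto
  have 2: "same_block B a b \<Longrightarrow> 1 \<le> a \<and> 1 \<le> b" "same_block D a b \<Longrightarrow> 1 \<le> a \<and> 1 \<le> b" for a b
    using same_block_bounds[OF B] same_block_bounds[OF D] by auto
  show ?thesis
    unfolding refines_iff_same_block[OF A C] refines_iff_same_block[OF B D]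
      refines_iff_same_block[OF part_concat_in[OF A B] part_concat_in[OF C D]] same_block_concat
  proof (intro iffI conjI allI impI)
    fix a b
    assume h: "\<forall>a b. same_block A a b \<or> n \<le> a \<and> n \<le> b \<and> same_block B (a - n) (b - n) \<longrightarrow>
      same_block C a b \<or> n \<le> a \<and> n \<le> b \<and> same_block D (a - n) (b - n)"
    show "same_block C a b" if "same_block A a b"
      using h[rule_format, of a b] 1(1)[OF that] 2(2)[of "a - n" "b - n"] that by auto
    show "same_block D a b" if "same_block B a b"
      using h[rule_format, of "a + n" "b + n"] 2(1)[OF that] 1(2)[of "a + n" "b + n"] that by auto
  qed auto
qed

lemma part_concat_inject:
  assumes "A \<in> set_partitions n" "B \<in> set_partitions m" "C \<in> set_partitions n" "D \<in> set_partitions m"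
    and "part_concat n A B = part_concat n C D"
  shows "A = C \<and> B = D"
  using concat_refines_concat_iff[of A n B m C D] concat_refines_concat_iff[of C n D m A B] assms
    refines_self[OF part_concat_in[of A n B m]] refines_asym by metis

text \<open>Below A|B no block can contain both an unshifted and a shifted label, so
  \<open>E\<close> is the concatenation of its two restrictions. With the order embedding above, the
  lower set of A|B is the product of the lower sets of \<open>A\<close> and
  \<open>B\<close>.\<close>

lemma refines_concatE:
  assumes A: "A \<in> set_partitions n" and B: "B \<in> set_partitions m"
    and E: "refines {1..n + m} E (part_concat n A B)"
  obtains C D where "refines {1..n} C A" "refines {1..m} D B" "E = part_concat n C D"
proof -
  have Ein: "E \<in> set_partitions (n + m)"
    using E refines_in_set_partitions by blast
  \<comment> \<open>The restrictions of \<open>E\<close> to the first \<open>n\<close> and the last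
    \<open>m\<close> labels, obtained as kernels of the map that sends a label to its class in
    \<open>E\<close>.\<close>
  define C where "C = fibre_partition n (\<lambda>a. {b. same_block E a b})"
  define D where "D = fibre_partition m (\<lambda>a. {b. same_block E (a + n) b})"
  have C: "C \<in> set_partitions n" and D: "D \<in> set_partitions m"
    by (simp_all add: C_def D_def fibre_partition_in)
  have eqE: "{c. same_block E a c} = {c. same_block E b c} \<longleftrightarrow> same_block E a b"
    if "a \<in> {1..n + m}" "b \<in> {1..n + m}" for a b
    using same_block_trans[OF Ein] same_block_sym[of E] same_block_refl[OF Ein that(2)] by blast
  have sC: "same_block C a b \<longleftrightarrow> a \<in> {1..n} \<and> b \<in> {1..n} \<and> same_block E a b" for a b
    unfolding C_def same_block_fibre_partition using eqE[of a b] by auto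
  have sD: "same_block D a b \<longleftrightarrow> a \<in> {1..m} \<and> b \<in> {1..m} \<and> same_block E (a + n) (b + n)" for a b
    unfolding D_def same_block_fibre_partition using eqE[of "a + n" "b + n"] by auto
  have split: "same_block A a b \<or> n \<le> a \<and> n \<le> b \<and> same_block B (a - n) (b - n)" if "same_block E a b" for a b
    using E that refines_iff_same_block[OF Ein part_concat_in[OF A B]] by (simp add: same_block_concat)
  have "E = part_concat n C D"
  proof (rule set_partition_eqI[OF Ein part_concat_in[OF C D]])
    fix a b
    show "same_block E a b \<longleftrightarrow> same_block (part_concat n C D) a b"
      using split[of a b] same_block_bounds[OF A, of a b] same_block_bounds[OF B, of "a - n" "b - n"]
      by (auto simp: same_block_concat sC sD)
  qed
  with E concat_refines_concat_iff[OF C D A B] that show thesis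
    by blast
qed

section \<open>Moebius inversion\<close>

lemma moebius_refl [simp]: "A \<in> set_partitions n \<Longrightarrow> moebius n A A = 1"
  by (simp add: moebius.simps refines_self)

lemma sum_moebius_lower_fixed:
  assumes "refines {1..n} A B"
  shows "(\<Sum>C | refines {1..n} A C \<and> refines {1..n} C B. moebius n A C) = (if A = B then 1 else 0)"
proof (cases "A = B")
  case True
  then have "{C. refines {1..n} A C \<and> refines {1..n} C B} = {A}"
    using assms refines_asym by blast
  with True show ?thesis
    using assms refines_in_set_partitions by simp
next
  case False
  let ?I = "{C. refines {1..n} A C \<and> refines {1..n} C B}"
  have "B \<in> ?I"
    using assms refines_in_set_partitions refines_self by blast
  moreover have "{C. refines {1..n} A C \<and> refines {1..n} C B \<and> C \<noteq> B} = ?I - {B}"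
    by blast
  ultimately show ?thesis
    using False assms by (simp add: sum.remove[OF finite_interval] moebius.simps[of n A B])
qed

text \<open>The recursion defining the Moebius function makes it a right inverse of the zeta function;
  being triangular, it is also a left inverse.\<close>

lemma sum_moebius_upper_fixed:
  assumes "refines {1..n} A B"
  shows "(\<Sum>C | refines {1..n} A C \<and> refines {1..n} C B. moebius n C B) = (if A = B then 1 else 0)"
  using assms
proof (induction "card {C. refines {1..n} A C \<and> refines {1..n} C B}" arbitrary: A rule: less_induct)
  case less
  let ?le = "refines {1..n}"
  let ?I = "\<lambda>A. {C. ?le A C \<and> ?le C B}"
  define g where "g A = (\<Sum>C\<in>?I A. moebius n C B)" for A
  have AA: "A \<in> ?I A"
    using less.prems refines_in_set_partitions refines_self by blast
  have IH: "g C = (if C = B then 1 else 0)" if "C \<in> ?I A - {A}" for C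
  proof -
    have "?I C \<subseteq> ?I A"
      using that refines_trans by blast
    moreover have "A \<notin> ?I C"
      using that refines_asym by blast
    ultimately have "?I C \<subset> ?I A"
      using AA by blast
    then have "card (?I C) < card (?I A)"
      using finite_interval by (rule psubset_card_mono[rotated])
    with less.hyps[of C] that show ?thesis
      by (simp add: g_def)
  qed
  \<comment> \<open>The convolution mu * zeta * mu at (A, B) is bracketed in two ways. One
    bracketing gives mu(A, B), because mu * zeta is already the identity; in the other every inner
    sum \<open>g C\<close> is known by induction except the one at \<open>C = A\<close>, whose value
    is thereby forced.\<close>
  have "moebius n A B = (\<Sum>D\<in>?I A. (if A = D then 1 else 0) * moebius n D B)"
    using AA by (simp add: if_distrib[of "\<lambda>x. x * _"] sum.delta' finite_interval cong: if_cong)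
  also have "\<dots> = (\<Sum>D\<in>?I A. \<Sum>C | ?le A C \<and> ?le C D. moebius n A C * moebius n D B)"
    by (intro sum.cong refl, subst sum_moebius_lower_fixed[symmetric]) (auto simp: sum_distrib_right)
  also have "\<dots> = (\<Sum>C\<in>?I A. \<Sum>D\<in>?I C. moebius n A C * moebius n D B)"
  proof -
    have "(\<Sum>D\<in>?I A. \<Sum>C | ?le A C \<and> ?le C D. moebius n A C * moebius n D B) =
        (\<Sum>(D, C)\<in>Sigma (?I A) (\<lambda>D. {C. ?le A C \<and> ?le C D}). moebius n A C * moebius n D B)"
      by (rule sum.Sigma) (auto intro: finite_interval)
    also have "\<dots> = (\<Sum>(C, D)\<in>Sigma (?I A) ?I. moebius n A C * moebius n D B)"
      by (rule sum.reindex_bij_witness[of _ "\<lambda>(a, b). (b, a)" "\<lambda>(a, b). (b, a)"])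
        (auto intro: refines_trans)
    also have "\<dots> = (\<Sum>C\<in>?I A. \<Sum>D\<in>?I C. moebius n A C * moebius n D B)"
      by (rule sum.Sigma[symmetric]) (auto intro: finite_interval)
    finally show ?thesis .
  qed
  also have "\<dots> = (\<Sum>C\<in>?I A. moebius n A C * g C)"
    by (simp add: g_def sum_distrib_left)
  also have "\<dots> = g A + (\<Sum>C\<in>?I A - {A}. moebius n A C * (if C = B then 1 else 0))"
  proof -
    have "(\<Sum>C\<in>?I A - {A}. moebius n A C * g C) =
        (\<Sum>C\<in>?I A - {A}. moebius n A C * (if C = B then 1 else 0))"
      by (intro sum.cong refl arg_cong[where f = "\<lambda>x. _ * x"] IH)
    moreover have "A \<in> set_partitions n"
      using less.prems refines_in_set_partitions by blast
    ultimately show ?thesis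
      using AA by (simp only: sum.remove[OF finite_interval AA] moebius_refl mult_1)
  qed
  finally have eq: "moebius n A B = g A + (\<Sum>C\<in>?I A - {A}. moebius n A C * (if C = B then 1 else 0))" .
  have "(\<Sum>C\<in>?I A - {A}. moebius n A C * (if C = B then 1 else 0)) = (if A = B then 0 else moebius n A B)"
  proof (cases "A = B")
    case True
    then show ?thesis
      by (auto intro!: sum.neutral)
  next
    case False
    have "B \<in> ?I A - {A}"
      using less.prems refines_in_set_partitions refines_self False by blast
    with False show ?thesis
      using finite_interval[of n A B] by (subst sum.remove[of _ B]) (auto intro!: sum.neutral)
  qed
  with eq have "g A = (if A = B then 1 else 0)"
    using AA refines_in_set_partitions by (auto split: if_splits)
  then show ?case
    by (simp add: g_def)
qed

lemma fscale_sum_left: "fscale (sum c I) v = (\<Sum>i\<in>I. fscale (c i) v)"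
  by (rule fvs.scale_sum_left)

lemma sum_swap_refines:
  fixes f :: "setpart \<Rightarrow> setpart \<Rightarrow> 'x::comm_monoid_add"
  shows "(\<Sum>B | refines {1..n} B A. \<Sum>C | refines {1..n} C B. f B C) =
    (\<Sum>C | refines {1..n} C A. \<Sum>B | refines {1..n} C B \<and> refines {1..n} B A. f B C)"
proof -
  let ?le = "refines {1..n}"
  have "(\<Sum>B | ?le B A. \<Sum>C | ?le C B. f B C) = (\<Sum>(B, C)\<in>Sigma {B. ?le B A} (\<lambda>B. {C. ?le C B}). f B C)"
    by (rule sum.Sigma) (auto intro: finite_lower)
  also have "\<dots> = (\<Sum>(C, B)\<in>Sigma {C. ?le C A} (\<lambda>C. {B. ?le C B \<and> ?le B A}). f B C)"
    by (rule sum.reindex_bij_witness[of _ "\<lambda>(a, b). (b, a)" "\<lambda>(a, b). (b, a)"])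
      (auto intro: refines_trans)
  also have "\<dots> = (\<Sum>C | ?le C A. \<Sum>B | ?le C B \<and> ?le B A. f B C)"
    by (rule sum.Sigma[symmetric]) (auto intro: finite_lower finite_interval)
  finally show ?thesis .
qed

lemma sum_swap_refines_upper:
  fixes f :: "setpart \<Rightarrow> setpart \<Rightarrow> 'x::comm_monoid_add"
  shows "(\<Sum>B | refines {1..n} A B. \<Sum>C | refines {1..n} B C. f B C) =
    (\<Sum>C | refines {1..n} A C. \<Sum>B | refines {1..n} A B \<and> refines {1..n} B C. f B C)"
proof -
  let ?le = "refines {1..n}"
  have "(\<Sum>B | ?le A B. \<Sum>C | ?le B C. f B C) = (\<Sum>(B, C)\<in>Sigma {B. ?le A B} (\<lambda>B. {C. ?le B C}). f B C)"
    by (rule sum.Sigma) (auto intro: finite_upper)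
  also have "\<dots> = (\<Sum>(C, B)\<in>Sigma {C. ?le A C} (\<lambda>C. {B. ?le A B \<and> ?le B C}). f B C)"
    by (rule sum.reindex_bij_witness[of _ "\<lambda>(a, b). (b, a)" "\<lambda>(a, b). (b, a)"])
      (auto intro: refines_trans)
  also have "\<dots> = (\<Sum>C | ?le A C. \<Sum>B | ?le A B \<and> ?le B C. f B C)"
    by (rule sum.Sigma[symmetric]) (auto intro: finite_upper finite_interval)
  finally show ?thesis .
qed

lemma sum_if_eq_scaled:
  assumes "finite I" "a \<in> I"
  shows "(\<Sum>i\<in>I. fscale (if i = a then 1 else 0) (g i)) = g a"
  using assms by (subst sum.remove[of _ a]) (auto intro!: sum.neutral)

lemma moebius_inversion_lower:
  fixes f g :: "setpart \<Rightarrow> 'x \<Rightarrow> 'k::field_char_0"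
  assumes A: "A \<in> set_partitions n"
    and f: "\<And>B. refines {1..n} B A \<Longrightarrow> f B = (\<Sum>C | refines {1..n} C B. g C)"
  shows "(\<Sum>B | refines {1..n} B A. fscale (of_int (moebius n B A)) (f B)) = g A"
proof -
  let ?le = "refines {1..n}"
  have "(\<Sum>B | ?le B A. fscale (of_int (moebius n B A)) (f B)) =
      (\<Sum>B | ?le B A. \<Sum>C | ?le C B. fscale (of_int (moebius n B A)) (g C))"
    by (intro sum.cong refl) (simp add: f fvs.scale_sum_right)
  also have "\<dots> = (\<Sum>C | ?le C A. \<Sum>B | ?le C B \<and> ?le B A. fscale (of_int (moebius n B A)) (g C))"
    by (rule sum_swap_refines)
  also have "\<dots> = (\<Sum>C | ?le C A. fscale (of_int (\<Sum>B | ?le C B \<and> ?le B A. moebius n B A)) (g C))"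
    by (simp add: fscale_sum_left)
  also have "\<dots> = (\<Sum>C | ?le C A. fscale (if C = A then 1 else 0) (g C))"
    by (intro sum.cong refl) (simp add: sum_moebius_upper_fixed)
  also have "\<dots> = g A"
    using A by (intro sum_if_eq_scaled finite_lower) (simp add: refines_self)
  finally show ?thesis .
qed

lemma moebius_inversion_upper:
  fixes f g :: "setpart \<Rightarrow> 'x \<Rightarrow> 'k::field_char_0"
  assumes A: "A \<in> set_partitions n"
    and f: "\<And>B. refines {1..n} A B \<Longrightarrow> f B = (\<Sum>C | refines {1..n} B C. g C)"
  shows "(\<Sum>B | refines {1..n} A B. fscale (of_int (moebius n A B)) (f B)) = g A"
proof -
  let ?le = "refines {1..n}"
  have "(\<Sum>B | ?le A B. fscale (of_int (moebius n A B)) (f B)) =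
      (\<Sum>B | ?le A B. \<Sum>C | ?le B C. fscale (of_int (moebius n A B)) (g C))"
    by (intro sum.cong refl) (simp add: f fvs.scale_sum_right)
  also have "\<dots> = (\<Sum>C | ?le A C. \<Sum>B | ?le A B \<and> ?le B C. fscale (of_int (moebius n A B)) (g C))"
    by (rule sum_swap_refines_upper)
  also have "\<dots> = (\<Sum>C | ?le A C. fscale (of_int (\<Sum>B | ?le A B \<and> ?le B C. moebius n A B)) (g C))"
    by (simp add: fscale_sum_left)
  also have "\<dots> = (\<Sum>C | ?le A C. fscale (if C = A then 1 else 0) (g C))"
    by (intro sum.cong refl) (simp add: sum_moebius_lower_fixed)
  also have "\<dots> = g A"
    using A by (intro sum_if_eq_scaled finite_upper) (simp add: refines_self)
  finally show ?thesis .
qed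

text \<open>Recovering \<open>f\<close> from its transform rests on the other of the two inverse
  relations between mu and zeta.\<close>

lemma moebius_inversion_lower_converse:
  fixes f g :: "setpart \<Rightarrow> 'x \<Rightarrow> 'k::field_char_0"
  assumes A: "A \<in> set_partitions n"
    and g: "\<And>B. refines {1..n} B A \<Longrightarrow>
      g B = (\<Sum>C | refines {1..n} C B. fscale (of_int (moebius n C B)) (f C))"
  shows "(\<Sum>B | refines {1..n} B A. g B) = f A"
proof -
  let ?le = "refines {1..n}"
  have "(\<Sum>B | ?le B A. g B) = (\<Sum>B | ?le B A. \<Sum>C | ?le C B. fscale (of_int (moebius n C B)) (f C))"
    by (intro sum.cong refl) (simp add: g)
  also have "\<dots> = (\<Sum>C | ?le C A. \<Sum>B | ?le C B \<and> ?le B A. fscale (of_int (moebius n C B)) (f C))"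
    by (rule sum_swap_refines)
  also have "\<dots> = (\<Sum>C | ?le C A. fscale (of_int (\<Sum>B | ?le C B \<and> ?le B A. moebius n C B)) (f C))"
    by (simp add: fscale_sum_left)
  also have "\<dots> = (\<Sum>C | ?le C A. fscale (if C = A then 1 else 0) (f C))"
    by (intro sum.cong refl) (simp add: sum_moebius_lower_fixed)
  also have "\<dots> = f A"
    using A by (intro sum_if_eq_scaled finite_lower) (simp add: refines_self)
  finally show ?thesis .
qed

lemma moebius_inversion_upper_converse:
  fixes f g :: "setpart \<Rightarrow> 'x \<Rightarrow> 'k::field_char_0"
  assumes A: "A \<in> set_partitions n"
    and g: "\<And>B. refines {1..n} A B \<Longrightarrow>
      g B = (\<Sum>C | refines {1..n} B C. fscale (of_int (moebius n B C)) (f C))"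
  shows "(\<Sum>B | refines {1..n} A B. g B) = f A"
proof -
  let ?le = "refines {1..n}"
  have "(\<Sum>B | ?le A B. g B) = (\<Sum>B | ?le A B. \<Sum>C | ?le B C. fscale (of_int (moebius n B C)) (f C))"
    by (intro sum.cong refl) (simp add: g)
  also have "\<dots> = (\<Sum>C | ?le A C. \<Sum>B | ?le A B \<and> ?le B C. fscale (of_int (moebius n B C)) (f C))"
    by (rule sum_swap_refines_upper)
  also have "\<dots> = (\<Sum>C | ?le A C. fscale (of_int (\<Sum>B | ?le A B \<and> ?le B C. moebius n B C)) (f C))"
    by (simp add: fscale_sum_left)
  also have "\<dots> = (\<Sum>C | ?le A C. fscale (if C = A then 1 else 0) (f C))"
    by (intro sum.cong refl) (simp add: sum_moebius_upper_fixed)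
  also have "\<dots> = f A"
    using A by (intro sum_if_eq_scaled finite_upper) (simp add: refines_self)
  finally show ?thesis .
qed

lemma sum_lower_concat:
  assumes A: "A \<in> set_partitions n" and B: "B \<in> set_partitions m"
  shows "(\<Sum>E | refines {1..n + m} E (part_concat n A B). g E) =
    (\<Sum>C | refines {1..n} C A. \<Sum>D | refines {1..m} D B. g (part_concat n C D))"
proof -
  let ?S = "{C. refines {1..n} C A} \<times> {D. refines {1..m} D B}"
  have inp: "C \<in> set_partitions n \<and> D \<in> set_partitions m" if "(C, D) \<in> ?S" for C D
    using that refines_in_set_partitions by blast
  have "bij_betw (\<lambda>(C, D). part_concat n C D) ?S {E. refines {1..n + m} E (part_concat n A B)}"
  proof (intro bij_betwI')
    fix x y assume "x \<in> ?S" "y \<in> ?S"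
    then show "((case x of (C, D) \<Rightarrow> part_concat n C D) = (case y of (C, D) \<Rightarrow> part_concat n C D)) = (x = y)"
      using inp[of "fst x" "snd x"] inp[of "fst y" "snd y"] part_concat_inject[of "fst x" n "snd x" m "fst y" "snd y"]
      by (simp add: case_prod_beta prod_eq_iff) metis
  next
    fix x assume "x \<in> ?S"
    then show "(case x of (C, D) \<Rightarrow> part_concat n C D) \<in> {E. refines {1..n + m} E (part_concat n A B)}"
      using concat_refines_concat_iff[OF _ _ A B] inp by (auto split: prod.splits)
  next
    fix E assume "E \<in> {E. refines {1..n + m} E (part_concat n A B)}"
    then show "\<exists>x\<in>?S. E = (case x of (C, D) \<Rightarrow> part_concat n C D)"
      using refines_concatE[OF A B] by (metis (no_types, lifting) SigmaI mem_Collect_eq case_prod_conv)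
  qed
  from sum.reindex_bij_betw[OF this, of g] show ?thesis
    by (simp add: sum.cartesian_product case_prod_beta)
qed

text \<open>Inversion on the two factors separately suffices; no product formula for the Moebius
  function is needed.\<close>

lemma moebius_inversion_concat:
  fixes f :: "setpart \<Rightarrow> 'x \<Rightarrow> 'k::field_char_0" and g :: "setpart \<Rightarrow> setpart \<Rightarrow> 'x \<Rightarrow> 'k"
  assumes A: "A \<in> set_partitions n" and B: "B \<in> set_partitions m"
    and f: "\<And>C D. C \<in> set_partitions n \<Longrightarrow> D \<in> set_partitions m \<Longrightarrow>
      f (part_concat n C D) = (\<Sum>C' | refines {1..n} C' C. \<Sum>D' | refines {1..m} D' D. g C' D')"
  shows "(\<Sum>E | refines {1..n + m} E (part_concat n A B).
      fscale (of_int (moebius (n + m) E (part_concat n A B))) (f E)) = g A B"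
proof -
  \<comment> \<open>The inverse of concatenation on its image, well defined by
    \<open>part_concat_inject\<close>. It turns \<open>g\<close>, a function of pairs, into a
    function of partitions of [n+m], to which ordinary inversion applies.\<close>
  define dec where "dec E = (THE p. fst p \<in> set_partitions n \<and> snd p \<in> set_partitions m \<and>
    E = part_concat n (fst p) (snd p))" for E
  have dec: "dec (part_concat n C D) = (C, D)" if "C \<in> set_partitions n" "D \<in> set_partitions m" for C D
  proof -
    have "p = (C, D)" if "fst p \<in> set_partitions n \<and> snd p \<in> set_partitions m \<and>
        part_concat n C D = part_concat n (fst p) (snd p)" for p
      using that part_concat_inject[of C n D m "fst p" "snd p"] \<open>C \<in> _\<close> \<open>D \<in> _\<close> by (simp add: prod_eq_iff)
    then show ?thesis
      unfolding dec_def using that by (intro the_equality) simp_all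
  qed
  let ?g = "\<lambda>E. g (fst (dec E)) (snd (dec E))"
  have "(\<Sum>E | refines {1..n + m} E (part_concat n A B).
      fscale (of_int (moebius (n + m) E (part_concat n A B))) (f E)) = ?g (part_concat n A B)"
  proof (rule moebius_inversion_lower[OF part_concat_in[OF A B]])
    fix E assume "refines {1..n + m} E (part_concat n A B)"
    then obtain C D where E: "E = part_concat n C D" and C: "C \<in> set_partitions n" and D: "D \<in> set_partitions m"
      using refines_concatE[OF A B] refines_in_set_partitions by metis
    show "f E = (\<Sum>F | refines {1..n + m} F E. ?g F)"
      unfolding E f[OF C D] sum_lower_concat[OF C D]
      by (intro sum.cong refl) (auto dest!: refines_in_set_partitions simp: dec)
  qed
  then show ?thesis
    using dec[OF A B] by simp
qed

section \<open>Linear algebra in function spaces\<close>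

lemma fscale_apply: "fscale c f x = c * f x"
  by (simp add: fscale_def)

lemma fun_sum_apply: "(\<Sum>i\<in>I. f i) x = (\<Sum>i\<in>I. f i x)"
  by (induction I rule: infinite_finite_induct) auto

lemma delta_apply: "delta x y = (if y = x then 1 else 0)"
  by (simp add: delta_def)

lemma tensor_apply: "tensor f g (x, y) = f x * g y"
  by (simp add: tensor_def)

lemma tensor_add_left: "tensor (f + g) h = tensor f h + tensor g h"
  and tensor_add_right: "tensor h (f + g) = tensor h f + tensor h g"
  and tensor_scale_left: "tensor (fscale c f) h = fscale c (tensor f h)"
  and tensor_scale_right: "tensor h (fscale c f) = fscale c (tensor h f)"
  and tensor_zero_left: "tensor 0 h = 0"
  and tensor_zero_right: "tensor h 0 = 0"
  by (auto simp: tensor_def fscale_def fun_eq_iff algebra_simps)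

lemma tensor_diff_left: "tensor (f - g) h = tensor f h - tensor g h"
  by (auto simp: tensor_def fun_eq_iff algebra_simps)

lemma tensor_sum_left: "tensor (\<Sum>i\<in>I. f i) h = (\<Sum>i\<in>I. tensor (f i) h)"
  by (induction I rule: infinite_finite_induct) (simp_all only: sum.infinite sum.empty sum.insert tensor_zero_left tensor_add_left not_False_eq_True)

lemma tensor_sum_right: "tensor h (\<Sum>i\<in>I. f i) = (\<Sum>i\<in>I. tensor h (f i))"
  by (induction I rule: infinite_finite_induct) (simp_all only: sum.infinite sum.empty sum.insert tensor_zero_right tensor_add_right not_False_eq_True)

lemma span_delta:
  assumes "finite S"
  shows "fvs.span (delta ` S) = {f :: 'x \<Rightarrow> 'k::field. \<forall>x. x \<notin> S \<longrightarrow> f x = 0}"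
proof (intro equalityI subsetI)
  fix f :: "'x \<Rightarrow> 'k"
  assume "f \<in> fvs.span (delta ` S)"
  then show "f \<in> {f. \<forall>x. x \<notin> S \<longrightarrow> f x = 0}"
    by (induction rule: fvs.span_induct_alt) (auto simp: delta_apply fscale_apply split: if_splits)
next
  fix f :: "'x \<Rightarrow> 'k"
  assume f: "f \<in> {f. \<forall>x. x \<notin> S \<longrightarrow> f x = 0}"
  have "f = (\<Sum>x\<in>S. fscale (f x) (delta x))"
    using f assms by (auto simp: fun_eq_iff fun_sum_apply fscale_apply delta_apply
        if_distrib[of "\<lambda>x. _ * x"] cong: if_cong)
  also have "\<dots> \<in> fvs.span (delta ` S)"
    by (intro fvs.span_sum fvs.span_scale fvs.span_base imageI)
  finally show "f \<in> fvs.span (delta ` S)" .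
qed

lemma tensor_in_tensor_space: "v \<in> V \<Longrightarrow> w \<in> W \<Longrightarrow> tensor v w \<in> tensor_space V W"
  unfolding tensor_space_def by (intro fvs.span_base) blast

text \<open>Scalars can be moved into the first factor, so against a line every tensor is pure. This
  makes the carriers of all the module tensor products explicit.\<close>

lemma tensor_space_line:
  assumes "fvs.subspace V"
  shows "tensor_space V (range (\<lambda>c. fscale c t)) = (\<lambda>f. tensor f t) ` V"
proof
  have "fvs.subspace ((\<lambda>f. tensor f t) ` V)"
  proof (rule fvs.subspaceI)
    show "0 \<in> (\<lambda>f. tensor f t) ` V"
      using fvs.subspace_0[OF assms] by (metis image_eqI tensor_zero_left)
    show "x + y \<in> (\<lambda>f. tensor f t) ` V" if "x \<in> (\<lambda>f. tensor f t) ` V" "y \<in> (\<lambda>f. tensor f t) ` V" for x y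
      using that fvs.subspace_add[OF assms] by (auto simp flip: tensor_add_left)
    show "fscale c x \<in> (\<lambda>f. tensor f t) ` V" if "x \<in> (\<lambda>f. tensor f t) ` V" for c x
      using that fvs.subspace_scale[OF assms] by (auto simp flip: tensor_scale_left)
  qed
  moreover have "{tensor v w |v w. v \<in> V \<and> w \<in> range (\<lambda>c. fscale c t)} \<subseteq> (\<lambda>f. tensor f t) ` V"
    using fvs.subspace_scale[OF assms] by (auto simp: tensor_scale_right simp flip: tensor_scale_left)
  ultimately show "tensor_space V (range (\<lambda>c. fscale c t)) \<subseteq> (\<lambda>f. tensor f t) ` V"
    unfolding tensor_space_def by (rule fvs.span_minimal[rotated])
  have "t = fscale 1 t"
    by simp
  then have "t \<in> range (\<lambda>c. fscale c t)"
    by blast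
  then show "(\<lambda>f. tensor f t) ` V \<subseteq> tensor_space V (range (\<lambda>c. fscale c t))"
    by (auto intro: tensor_in_tensor_space)
qed

lemma subspace_line: "fvs.subspace (range (\<lambda>c. fscale c t))"
  by (rule fvs.subspaceI)
    (auto simp: fvs.scale_left_distrib[symmetric] intro: range_eqI[of _ _ 0])

lemma tensor_space_lines:
  "tensor_space (range (\<lambda>c. fscale c s)) (range (\<lambda>c. fscale c t)) = range (\<lambda>c. fscale c (tensor s t))"
  unfolding tensor_space_line[OF subspace_line] image_image tensor_scale_left ..

text \<open>Reduces an action to basis elements: linearity in the first argument assembles their
  eigenvalues into a linear functional of \<open>f\<close>, which in the applications is recognised
  as a character.\<close>

lemma bilin_ext_eigen:
  assumes "\<And>x. x \<in> I \<Longrightarrow> (\<Sum>y\<in>J. fscale (g y) (delta (opn x y))) = fscale (c x) g"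
  shows "bilin_ext I J opn f g = fscale (\<Sum>x\<in>I. f x * c x) g"
proof -
  have "bilin_ext I J opn f g = (\<Sum>x\<in>I. fscale (f x) (\<Sum>y\<in>J. fscale (g y) (delta (opn x y))))"
    by (simp add: bilin_ext_def fvs.scale_sum_right)
  also have "\<dots> = (\<Sum>x\<in>I. fscale (f x * c x) g)"
    by (intro sum.cong refl) (simp add: assms)
  finally show ?thesis
    by (simp add: fvs.scale_sum_left)
qed

lemma bilin_ext_scale_right: "bilin_ext I J opn f (fscale c g) = fscale c (bilin_ext I J opn f g)"
  by (simp add: bilin_ext_def fvs.scale_sum_right fscale_apply mult.left_commute)

lemma tensor_delta: "tensor (delta x) (delta y) = delta (x, y)"
  by (auto simp: fun_eq_iff delta_apply tensor_apply)

text \<open>An action by separate maps on the two coordinates factors through the tensor. The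
  diagonal action, the outer action and the action on the first factor of an induced module all have
  this shape.\<close>

lemma sum_delta_pair:
  "(\<Sum>p\<in>J \<times> K. fscale (tensor v w p) (delta (case p of (y, z) \<Rightarrow> (a y, b z)))) =
    tensor (\<Sum>y\<in>J. fscale (v y) (delta (a y))) (\<Sum>z\<in>K. fscale (w z) (delta (b z)))"
proof -
  have "tensor (\<Sum>y\<in>J. fscale (v y) (delta (a y))) (\<Sum>z\<in>K. fscale (w z) (delta (b z))) =
      (\<Sum>y\<in>J. \<Sum>z\<in>K. fscale (tensor v w (y, z)) (delta (a y, b z)))"
    by (simp add: tensor_sum_left tensor_scale_left)
      (simp add: tensor_sum_right tensor_scale_right tensor_apply fvs.scale_sum_right tensor_delta)
  then show ?thesis
    by (simp add: sum.cartesian_product case_prod_beta')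
qed

section \<open>Characters of the meet algebra\<close>

definition character :: "nat \<Rightarrow> setpart \<Rightarrow> 'k::field part_vec \<Rightarrow> 'k"
  where "character n A f = (\<Sum>C | refines {1..n} A C. f C)"

lemma part_algebra_carrier:
  "carrier (part_algebra n) = {f. \<forall>A. A \<notin> set_partitions n \<longrightarrow> f A = 0}"
  by (simp add: part_algebra_def span_delta finite_set_partitions)

lemma part_algebra_simps [simp]:
  "mult (part_algebra n) = bilin_ext (set_partitions n) (set_partitions n) (\<lambda>A B. A \<sqinter>\<^bsub>part_lattice n\<^esub> B)"
  "one (part_algebra n) = delta \<top>\<^bsub>part_lattice n\<^esub>"
  "zero (part_algebra n) = 0"
  "add (part_algebra n) = (+)"
  by (simp_all add: part_algebra_def)

lemma subspace_part_algebra: "fvs.subspace (carrier (part_algebra n))"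
  by (simp add: part_algebra_def)

lemma character_add: "character n A (f + g) = character n A f + character n A g"
  and character_scale: "character n A (fscale c f) = c * character n A f"
  and character_zero: "character n A 0 = 0"
  and character_diff: "character n A (f - g) = character n A f - character n A g"
  by (simp_all add: character_def sum.distrib sum_distrib_left fscale_apply sum_subtractf)

lemma character_sum: "character n A (\<Sum>i\<in>I. f i) = (\<Sum>i\<in>I. character n A (f i))"
  by (induction I rule: infinite_finite_induct) (simp_all only: sum.infinite sum.empty sum.insert character_zero character_add not_False_eq_True)

lemma character_delta: "character n A (delta C) = (if refines {1..n} A C then 1 else 0)"
  by (simp add: character_def delta_apply finite_upper)

lemma character_as_sum:
  "character n A f = (\<Sum>C\<in>set_partitions n. f C * (if refines {1..n} A C then 1 else 0))"
proof -
  have "{C. refines {1..n} A C} = {C \<in> set_partitions n. refines {1..n} A C}"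
    using refines_in_set_partitions by blast
  then show ?thesis
    by (simp add: character_def sum.If_cases[OF finite_set_partitions] Int_def if_distrib[of "\<lambda>x. _ * x"] cong: if_cong)
qed

text \<open>Multiplicative because lying below a meet means lying below both of its
  arguments.\<close>

lemma character_mult:
  assumes "A \<in> set_partitions n"
  shows "character n A (f \<otimes>\<^bsub>part_algebra n\<^esub> g) = character n A f * character n A g"
proof -
  have "character n A (f \<otimes>\<^bsub>part_algebra n\<^esub> g) =
      (\<Sum>B\<in>set_partitions n. \<Sum>C\<in>set_partitions n. f B * g C *
        (if refines {1..n} A (B \<sqinter>\<^bsub>part_lattice n\<^esub> C) then 1 else 0))"
    by (simp add: bilin_ext_def character_sum character_scale character_delta)
  also have "\<dots> = (\<Sum>B\<in>set_partitions n. \<Sum>C\<in>set_partitions n.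
      (f B * (if refines {1..n} A B then 1 else 0)) * (g C * (if refines {1..n} A C then 1 else 0)))"
    by (intro sum.cong refl) (simp add: refines_meet_iff)
  also have "\<dots> = character n A f * character n A g"
    by (simp add: character_as_sum sum_product)
  finally show ?thesis .
qed

lemma character_one: "A \<in> set_partitions n \<Longrightarrow> character n A \<one>\<^bsub>part_algebra n\<^esub> = 1"
  using part_lattice_top by (simp add: character_delta)

text \<open>The characters form the upper zeta transform of the coefficients, and Moebius inversion
  recovers each coefficient from it.\<close>

lemma character_eqI:
  fixes f g :: "'k::field_char_0 part_vec"
  assumes "f \<in> carrier (part_algebra n)" "g \<in> carrier (part_algebra n)"
    and eq: "\<And>A. A \<in> set_partitions n \<Longrightarrow> character n A f = character n A g"
  shows "f = g"
proof
  fix A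
  show "f A = g A"
  proof (cases "A \<in> set_partitions n")
    case True
    have inv: "(\<Sum>B | refines {1..n} A B. fscale (of_int (moebius n A B)) (\<lambda>_::unit. character n B f)) = (\<lambda>_. f A)"
      for f :: "'k part_vec"
      by (rule moebius_inversion_upper[OF True]) (simp add: character_def fun_eq_iff fun_sum_apply)
    have "(\<Sum>B | refines {1..n} A B. fscale (of_int (moebius n A B)) (\<lambda>_::unit. character n B f)) =
        (\<Sum>B | refines {1..n} A B. fscale (of_int (moebius n A B)) (\<lambda>_::unit. character n B g))"
      using eq refines_in_set_partitions by (intro sum.cong refl) auto
    then show ?thesis
      unfolding inv by meson
  next
    case False
    with assms show ?thesis
      by (simp add: part_algebra_carrier)
  qed
qed

lemma delta_in_part_algebra: "A \<in> set_partitions n \<Longrightarrow> delta A \<in> carrier (part_algebra n)"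
  by (auto simp: part_algebra_carrier delta_apply)

lemma part_algebra_mult_closed: "f \<otimes>\<^bsub>part_algebra n\<^esub> g \<in> carrier (part_algebra n)"
  unfolding part_algebra_simps bilin_ext_def
  by (intro fvs.subspace_sum[OF subspace_part_algebra] fvs.subspace_scale[OF subspace_part_algebra]
      delta_in_part_algebra meet_in)

lemma part_algebra_one_closed: "\<one>\<^bsub>part_algebra n\<^esub> \<in> carrier (part_algebra n)"
  using part_lattice_top by (simp add: delta_in_part_algebra)

text \<open>The monoid laws are inherited from the field: characters are multiplicative and separate
  the elements.\<close>

lemma cring_part_algebra: "cring (part_algebra n :: ('k::field_char_0 part_vec) ring)"
proof (rule cringI)
  let ?R = "part_algebra n :: ('k part_vec) ring"
  note sub = subspace_part_algebra[of n]
  show "abelian_group ?R"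
  proof (rule abelian_groupI)
    show "\<exists>y\<in>carrier ?R. y \<oplus>\<^bsub>?R\<^esub> x = \<zero>\<^bsub>?R\<^esub>" if "x \<in> carrier ?R" for x
      using fvs.subspace_neg[OF sub that] by (intro bexI[of _ "- x"]) simp_all
  qed (use fvs.subspace_0[OF sub] fvs.subspace_add[OF sub] in \<open>auto simp: algebra_simps\<close>)
  show "Group.comm_monoid ?R"
    by (rule comm_monoidI; (rule part_algebra_mult_closed part_algebra_one_closed)?;
        rule character_eqI[of _ n];
        (simp only: part_algebra_mult_closed part_algebra_one_closed character_mult character_one mult_1 mult_ac)?)
  show "(x \<oplus>\<^bsub>?R\<^esub> y) \<otimes>\<^bsub>?R\<^esub> z = x \<otimes>\<^bsub>?R\<^esub> z \<oplus>\<^bsub>?R\<^esub> y \<otimes>\<^bsub>?R\<^esub> z" for x y z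
    by (simp add: bilin_ext_def fun_eq_iff fun_sum_apply fscale_apply algebra_simps sum.distrib)
qed

section \<open>Primitive idempotents and the lines they span\<close>

lemma prim_idem_apply:
  "prim_idem n A C = (if refines {1..n} C A then of_int (moebius n C A) else 0)"
  by (simp add: prim_idem_def fun_sum_apply fscale_apply delta_apply finite_lower
      if_distrib[of "\<lambda>x. _ * x"] cong: if_cong)

lemma prim_idem_self: "A \<in> set_partitions n \<Longrightarrow> prim_idem n A A = 1"
  by (simp add: prim_idem_apply refines_self)

lemma prim_idem_in: "prim_idem n A \<in> carrier (part_algebra n)"
  using refines_in_set_partitions by (auto simp: part_algebra_carrier prim_idem_apply)

text \<open>A row of zeta is applied to a column of its inverse mu, so the result is a Kronecker
  delta: idempotents and characters are dual bases.\<close>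

lemma character_prim_idem:
  assumes "A \<in> set_partitions n"
  shows "character n D (prim_idem n A :: 'k::field_char_0 part_vec) = (if D = A then 1 else 0)"
proof -
  have "character n D (prim_idem n A :: 'k part_vec) =
      (\<Sum>C | refines {1..n} D C \<and> refines {1..n} C A. of_int (moebius n C A))"
    unfolding character_def
    by (rule sum.mono_neutral_cong_right) (auto simp: prim_idem_apply finite_upper)
  also have "\<dots> = of_int (\<Sum>C | refines {1..n} D C \<and> refines {1..n} C A. moebius n C A)"
    by simp
  also have "\<dots> = (if D = A then 1 else 0)"
  proof (cases "refines {1..n} D A")
    case True
    then show ?thesis
      by (simp only: sum_moebius_upper_fixed) simp
  next
    case False
    then have "{C. refines {1..n} D C \<and> refines {1..n} C A} = {}"
      using refines_trans by blast
    moreover have "D \<noteq> A"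
      using False assms refines_self by blast
    ultimately show ?thesis
      by (metis (no_types, lifting) of_int_0 sum.empty)
  qed
  finally show ?thesis .
qed

lemma mult_prim_idem:
  assumes "A \<in> set_partitions n"
  shows "f \<otimes>\<^bsub>part_algebra n\<^esub> prim_idem n A = fscale (character n A f) (prim_idem n A)"
proof (rule character_eqI[OF part_algebra_mult_closed])
  show "fscale (character n A f) (prim_idem n A) \<in> carrier (part_algebra n)"
    by (rule fvs.subspace_scale[OF subspace_part_algebra prim_idem_in])
  show "character n D (f \<otimes>\<^bsub>part_algebra n\<^esub> prim_idem n A) =
      character n D (fscale (character n A f) (prim_idem n A))" if "D \<in> set_partitions n" for D
    unfolding character_mult[OF that] character_scale character_prim_idem[OF assms] by simp
qed

text \<open>The eigenvalue relation of \<open>mult_prim_idem\<close> for a single basis element,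
  brought into the form that \<open>sum_delta_pair\<close> produces.\<close>

lemma meet_prim_idem:
  assumes "A \<in> set_partitions n" and x: "x \<in> set_partitions n"
  shows "(\<Sum>y\<in>set_partitions n. fscale (prim_idem n A y) (delta (x \<sqinter>\<^bsub>part_lattice n\<^esub> y))) =
    fscale (if refines {1..n} A x then 1 else 0) (prim_idem n A :: 'k::field_char_0 part_vec)"
proof -
  have "delta x \<otimes>\<^bsub>part_algebra n\<^esub> (prim_idem n A :: 'k part_vec) =
      (\<Sum>z\<in>set_partitions n. fscale (delta x z)
        (\<Sum>y\<in>set_partitions n. fscale (prim_idem n A y) (delta (z \<sqinter>\<^bsub>part_lattice n\<^esub> y))))"
    by (simp add: bilin_ext_def fvs.scale_sum_right)
  also have "\<dots> = (\<Sum>y\<in>set_partitions n. fscale (prim_idem n A y) (delta (x \<sqinter>\<^bsub>part_lattice n\<^esub> y)))"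
    unfolding delta_apply by (rule sum_if_eq_scaled[OF finite_set_partitions x])
  finally show ?thesis
    by (simp only: mult_prim_idem[OF assms(1)] character_delta)
qed

lemma simple_module_carrier:
  fixes A :: setpart
  assumes "A \<in> set_partitions n"
  shows "carrier (simple_module n A) = range (\<lambda>c::'k::field_char_0. fscale c (prim_idem n A))"
proof -
  have "\<exists>f\<in>carrier (part_algebra n). character n A f = c" for c :: 'k
    using character_one[OF assms] fvs.subspace_scale[OF subspace_part_algebra part_algebra_one_closed]
    by (metis character_scale mult.right_neutral)
  then show ?thesis
    unfolding simple_module_def fun_module_def mult_prim_idem[OF assms] by (auto simp: image_iff) metis
qed

section \<open>Modules on which the meet algebra acts through a character\<close>

text \<open>A line on which the algebra acts through the character at \<open>C\<close>. Every
  equation is phrased through a bijection \<open>coord\<close> onto the field, so that vectors,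
  tensors and cosets are treated uniformly; the module axioms are then derived from those of the
  field.\<close>

locale character_module =
  fixes n :: nat and C :: setpart and M :: "('k::field_char_0 part_vec, 'b) module" and coord :: "'b \<Rightarrow> 'k"
  assumes C_in: "C \<in> set_partitions n"
    and coord_bij: "bij_betw coord (carrier M) UNIV"
    and add_in: "x \<in> carrier M \<Longrightarrow> y \<in> carrier M \<Longrightarrow> x \<oplus>\<^bsub>M\<^esub> y \<in> carrier M"
    and coord_add: "x \<in> carrier M \<Longrightarrow> y \<in> carrier M \<Longrightarrow> coord (x \<oplus>\<^bsub>M\<^esub> y) = coord x + coord y"
    and zero_in: "\<zero>\<^bsub>M\<^esub> \<in> carrier M"
    and coord_zero: "coord \<zero>\<^bsub>M\<^esub> = 0"
    and smult_in: "a \<in> carrier (part_algebra n) \<Longrightarrow> x \<in> carrier M \<Longrightarrow> a \<odot>\<^bsub>M\<^esub> x \<in> carrier M"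
    and coord_smult: "a \<in> carrier (part_algebra n) \<Longrightarrow> x \<in> carrier M \<Longrightarrow>
      coord (a \<odot>\<^bsub>M\<^esub> x) = character n C a * coord x"
begin

lemma coord_eqI: "x \<in> carrier M \<Longrightarrow> y \<in> carrier M \<Longrightarrow> coord x = coord y \<Longrightarrow> x = y"
  using coord_bij by (auto simp: bij_betw_def inj_on_def)

lemma coord_surj: "\<exists>x\<in>carrier M. coord x = c"
  using coord_bij unfolding bij_betw_def by (metis UNIV_I imageE)

lemma abelian_group_M: "abelian_group M"
proof (rule abelian_groupI)
  show "\<exists>y\<in>carrier M. y \<oplus>\<^bsub>M\<^esub> x = \<zero>\<^bsub>M\<^esub>" if x: "x \<in> carrier M" for x
  proof -
    obtain y where "y \<in> carrier M" "coord y = - coord x"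
      using coord_surj by blast
    with x show ?thesis
      by (intro bexI[of _ y] coord_eqI) (simp_all add: add_in zero_in coord_add coord_zero)
  qed
qed (auto intro!: coord_eqI simp: add_in zero_in coord_add coord_zero algebra_simps)

lemma module_M: "Module.module (part_algebra n) M"
proof (rule moduleI[OF cring_part_algebra abelian_group_M])
  let ?R = "part_algebra n"
  show "(a \<oplus>\<^bsub>?R\<^esub> b) \<odot>\<^bsub>M\<^esub> x = a \<odot>\<^bsub>M\<^esub> x \<oplus>\<^bsub>M\<^esub> b \<odot>\<^bsub>M\<^esub> x"
    if "a \<in> carrier ?R" "b \<in> carrier ?R" "x \<in> carrier M" for a b x
    using that fvs.subspace_add[OF subspace_part_algebra that(1,2)]
    by (intro coord_eqI)
      (simp_all add: smult_in add_in coord_add coord_smult character_add algebra_simps)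
  show "(a \<otimes>\<^bsub>?R\<^esub> b) \<odot>\<^bsub>M\<^esub> x = a \<odot>\<^bsub>M\<^esub> (b \<odot>\<^bsub>M\<^esub> x)"
    if "a \<in> carrier ?R" "b \<in> carrier ?R" "x \<in> carrier M" for a b x
    using that
    by (intro coord_eqI)
      (simp_all only: smult_in part_algebra_mult_closed coord_smult character_mult[OF C_in] mult.assoc)
  show "\<one>\<^bsub>?R\<^esub> \<odot>\<^bsub>M\<^esub> x = x" if "x \<in> carrier M" for x
    using that
    by (intro coord_eqI)
      (simp_all only: smult_in part_algebra_one_closed coord_smult character_one[OF C_in] mult_1)
qed (auto intro!: coord_eqI simp: smult_in add_in coord_add coord_smult algebra_simps)

text \<open>The idempotent at \<open>C\<close> tells lines apart: it is the identity on
  \<open>M\<close>, but it would annihilate \<open>N\<close> if \<open>D\<close> differed from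
  \<open>C\<close>, and then a nonzero element would have the same image as zero.\<close>

lemma coord_hom_eq:
  assumes "character_module n D N coord'" and h: "h \<in> mod_hom (part_algebra n) M N"
    and bij: "bij_betw h (carrier M) (carrier N)"
  shows "C = D"
proof (rule ccontr)
  assume "C \<noteq> D"
  interpret N: character_module n D N coord' by fact
  let ?e = "prim_idem n C :: 'k part_vec"
  obtain x where x: "x \<in> carrier M" "coord x = 1"
    using coord_surj by blast
  have hx: "h x \<in> carrier N" "h \<zero>\<^bsub>M\<^esub> \<in> carrier N"
    using bij x zero_in by (auto simp: bij_betw_def)
  have "?e \<odot>\<^bsub>M\<^esub> x = x"
    using x C_in by (intro coord_eqI) (simp_all add: smult_in prim_idem_in coord_smult character_prim_idem)
  then have "h x = ?e \<odot>\<^bsub>N\<^esub> h x"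
    using h x(1) prim_idem_in[of n C] unfolding mod_hom_def by fastforce
  then have "coord' (h x) = character n D ?e * coord' (h x)"
    using N.coord_smult[OF prim_idem_in hx(1)] by metis
  then have "coord' (h x) = 0"
    using \<open>C \<noteq> D\<close> C_in by (simp add: character_prim_idem)
  moreover have "h \<zero>\<^bsub>M\<^esub> \<oplus>\<^bsub>N\<^esub> h \<zero>\<^bsub>M\<^esub> = h \<zero>\<^bsub>M\<^esub>"
  proof -
    have "\<zero>\<^bsub>M\<^esub> \<oplus>\<^bsub>M\<^esub> \<zero>\<^bsub>M\<^esub> = \<zero>\<^bsub>M\<^esub>"
      by (intro coord_eqI) (simp_all add: add_in zero_in coord_add coord_zero)
    then show ?thesis
      using h zero_in by (force simp: mod_hom_def hom_def)
  qed
  then have "coord' (h \<zero>\<^bsub>M\<^esub>) = 0"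
    using N.coord_add[OF hx(2) hx(2)] by simp
  ultimately have "h x = h \<zero>\<^bsub>M\<^esub>"
    using hx by (intro N.coord_eqI) simp_all
  then have "x = \<zero>\<^bsub>M\<^esub>"
    using bij x zero_in by (auto simp: bij_betw_def inj_on_def)
  with x coord_zero show False
    by simp
qed

text \<open>Multiples of the unit of the algebra act as scalars, so any nonzero element of a
  submodule generates the whole line.\<close>

lemma submodule_cases:
  assumes "submodule N (part_algebra n) M"
  shows "N = {\<zero>\<^bsub>M\<^esub>} \<or> N = carrier M"
proof -
  interpret N: submodule N "part_algebra n" M by fact
  have sub: "N \<subseteq> carrier M" and z: "\<zero>\<^bsub>M\<^esub> \<in> N"
    using N.subset N.one_closed by simp_all
  have "z \<in> N" if y: "y \<in> N" "y \<noteq> \<zero>\<^bsub>M\<^esub>" and zin: "z \<in> carrier M" for y z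
  proof -
    have yin: "y \<in> carrier M"
      using sub y by blast
    then have "coord y \<noteq> 0"
      using coord_eqI[OF yin zero_in] coord_zero y by auto
    let ?a = "fscale (coord z / coord y) \<one>\<^bsub>part_algebra n\<^esub>"
    have a: "?a \<in> carrier (part_algebra n)"
      by (rule fvs.subspace_scale[OF subspace_part_algebra part_algebra_one_closed])
    have "?a \<odot>\<^bsub>M\<^esub> y = z"
    proof (rule coord_eqI[OF smult_in[OF a yin] zin])
      show "coord (?a \<odot>\<^bsub>M\<^esub> y) = coord z"
        unfolding coord_smult[OF a yin] character_scale character_one[OF C_in]
        using \<open>coord y \<noteq> 0\<close> by simp
    qed
    with N.smult_closed[OF a y(1)] show ?thesis
      by simp
  qed
  then show ?thesis
    using sub z by blast
qed

end

text \<open>The coordinate is the coefficient at \<open>A\<close>, which equals 1 on the idempotent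
  because mu(A, A) = 1.\<close>

lemma simple_module_character:
  assumes A: "A \<in> set_partitions n"
  shows "character_module n A (simple_module n A :: ('k::field_char_0 part_vec, 'k part_vec) module) (\<lambda>f. f A)"
proof -
  let ?V = "simple_module n A :: ('k part_vec, 'k part_vec) module"
  have car: "carrier ?V = range (\<lambda>c. fscale c (prim_idem n A))"
    by (rule simple_module_carrier[OF A])
  have simps: "\<zero>\<^bsub>?V\<^esub> = 0" "add ?V = (+)" "smult ?V = mult (part_algebra n)"
    by (simp_all add: simple_module_def fun_module_def)
  have act: "a \<otimes>\<^bsub>part_algebra n\<^esub> fscale c (prim_idem n A) = fscale (character n A a * c) (prim_idem n A)" for a and c :: 'k
    using mult_prim_idem[OF A, of a] by (simp add: bilin_ext_scale_right mult.commute)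
  have ev: "fscale c (prim_idem n A) A = c" for c :: 'k
    by (simp add: fscale_apply prim_idem_self A)
  show ?thesis
  proof
    show "bij_betw (\<lambda>f. f A) (carrier ?V) UNIV"
      unfolding car by (rule bij_betwI[where g = "\<lambda>c. fscale c (prim_idem n A)"]) (auto simp: ev)
    show "x \<oplus>\<^bsub>?V\<^esub> y \<in> carrier ?V" if "x \<in> carrier ?V" "y \<in> carrier ?V" for x y
      using that fvs.subspace_add[OF subspace_line] unfolding car simps by blast
    show "\<zero>\<^bsub>?V\<^esub> \<in> carrier ?V"
      unfolding car simps by (rule fvs.subspace_0[OF subspace_line])
    show "a \<odot>\<^bsub>?V\<^esub> x \<in> carrier ?V" "(a \<odot>\<^bsub>?V\<^esub> x) A = character n A a * x A"
      if "a \<in> carrier (part_algebra n)" "x \<in> carrier ?V" for a x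
      using that unfolding car simps by (auto simp del: part_algebra_simps simp: act ev)
  qed (simp_all add: A simps)
qed

lemma mod_isomorphic_refl: "mod_isomorphic R M M"
  unfolding mod_isomorphic_def mod_hom_def
  by (intro bexI[of _ id]) (auto simp: hom_def)

text \<open>Keeps the basis vectors of \<open>G0_space\<close> distinct. The class of
  \<open>A\<close> contains the line at \<open>A\<close> itself, so equal classes give an
  isomorphism of lines, and that forces equal characters.\<close>

lemma iso_class_inject:
  assumes A: "A \<in> set_partitions n" and B: "B \<in> set_partitions n"
    and eq: "(iso_class n A :: 'k::field_char_0 mod_class) = iso_class n B"
  shows "A = B"
proof -
  interpret A: character_module n A "simple_module n A :: ('k part_vec, 'k part_vec) module" "\<lambda>f. f A"
    by (rule simple_module_character[OF A])
  have "(simple_module n A :: ('k part_vec, 'k part_vec) module) \<in> iso_class n A"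
    by (simp add: iso_class_def A.module_M mod_isomorphic_refl)
  then have "mod_isomorphic (part_algebra n) (simple_module n A) (simple_module n B :: ('k part_vec, 'k part_vec) module)"
    unfolding eq by (simp add: iso_class_def)
  then show ?thesis
    unfolding mod_isomorphic_def using A.coord_hom_eq simple_module_character[OF B] by blast
qed

context character_module
begin

text \<open>A composition series of length one: matching coordinates with the simple module at
  \<open>C\<close> is a bijective homomorphism, so its kernel is zero.\<close>

lemma comp_class_carrier: "comp_class n M (carrier M) (simple_class n C)"
proof -
  interpret V: character_module n C "simple_module n C :: ('k part_vec, 'k part_vec) module" "\<lambda>f. f C"
    by (rule simple_module_character[OF C_in])
  let ?V = "simple_module n C :: ('k part_vec, 'k part_vec) module"
  interpret M: Module.module "part_algebra n" M
    by (rule module_M)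
  define h where "h x = fscale (coord x) (prim_idem n C)" for x
  have car: "carrier ?V = range (\<lambda>c. fscale c (prim_idem n C))"
    by (rule simple_module_carrier[OF C_in])
  have hC: "h x C = coord x" for x
    by (simp add: h_def fscale_apply prim_idem_self C_in)
  have hin: "h x \<in> carrier ?V" for x
    by (auto simp: h_def car)
  have hom: "h \<in> mod_hom (part_algebra n) (M\<lparr>carrier := carrier M\<rparr>) ?V"
  proof -
    have "h (x \<oplus>\<^bsub>M\<^esub> y) = h x \<oplus>\<^bsub>?V\<^esub> h y" if "x \<in> carrier M" "y \<in> carrier M" for x y
      by (rule V.coord_eqI[OF hin V.add_in[OF hin hin]]) (simp only: hC V.coord_add[OF hin hin] coord_add[OF that])
    moreover have "h (a \<odot>\<^bsub>M\<^esub> x) = a \<odot>\<^bsub>?V\<^esub> h x" if "a \<in> carrier (part_algebra n)" "x \<in> carrier M" for a x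
      by (rule V.coord_eqI[OF hin V.smult_in[OF that(1) hin]])
        (simp only: hC V.coord_smult[OF that(1) hin] coord_smult[OF that])
    ultimately show ?thesis
      by (simp add: mod_hom_def hom_def hin)
  qed
  have surj: "h ` carrier M = carrier ?V"
  proof -
    have "h ` carrier M = (\<lambda>c. fscale c (prim_idem n C)) ` coord ` carrier M"
      by (simp add: h_def image_image)
    then show ?thesis
      using coord_bij by (simp add: car bij_betw_def)
  qed
  have "h x = \<zero>\<^bsub>?V\<^esub> \<longleftrightarrow> x = \<zero>\<^bsub>M\<^esub>" if "x \<in> carrier M" for x
  proof
    assume "h x = \<zero>\<^bsub>?V\<^esub>"
    then have "coord x = 0"
      using hC[of x] V.coord_zero by simp
    then show "x = \<zero>\<^bsub>M\<^esub>"
      by (intro coord_eqI[OF that zero_in]) (simp add: coord_zero)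
  next
    assume "x = \<zero>\<^bsub>M\<^esub>"
    then show "h x = \<zero>\<^bsub>?V\<^esub>"
      by (intro V.coord_eqI[OF hin V.zero_in]) (simp only: hC coord_zero V.coord_zero)
  qed
  then have ker: "a_kernel (M\<lparr>carrier := carrier M\<rparr>) ?V h = {\<zero>\<^bsub>M\<^esub>}"
    using zero_in by (auto simp: a_kernel_def kernel_def)
  have "comp_class n M (carrier M) (0 + simple_class n C)"
    by (rule comp_class.step[OF comp_class.zero M.carrier_is_submodule C_in hom surj ker])
  then show ?thesis
    by simp
qed

text \<open>Uniqueness of composition factors is immediate, since the module is simple.\<close>

lemma comp_class_cases:
  assumes "comp_class n M N v"
  shows "N = {\<zero>\<^bsub>M\<^esub>} \<and> v = 0 \<or> N = carrier M \<and> v = simple_class n C"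
  using assms
proof induction
  case zero
  then show ?case
    by simp
next
  case (step N v N' A h)
  let ?V = "simple_module n A :: ('k part_vec, 'k part_vec) module"
  interpret V: character_module n A ?V "\<lambda>f. f A"
    by (rule simple_module_character[OF step.hyps(3)])
  \<comment> \<open>A map onto a module with more than one element can neither start from the zero
    submodule nor have full kernel. So each step of a series inside \<open>M\<close> leads from zero
    to all of \<open>M\<close>.\<close>
  have nontriv: "carrier ?V \<noteq> {c}" for c
  proof
    assume "carrier ?V = {c}"
    moreover obtain x y where "x \<in> carrier ?V" "x A = 0" "y \<in> carrier ?V" "y A = 1"
      using V.coord_surj by metis
    ultimately show False
      by auto
  qed
  from submodule_cases[OF step.hyps(2)] have N': "N' = carrier M"
    using step.hyps(5) nontriv by (metis image_empty image_insert)
  then have upd: "M\<lparr>carrier := N'\<rparr> = M"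
    by simp
  note hom = step.hyps(4)[unfolded upd]
  have ker: "N = {x \<in> carrier M. h x = \<zero>\<^bsub>?V\<^esub>}"
    using step.hyps(6) unfolding upd by (simp add: a_kernel_def kernel_def)
  have "N \<noteq> carrier M"
  proof
    assume "N = carrier M"
    with ker have "\<forall>x\<in>carrier M. h x = \<zero>\<^bsub>?V\<^esub>"
      by blast
    then have "h ` carrier M = {\<zero>\<^bsub>?V\<^esub>}"
      using zero_in by force
    with step.hyps(5) N' nontriv show False
      by metis
  qed
  with step.IH have N: "N = {\<zero>\<^bsub>M\<^esub>}" and v: "v = 0"
    by auto
  interpret hom: group_hom "add_monoid M" "add_monoid ?V" h
    using hom abelian_group.a_group[OF abelian_group_M] abelian_group.a_group[OF V.abelian_group_M]
    by (simp add: mod_hom_def group_hom_def group_hom_axioms_def)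
  have "inj_on h (carrier M)"
    using hom.trivial_ker_imp_inj step.hyps(6) unfolding upd N a_kernel_def by simp
  then have "bij_betw h (carrier M) (carrier ?V)"
    using step.hyps(5) N' by (simp add: bij_betw_def)
  then have "C = A"
    by (rule coord_hom_eq[OF V.character_module_axioms hom])
  with N' v show ?case
    by simp
qed

text \<open>Existence and uniqueness of the class are now both known for a line, so the definite
  description is justified; the carrier being nonzero excludes the empty series.\<close>

lemma G0_class_M: "G0_class n M = simple_class n C"
proof -
  have "simple_class n C \<noteq> (0 :: 'k G0_vec)"
    by (auto simp: simple_class_def fun_eq_iff delta_apply)
  moreover have "carrier M \<noteq> {\<zero>\<^bsub>M\<^esub>}"
  proof
    assume "carrier M = {\<zero>\<^bsub>M\<^esub>}"
    moreover obtain x where "x \<in> carrier M" "coord x = 1"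
      using coord_surj by blast
    ultimately show False
      using coord_zero by simp
  qed
  ultimately show ?thesis
    unfolding G0_class_def using comp_class_carrier comp_class_cases by (intro the_equality) blast+
qed

end

section \<open>Tensor products and induced modules\<close>

text \<open>A basis element C acts on e_A \<otimes> e_B by the product of the indicators of A \<le>
  C and B \<le> C, which is the indicator for the join.\<close>

lemma inner_tensor_character:
  assumes A: "A \<in> set_partitions n" and B: "B \<in> set_partitions n"
  shows "character_module n (part_join n A B) (inner_tensor n A B :: ('k::field_char_0 part_vec, 'k part_vec2) module)
    (\<lambda>F. F (A, B))"
proof -
  let ?M = "inner_tensor n A B :: ('k part_vec, 'k part_vec2) module"
  let ?t = "tensor (prim_idem n A) (prim_idem n B) :: 'k part_vec2"
  let ?act = "bilin_ext (set_partitions n) (set_partitions n \<times> set_partitions n)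
    (\<lambda>C (D, E). (C \<sqinter>\<^bsub>part_lattice n\<^esub> D, C \<sqinter>\<^bsub>part_lattice n\<^esub> E))"
  have car: "carrier ?M = range (\<lambda>c. fscale c ?t)"
    by (simp add: inner_tensor_def fun_module_def simple_module_carrier[OF A] simple_module_carrier[OF B]
        tensor_space_lines)
  have simps: "\<zero>\<^bsub>?M\<^esub> = 0" "add ?M = (+)" "smult ?M = ?act"
    by (simp_all add: inner_tensor_def fun_module_def)
  have "?act a ?t = fscale (\<Sum>x\<in>set_partitions n. a x *
      (if refines {1..n} (part_join n A B) x then 1 else 0)) ?t" for a
  proof (rule bilin_ext_eigen)
    fix x assume x: "x \<in> set_partitions n"
    show "(\<Sum>y\<in>set_partitions n \<times> set_partitions n. fscale (?t y)
        (delta (case y of (D, E) \<Rightarrow> (x \<sqinter>\<^bsub>part_lattice n\<^esub> D, x \<sqinter>\<^bsub>part_lattice n\<^esub> E)))) =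
      fscale (if refines {1..n} (part_join n A B) x then 1 else 0) ?t"
      unfolding sum_delta_pair meet_prim_idem[OF A x] meet_prim_idem[OF B x]
        part_join_refines_iff[OF A B] tensor_scale_left tensor_scale_right fvs.scale_scale by simp
  qed
  then have act: "?act a (fscale c ?t) = fscale (character n (part_join n A B) a * c) ?t" for a c
    by (simp add: bilin_ext_scale_right character_as_sum[symmetric] mult.commute)
  have ev: "fscale c ?t (A, B) = c" for c :: 'k
    by (simp add: fscale_apply tensor_apply prim_idem_self A B)
  show ?thesis
  proof
    show "part_join n A B \<in> set_partitions n"
      by (rule part_join_in[OF A B])
    show "bij_betw (\<lambda>F. F (A, B)) (carrier ?M) UNIV"
      unfolding car by (rule bij_betwI[where g = "\<lambda>c. fscale c ?t"]) (auto simp: ev)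
    show "x \<oplus>\<^bsub>?M\<^esub> y \<in> carrier ?M" if "x \<in> carrier ?M" "y \<in> carrier ?M" for x y
      using that fvs.subspace_add[OF subspace_line] unfolding car simps by blast
    show "\<zero>\<^bsub>?M\<^esub> \<in> carrier ?M"
      unfolding car simps by (rule fvs.subspace_0[OF subspace_line])
    show "a \<odot>\<^bsub>?M\<^esub> x \<in> carrier ?M" "(a \<odot>\<^bsub>?M\<^esub> x) (A, B) = character n (part_join n A B) a * x (A, B)"
      if "a \<in> carrier (part_algebra n)" "x \<in> carrier ?M" for a x
      using that unfolding car simps by (auto simp: act ev)
  qed (simp_all add: simps)
qed

text \<open>The cosets of the kernel of \<open>\<theta>\<close> are its level sets.\<close>

lemma quotient_character_module:
  fixes V :: "('x \<Rightarrow> 'k::field_char_0) set"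
  assumes C: "C \<in> set_partitions n" and V: "fvs.subspace V"
    and K: "K = {v \<in> V. \<theta> v = 0}"
    and add: "\<And>u v. u \<in> V \<Longrightarrow> v \<in> V \<Longrightarrow> \<theta> (u + v) = \<theta> u + \<theta> v"
    and surj: "\<And>c::'k. \<exists>v\<in>V. \<theta> v = c"
    and act: "\<And>a v. a \<in> carrier (part_algebra n) \<Longrightarrow> v \<in> V \<Longrightarrow> act a v \<in> V \<and> \<theta> (act a v) = character n C a * \<theta> v"
  shows "character_module n C (quotient_module (fun_module V act) K) (\<lambda>U. \<theta> (SOME u. u \<in> U))"
proof -
  let ?Q = "quotient_module (fun_module V act) K"
  define L where "L c = {v \<in> V. \<theta> v = c}" for c
  have diff: "u - v \<in> V \<and> \<theta> (u - v) = \<theta> u - \<theta> v" if "u \<in> V" "v \<in> V" for u v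
    using add[of "u - v" v] that fvs.subspace_diff[OF V that] by (simp add: algebra_simps)
  have coset: "K +>\<^bsub>fun_module V act\<^esub> v = L (\<theta> v)" if v: "v \<in> V" for v
  proof (intro equalityI subsetI)
    fix u assume "u \<in> K +>\<^bsub>fun_module V act\<^esub> v"
    then obtain k where "k \<in> K" "u = k + v"
      by (auto simp: a_r_coset_def' fun_module_def)
    then show "u \<in> L (\<theta> v)"
      using v add fvs.subspace_add[OF V] by (simp add: L_def K)
  next
    fix u assume "u \<in> L (\<theta> v)"
    then have "u - v \<in> K"
      using diff v by (simp add: L_def K)
    then show "u \<in> K +>\<^bsub>fun_module V act\<^esub> v"
      by (auto simp: a_r_coset_def' fun_module_def intro!: bexI[of _ "u - v"])
  qed
  have car: "carrier ?Q = range L"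
  proof -
    have "carrier ?Q = (\<lambda>v. K +>\<^bsub>fun_module V act\<^esub> v) ` V"
      by (auto simp: quotient_module_def A_RCOSETS_def' fun_module_def)
    also have "\<dots> = L ` \<theta> ` V"
      unfolding image_image by (intro image_cong refl coset)
    also have "\<theta> ` V = UNIV"
      using surj by (metis (no_types, lifting) image_eqI UNIV_eq_I)
    finally show ?thesis .
  qed
  have addL: "L c \<oplus>\<^bsub>?Q\<^esub> L d = L (c + d)" for c d
  proof (intro equalityI subsetI)
    fix u assume "u \<in> L c \<oplus>\<^bsub>?Q\<^esub> L d"
    then show "u \<in> L (c + d)"
      using add fvs.subspace_add[OF V]
      by (auto simp: quotient_module_def set_add_def' fun_module_def L_def)
  next
    fix u assume u: "u \<in> L (c + d)"
    obtain w where w: "w \<in> V" "\<theta> w = d"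
      using surj by blast
    have "u - w \<in> L c" "w \<in> L d"
      using diff[of u w] u w by (auto simp: L_def)
    moreover from this have "\<exists>x\<in>L c. \<exists>y\<in>L d. u = x + y"
      by (intro bexI[of _ "u - w"] bexI[of _ w]) simp_all
    ultimately show "u \<in> L c \<oplus>\<^bsub>?Q\<^esub> L d"
      by (simp add: quotient_module_def set_add_def' fun_module_def)
  qed
  have smultL: "a \<odot>\<^bsub>?Q\<^esub> L c = L (character n C a * c)" if a: "a \<in> carrier (part_algebra n)" for a c
  proof -
    have "K +>\<^bsub>fun_module V act\<^esub> act a u = L (character n C a * c)" if "u \<in> L c" for u
      using act[OF a, of u] coset[of "act a u"] that by (simp add: L_def)
    \<comment> \<open>All cosets in the union defining the action coincide; nonemptiness of the
      level set is what keeps that union from being empty.\<close>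
    moreover have "L c \<noteq> {}"
      using surj by (auto simp: L_def)
    moreover have "a \<odot>\<^bsub>?Q\<^esub> L c = (\<Union>u\<in>L c. K +>\<^bsub>fun_module V act\<^esub> act a u)"
      by (simp add: quotient_module_def fun_module_def)
    ultimately show ?thesis
      by auto
  qed
  \<comment> \<open>\<open>\<theta>\<close> is constant on each level set, so the choice of
    representative is immaterial.\<close>
  have coordL: "\<theta> (SOME u. u \<in> L c) = c" for c
  proof -
    obtain v where "v \<in> L c"
      using surj by (auto simp: L_def)
    then have "(SOME u. u \<in> L c) \<in> L c"
      by (rule someI[where P = "\<lambda>u. u \<in> L c"])
    then show ?thesis
      by (simp add: L_def)
  qed
  have zero: "\<zero>\<^bsub>?Q\<^esub> = L 0"
    by (simp add: quotient_module_def K L_def)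
  show ?thesis
  proof
    show "bij_betw (\<lambda>U. \<theta> (SOME u. u \<in> U)) (carrier ?Q) UNIV"
      unfolding car by (rule bij_betwI[where g = L]) (auto simp: coordL)
  qed (use C in \<open>auto simp: car zero addL smultL coordL\<close>)
qed

text \<open>The basis element at C is the sum of the idempotents below C. So the basis element at
  C|D is the double sum of the images of e \<otimes> e under \<open>rho\<close>, and inversion over
  concatenations identifies these images with the idempotents of the large algebra.\<close>

lemma rho_prim_idem:
  assumes A: "A \<in> set_partitions n" and B: "B \<in> set_partitions m"
  shows "rho n m (tensor (prim_idem n A) (prim_idem m B)) =
    (prim_idem (n + m) (part_concat n A B) :: 'k::field_char_0 part_vec)"
proof -
  let ?t = "\<lambda>C D. tensor (prim_idem n C) (prim_idem m D) :: 'k part_vec2"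
  have rho_sum: "rho n m (\<Sum>i\<in>I. f i) = (\<Sum>i\<in>I. rho n m (f i))" for I :: "setpart set" and f :: "setpart \<Rightarrow> 'k part_vec2"
    by (simp only: rho_def fun_sum_apply[of f I] fscale_sum_left split_def) (rule sum.swap)
  have sum_idem: "(\<Sum>C' | refines {1..k} C' C. prim_idem k C') = (delta C :: 'k part_vec)"
    if "C \<in> set_partitions k" for k C
    by (rule moebius_inversion_lower_converse[OF that]) (simp add: prim_idem_def)
  have "prim_idem (n + m) (part_concat n A B) = rho n m (?t A B)"
    unfolding prim_idem_def[of "n + m"]
  proof (rule moebius_inversion_concat[OF A B])
    fix C D assume C: "C \<in> set_partitions n" and D: "D \<in> set_partitions m"
    have "(\<Sum>C' | refines {1..n} C' C. \<Sum>D' | refines {1..m} D' D. rho n m (?t C' D')) =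
        rho n m (tensor (delta C) (delta D))"
      by (simp only: rho_sum[symmetric] tensor_sum_right[symmetric] tensor_sum_left[symmetric]
          sum_idem[OF C] sum_idem[OF D])
    also have "\<dots> = (\<Sum>p\<in>set_partitions n \<times> set_partitions m.
        fscale (if p = (C, D) then 1 else 0) (delta (part_concat n (fst p) (snd p))))"
      unfolding rho_def tensor_delta delta_apply split_def by simp
    also have "\<dots> = delta (part_concat n C D)"
      by (subst sum_if_eq_scaled) (auto simp: C D finite_set_partitions)
    finally show "delta (part_concat n C D) =
        (\<Sum>C' | refines {1..n} C' C. \<Sum>D' | refines {1..m} D' D. rho n m (?t C' D'))" ..
  qed
  then show ?thesis ..
qed

text \<open>C \<otimes> D acts by the indicator of A \<le> C and B \<le> D, which is the indicator
  of A|B \<le> C|D. Thus the outer tensor product carries the character at A|B pulled back along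
  \<open>rho\<close>.\<close>

lemma outer_tensor_act:
  assumes A: "A \<in> set_partitions n" and B: "B \<in> set_partitions m"
  shows "s \<otimes>\<^bsub>part_algebra2 n m\<^esub> tensor (prim_idem n A) (prim_idem m B) =
    fscale (character (n + m) (part_concat n A B) (rho n m s))
      (tensor (prim_idem n A) (prim_idem m B) :: 'k::field_char_0 part_vec2)"
proof -
  let ?t = "tensor (prim_idem n A) (prim_idem m B) :: 'k part_vec2"
  have "s \<otimes>\<^bsub>part_algebra2 n m\<^esub> ?t = fscale (\<Sum>p\<in>set_partitions n \<times> set_partitions m. s p *
      (if refines {1..n} A (fst p) \<and> refines {1..m} B (snd p) then 1 else 0)) ?t"
    unfolding part_algebra2_def monoid.simps
  proof (rule bilin_ext_eigen)
    fix p assume p: "p \<in> set_partitions n \<times> set_partitions m"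
    then have p1: "fst p \<in> set_partitions n" and p2: "snd p \<in> set_partitions m"
      by auto
    show "(\<Sum>q\<in>set_partitions n \<times> set_partitions m. fscale (?t q) (delta ((case p of (A, B) \<Rightarrow>
        \<lambda>(C, D). (A \<sqinter>\<^bsub>part_lattice n\<^esub> C, B \<sqinter>\<^bsub>part_lattice m\<^esub> D)) q))) =
      fscale (if refines {1..n} A (fst p) \<and> refines {1..m} B (snd p) then 1 else 0) ?t"
      unfolding case_prod_beta[of _ p] sum_delta_pair meet_prim_idem[OF A p1] meet_prim_idem[OF B p2]
        tensor_scale_left tensor_scale_right fvs.scale_scale by simp
  qed
  also have "(\<Sum>p\<in>set_partitions n \<times> set_partitions m. s p *
      (if refines {1..n} A (fst p) \<and> refines {1..m} B (snd p) then 1 else 0)) =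
    character (n + m) (part_concat n A B) (rho n m s)"
    unfolding rho_def split_def character_sum character_scale character_delta
    by (intro sum.cong refl) (auto simp: concat_refines_concat_iff[OF A B])
  finally show ?thesis .
qed

text \<open>Before passing to the quotient every element has the form p \<otimes> t with t = e_A
  \<otimes> e_B. Each generating relation is a multiple of (p \<wedge> rho(s) - \<chi>(rho(s)) p)
  \<otimes> t, whose first factor is killed by \<chi>; conversely the relations contain p \<otimes>
  t whenever \<chi>(p) = 0. So the quotient is the line of values of \<chi>.\<close>

lemma induced_module_character:
  assumes A: "A \<in> set_partitions n" and B: "B \<in> set_partitions m"
  shows "character_module (n + m) (part_concat n A B)
    (induced_module n m (outer_tensor n m A B) :: ('k::field_char_0 part_vec, _) module)
    (\<lambda>U. character (n + m) (part_concat n A B) (\<lambda>C. (SOME u. u \<in> U) (C, (A, B))))"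
proof -
  let ?N = "outer_tensor n m A B :: ('k part_vec2, 'k part_vec2) module"
  let ?t = "tensor (prim_idem n A) (prim_idem m B) :: 'k part_vec2"
  let ?P = "part_algebra (n + m) :: ('k part_vec) ring"
  let ?AB = "part_concat n A B"
  let ?chi = "character (n + m) ?AB :: 'k part_vec \<Rightarrow> 'k"
  let ?act = "bilin_ext (set_partitions (n + m)) (set_partitions (n + m) \<times> set_partitions n \<times> set_partitions m)
    (\<lambda>C (D, q). (C \<sqinter>\<^bsub>part_lattice (n + m)\<^esub> D, q)) :: 'k part_vec \<Rightarrow> (setpart \<times> setpart \<times> setpart \<Rightarrow> 'k) \<Rightarrow> _"
  let ?V = "(\<lambda>p. tensor p ?t) ` carrier ?P"
  \<comment> \<open>The functional that cuts out the relations. The slice at (A, B) recovers p from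
    p \<otimes> t, since t has coefficient 1 there.\<close>
  define \<theta> where "\<theta> F = ?chi (\<lambda>C. F (C, (A, B)))" for F :: "setpart \<times> setpart \<times> setpart \<Rightarrow> 'k"
  note AB = part_concat_in[OF A B]
  have carN: "carrier ?N = range (\<lambda>c. fscale c ?t)"
    by (simp add: outer_tensor_def fun_module_def simple_module_carrier[OF A] simple_module_carrier[OF B]
        tensor_space_lines)
  have smultN: "s \<odot>\<^bsub>?N\<^esub> fscale c ?t = fscale (?chi (rho n m s) * c) ?t" for s c
  proof -
    have "s \<odot>\<^bsub>?N\<^esub> fscale c ?t = fscale c (s \<otimes>\<^bsub>part_algebra2 n m\<^esub> ?t)"
      by (simp add: outer_tensor_def fun_module_def part_algebra2_def bilin_ext_scale_right)
    then show ?thesis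
      unfolding outer_tensor_act[OF A B] by (simp add: mult.commute)
  qed
  have \<theta>_tensor: "\<theta> (tensor p ?t) = ?chi p" for p
    by (simp add: \<theta>_def tensor_apply prim_idem_self A B)
  have pre: "induced_pre n m ?N = fun_module ?V ?act"
    unfolding induced_pre_def carN tensor_space_line[OF subspace_part_algebra] ..
  have V: "fvs.subspace ?V"
    unfolding tensor_space_line[OF subspace_part_algebra, symmetric] tensor_space_def by (rule fvs.subspace_span)
  have t_sum: "(\<Sum>q\<in>set_partitions n \<times> set_partitions m. fscale (?t q) (delta q)) = ?t"
  proof
    fix q :: "setpart \<times> setpart"
    obtain C D where q: "q = (C, D)"
      by fastforce
    have "?t q = 0" if "q \<notin> set_partitions n \<times> set_partitions m"
      using that prim_idem_in[of n A] prim_idem_in[of m B]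
      unfolding q by (auto simp: tensor_apply part_algebra_carrier)
    then show "(\<Sum>q\<in>set_partitions n \<times> set_partitions m. fscale (?t q) (delta q)) q = ?t q"
      by (auto simp: fun_sum_apply fscale_apply delta_apply finite_set_partitions
          if_distrib[of "\<lambda>x. _ * x"] simp del: mem_Sigma_iff cong: if_cong)
  qed
  have act: "?act a (tensor p ?t) = tensor (a \<otimes>\<^bsub>?P\<^esub> p) ?t" for a p
  proof -
    have "?act a (tensor p ?t) = (\<Sum>x\<in>set_partitions (n + m). fscale (a x)
        (\<Sum>q\<in>set_partitions (n + m) \<times> set_partitions n \<times> set_partitions m.
          fscale (tensor p ?t q) (delta (case q of (D, q) \<Rightarrow> (x \<sqinter>\<^bsub>part_lattice (n + m)\<^esub> D, q)))))"
      by (simp add: bilin_ext_def fvs.scale_sum_right)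
    also have "\<dots> = (\<Sum>x\<in>set_partitions (n + m). fscale (a x)
        (tensor (\<Sum>y\<in>set_partitions (n + m). fscale (p y) (delta (x \<sqinter>\<^bsub>part_lattice (n + m)\<^esub> y))) ?t))"
      unfolding sum_delta_pair t_sum ..
    also have "\<dots> = tensor (a \<otimes>\<^bsub>?P\<^esub> p) ?t"
      by (simp add: bilin_ext_def tensor_sum_left tensor_scale_left fvs.scale_sum_right)
    finally show ?thesis .
  qed
  have rel: "induced_rel n m ?N = {v \<in> ?V. \<theta> v = 0}"
  proof
    have gen: "tensor (p \<otimes>\<^bsub>?P\<^esub> rho n m s) (fscale c ?t) - tensor p (s \<odot>\<^bsub>?N\<^esub> fscale c ?t) =
        tensor (fscale c (p \<otimes>\<^bsub>?P\<^esub> rho n m s - fscale (?chi (rho n m s)) p)) ?t" for p s c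
      by (simp del: part_algebra_simps add: smultN tensor_scale_right tensor_scale_left tensor_diff_left
          fvs.scale_right_diff_distrib mult.commute)
    show "induced_rel n m ?N \<subseteq> {v \<in> ?V. \<theta> v = 0}"
      unfolding induced_rel_def
    proof (rule fvs.span_minimal)
      show "fvs.subspace {v \<in> ?V. \<theta> v = 0}"
      proof (rule fvs.subspaceI)
        show "0 \<in> {v \<in> ?V. \<theta> v = 0}"
          using fvs.subspace_0[OF V] by (simp add: \<theta>_def character_def)
        show "x + y \<in> {v \<in> ?V. \<theta> v = 0}" if "x \<in> {v \<in> ?V. \<theta> v = 0}" "y \<in> {v \<in> ?V. \<theta> v = 0}" for x y
          using that fvs.subspace_add[OF V] by (simp add: \<theta>_def character_def sum.distrib)
        show "fscale c x \<in> {v \<in> ?V. \<theta> v = 0}" if "x \<in> {v \<in> ?V. \<theta> v = 0}" for c x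
          using that fvs.subspace_scale[OF V]
          by (simp add: \<theta>_def character_def fscale_apply sum_distrib_left[symmetric])
      qed
      show "{tensor (p \<otimes>\<^bsub>?P\<^esub> rho n m s) t - tensor p (s \<odot>\<^bsub>?N\<^esub> t) | p s t.
          p \<in> carrier ?P \<and> s \<in> carrier (part_algebra2 n m) \<and> t \<in> carrier ?N} \<subseteq> {v \<in> ?V. \<theta> v = 0}"
      proof clarify
        fix p s t assume p: "p \<in> carrier ?P" and "t \<in> carrier ?N"
        then obtain c where t: "t = fscale c ?t"
          unfolding carN by blast
        have "fscale c (p \<otimes>\<^bsub>?P\<^esub> rho n m s - fscale (?chi (rho n m s)) p) \<in> carrier ?P"
          by (intro fvs.subspace_scale[OF subspace_part_algebra] fvs.subspace_diff[OF subspace_part_algebra]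
              part_algebra_mult_closed p)
        moreover have "?chi (fscale c (p \<otimes>\<^bsub>?P\<^esub> rho n m s - fscale (?chi (rho n m s)) p)) = 0"
          unfolding character_scale character_diff character_mult[OF AB] by simp
        ultimately show "tensor (p \<otimes>\<^bsub>?P\<^esub> rho n m s) t - tensor p (s \<odot>\<^bsub>?N\<^esub> t) \<in> ?V \<and>
            \<theta> (tensor (p \<otimes>\<^bsub>?P\<^esub> rho n m s) t - tensor p (s \<odot>\<^bsub>?N\<^esub> t)) = 0"
          unfolding t gen \<theta>_tensor by blast
      qed
    qed
    show "{v \<in> ?V. \<theta> v = 0} \<subseteq> induced_rel n m ?N"
    proof clarify
      fix p assume p: "p \<in> carrier ?P" and "\<theta> (tensor p ?t) = 0"
      then have chi: "?chi p = 0"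
        by (simp only: \<theta>_tensor)
      have one: "fscale 1 ?t = ?t"
        by simp
      \<comment> \<open>The relation is taken with s = t. As t is idempotent and p \<wedge> rho(t) =
        \<chi>(p) e = 0, with e the idempotent at A|B, it reads - p \<otimes> t.\<close>
      have "?t \<odot>\<^bsub>?N\<^esub> ?t = ?t"
        using smultN[of ?t 1] unfolding rho_prim_idem[OF A B] character_prim_idem[OF AB] one by simp
      then have "tensor (p \<otimes>\<^bsub>?P\<^esub> rho n m ?t) ?t - tensor p (?t \<odot>\<^bsub>?N\<^esub> ?t) = - tensor p ?t"
        unfolding rho_prim_idem[OF A B] mult_prim_idem[OF AB] chi by (simp add: tensor_zero_left)
      moreover have "tensor (p \<otimes>\<^bsub>?P\<^esub> rho n m ?t) ?t - tensor p (?t \<odot>\<^bsub>?N\<^esub> ?t) \<in> induced_rel n m ?N"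
        unfolding induced_rel_def
      proof (rule fvs.span_base, intro CollectI exI[of _ p] exI[of _ ?t] conjI refl)
        show "?t \<in> carrier (part_algebra2 n m)"
          by (simp add: part_algebra2_def tensor_in_tensor_space prim_idem_in)
        show "?t \<in> carrier ?N"
          unfolding carN by (rule range_eqI[where x = 1]) simp
        show "p \<in> carrier ?P"
          by (rule p)
      qed
      ultimately have "- tensor p ?t \<in> induced_rel n m ?N"
        by metis
      then have "- (- tensor p ?t) \<in> induced_rel n m ?N"
        unfolding induced_rel_def by (rule fvs.span_neg)
      then show "tensor p ?t \<in> induced_rel n m ?N"
        by simp
    qed
  qed
  have "character_module (n + m) ?AB (quotient_module (fun_module ?V ?act) (induced_rel n m ?N))
      (\<lambda>U. \<theta> (SOME u. u \<in> U))"
  proof (rule quotient_character_module[OF AB V rel])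
    show "\<theta> (u + v) = \<theta> u + \<theta> v" for u v
      by (simp add: \<theta>_def character_def sum.distrib)
    show "\<exists>v\<in>?V. \<theta> v = c" for c
    proof (rule bexI)
      show "\<theta> (tensor (fscale c \<one>\<^bsub>?P\<^esub>) ?t) = c"
        unfolding \<theta>_tensor character_scale character_one[OF AB] by simp
      show "tensor (fscale c \<one>\<^bsub>?P\<^esub>) ?t \<in> ?V"
        by (intro imageI fvs.subspace_scale[OF subspace_part_algebra] part_algebra_one_closed)
    qed
    show "?act a v \<in> ?V \<and> \<theta> (?act a v) = ?chi a * \<theta> v" if "v \<in> ?V" for a v
      using that by (auto simp: act \<theta>_tensor character_mult[OF AB] part_algebra_mult_closed simp del: part_algebra_simps)
  qed
  then show ?thesis
    unfolding induced_module_def pre \<theta>_def .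
qed

section \<open>Linear maps given on a basis\<close>

lemma linear_on_zero:
  assumes "linear_on s1 s2 V f" "0 \<in> V"
  shows "f 0 = 0"
  using assms unfolding linear_on_def by (metis add_0 add_cancel_left_left)

lemma linear_on_span_eq:
  assumes f: "linear_on fscale s2 (fvs.span B) f" and g: "linear_on fscale s2 (fvs.span B) g"
    and eq: "\<And>b. b \<in> B \<Longrightarrow> f b = g b" and v: "v \<in> fvs.span B"
  shows "f v = g v"
proof -
  have "v \<in> fvs.span B \<and> f v = g v"
    using v
  proof (induction rule: fvs.span_induct_alt)
    case base
    show "0 \<in> fvs.span B \<and> f 0 = g 0"
      using linear_on_zero[OF f fvs.span_zero] linear_on_zero[OF g fvs.span_zero] by (simp add: fvs.span_zero)
  next
    case (step c x y)
    then have "x \<in> fvs.span B" "fscale c x \<in> fvs.span B"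
      by (simp_all add: fvs.span_base fvs.span_scale)
    with step show "fscale c x + y \<in> fvs.span B \<and> f (fscale c x + y) = g (fscale c x + y)"
      using f g eq[of x] unfolding linear_on_def by (simp add: fvs.span_add)
  qed
  then show ?thesis ..
qed

lemma linear_on_span_in:
  assumes f: "linear_on fscale fscale (fvs.span B) f" and W: "fvs.subspace W"
    and B: "\<And>b. b \<in> B \<Longrightarrow> f b \<in> W" and v: "v \<in> fvs.span B"
  shows "f v \<in> W"
proof -
  have "v \<in> fvs.span B \<and> f v \<in> W"
    using v
  proof (induction rule: fvs.span_induct_alt)
    case base
    show "0 \<in> fvs.span B \<and> f 0 \<in> W"
      using linear_on_zero[OF f fvs.span_zero] by (simp add: fvs.span_zero fvs.subspace_0[OF W])
  next
    case (step c x y)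
    then have "x \<in> fvs.span B" "fscale c x \<in> fvs.span B"
      by (simp_all add: fvs.span_base fvs.span_scale)
    with step show "fscale c x + y \<in> fvs.span B \<and> f (fscale c x + y) \<in> W"
      using f B[of x] unfolding linear_on_def
      by (simp add: fvs.span_add fvs.subspace_add[OF W] fvs.subspace_scale[OF W])
  qed
  then show ?thesis ..
qed

lemma linear_on_compose:
  assumes "linear_on s1 s2 V f" "linear_on s2 s3 W g" "\<And>v. v \<in> V \<Longrightarrow> f v \<in> W"
  shows "linear_on s1 s3 V (\<lambda>v. g (f v))"
  using assms unfolding linear_on_def by simp

lemma linear_on_subset: "linear_on s1 s2 W f \<Longrightarrow> V \<subseteq> W \<Longrightarrow> linear_on s1 s2 V f"
  unfolding linear_on_def by blast

lemma linear_on_sum: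
  assumes f: "linear_on fscale s2 V f" and V: "fvs.subspace V" and v: "\<And>i. i \<in> I \<Longrightarrow> v i \<in> V"
  shows "f (\<Sum>i\<in>I. v i) = (\<Sum>i\<in>I. f (v i))"
  using v
proof (induction I rule: infinite_finite_induct)
  case (insert i I)
  then have "(\<Sum>i\<in>I. v i) \<in> V"
    by (intro fvs.subspace_sum[OF V]) simp
  with insert f show "f (\<Sum>i\<in>insert i I. v i) = (\<Sum>i\<in>insert i I. f (v i))"
    by (simp add: linear_on_def)
qed (simp_all only: sum.infinite sum.empty linear_on_zero[OF f fvs.subspace_0[OF V]] not_False_eq_True)

lemma linear_on_sum_scale:
  assumes f: "linear_on fscale s2 V f" and V: "fvs.subspace V" and v: "\<And>i. i \<in> I \<Longrightarrow> v i \<in> V"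
  shows "f (\<Sum>i\<in>I. fscale (c i) (v i)) = (\<Sum>i\<in>I. s2 (c i) (f (v i)))"
proof -
  have "f (\<Sum>i\<in>I. fscale (c i) (v i)) = (\<Sum>i\<in>I. f (fscale (c i) (v i)))"
    by (rule linear_on_sum[OF f V]) (simp add: v fvs.subspace_scale[OF V])
  also have "\<dots> = (\<Sum>i\<in>I. s2 (c i) (f (v i)))"
    using f v by (intro sum.cong refl) (simp add: linear_on_def)
  finally show ?thesis .
qed

text \<open>Instantiated with the defining equation of an operation chosen by \<open>SOME\<close>,
  this turns one witness into the property of the operation, while the goal keeps mentioning the
  constant.\<close>

lemma eq_Eps_spec: "x = Eps P \<Longrightarrow> P a \<Longrightarrow> P x"
  by (simp add: someI)

lemma vector_space_mult: "vector_space ((*) :: 'k::field \<Rightarrow> 'k \<Rightarrow> 'k)"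
  by unfold_locales (auto simp: algebra_simps)

text \<open>Points dual to a family of functions witness its linear independence.\<close>

definition dual_points :: "'i set \<Rightarrow> ('i \<Rightarrow> 'x \<Rightarrow> 'k::field) \<Rightarrow> ('i \<Rightarrow> 'x) \<Rightarrow> bool"
  where "dual_points I b pt \<longleftrightarrow> (\<forall>i\<in>I. \<forall>j\<in>I. b i (pt j) = (if i = j then 1 else 0))"

text \<open>Evaluation at a dual point extracts one coefficient of a linear combination, so the
  family is independent and prescribed values extend to the whole function space. The target is an
  arbitrary vector space, so that counits with values in the field are included.\<close>

lemma linear_extension:
  fixes b :: "'i \<Rightarrow> 'x \<Rightarrow> 'k::field" and h :: "'i \<Rightarrow> 'v::ab_group_add"
  assumes dual: "dual_points I b pt" and s2: "vector_space s2"
  shows "\<exists>D. linear_on fscale s2 UNIV D \<and> (\<forall>i\<in>I. D (b i) = h i)"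
proof -
  interpret vector_space_pair "fscale :: 'k \<Rightarrow> ('x \<Rightarrow> 'k) \<Rightarrow> 'x \<Rightarrow> 'k" s2
    by (intro vector_space_pair.intro s2 fvs.vector_space_axioms)
  have eval: "b i (pt j) = (if i = j then 1 else 0)" if "i \<in> I" "j \<in> I" for i j
    using dual that by (simp add: dual_points_def)
  have inj: "inj_on b I"
  proof (rule inj_onI)
    fix i j assume i: "i \<in> I" and j: "j \<in> I" and eq: "b i = b j"
    have "b i (pt i) = b j (pt i)"
      by (rule fun_cong[OF eq])
    then show "i = j"
      unfolding eval[OF i i] eval[OF j i] by (simp split: if_splits)
  qed
  have "fvs.independent (b ` I)"
    unfolding fvs.independent_explicit_module
  proof (intro allI impI)
    fix t u v
    assume t: "finite t" "t \<subseteq> b ` I" and sum: "(\<Sum>v\<in>t. fscale (u v) v) = 0" and v: "v \<in> t"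
    obtain i where i: "i \<in> I" "v = b i"
      using t v by blast
    have "0 = (\<Sum>w\<in>t. fscale (u w) w) (pt i)"
      by (simp add: sum)
    also have "\<dots> = (\<Sum>w\<in>t. if w = v then u w else 0)"
      unfolding fun_sum_apply
    proof (intro sum.cong refl)
      fix w assume "w \<in> t"
      then obtain j where j: "j \<in> I" "w = b j"
        using t by blast
      have "w = v \<longleftrightarrow> j = i"
        using inj_on_eq_iff[OF inj j(1) i(1)] j i by simp
      moreover have "w (pt i) = (if j = i then 1 else 0)"
        unfolding j(2) by (rule eval[OF j(1) i(1)])
      ultimately show "fscale (u w) w (pt i) = (if w = v then u w else 0)"
        by (simp add: fscale_apply)
    qed
    also have "\<dots> = u v"
      using t v by simp
    finally show "u v = 0" ..
  qed
  from linear_independent_extend[OF this, of "\<lambda>v. h (inv_into I b v)"]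
  obtain D where D: "Vector_Spaces.linear fscale s2 D" "\<forall>v\<in>b ` I. D v = h (inv_into I b v)"
    by blast
  then have "linear_on fscale s2 UNIV D"
    by (simp add: linear_on_def linear_add linear_scale)
  moreover have "D (b i) = h i" if "i \<in> I" for i
    using D(2) inv_into_f_f[OF inj that] that by simp
  ultimately show ?thesis
    by blast
qed

lemma dual_points_tensor:
  assumes "dual_points I b pt" "dual_points J c qt"
  shows "dual_points (I \<times> J) (\<lambda>(i, j). tensor (b i) (c j)) (\<lambda>(i, j). (pt i, qt j))"
  using assms by (simp add: dual_points_def tensor_apply split_paired_all)

lemma linear_on_tensor_left: "linear_on fscale fscale V (\<lambda>v. tensor v w)"
  by (simp add: linear_on_def tensor_add_left tensor_scale_left)

lemma linear_on_tensor_right: "linear_on fscale fscale V (\<lambda>v. tensor w v)"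
  by (simp add: linear_on_def tensor_add_right tensor_scale_right)

text \<open>Bilinear maps are handled as linear maps on tensors: pairs of dual points are dual to
  the tensors of basis vectors, so values on pairs may be prescribed freely.\<close>

lemma bilinear_extension:
  fixes b :: "'i \<Rightarrow> 'x \<Rightarrow> 'k::field" and h :: "'i \<Rightarrow> 'i \<Rightarrow> 'y \<Rightarrow> 'k"
  assumes dual: "dual_points I b pt"
  obtains T where "linear_on fscale fscale UNIV T" "\<And>i j. i \<in> I \<Longrightarrow> j \<in> I \<Longrightarrow> T (tensor (b i) (b j)) = h i j"
proof -
  obtain T where "linear_on fscale fscale UNIV T"
    "\<forall>p\<in>I \<times> I. T ((\<lambda>(i, j). tensor (b i) (b j)) p) = (\<lambda>(i, j). h i j) p"
    using linear_extension[OF dual_points_tensor[OF dual dual] fvs.vector_space_axioms] by blast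
  then show thesis
    by (intro that[of T]) simp_all
qed

lemma bilinear_span_eq:
  assumes f1: "\<And>w. w \<in> fvs.span B \<Longrightarrow> linear_on fscale sc (fvs.span A) (\<lambda>v. f v w)"
    and f2: "\<And>v. v \<in> fvs.span A \<Longrightarrow> linear_on fscale sc (fvs.span B) (f v)"
    and g1: "\<And>w. w \<in> fvs.span B \<Longrightarrow> linear_on fscale sc (fvs.span A) (\<lambda>v. g v w)"
    and g2: "\<And>v. v \<in> fvs.span A \<Longrightarrow> linear_on fscale sc (fvs.span B) (g v)"
    and eq: "\<And>a b. a \<in> A \<Longrightarrow> b \<in> B \<Longrightarrow> f a b = g a b"
    and v: "v \<in> fvs.span A" and w: "w \<in> fvs.span B"
  shows "f v w = g v w"
proof (rule linear_on_span_eq[OF f1[OF w] g1[OF w] _ v])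
  fix a assume a: "a \<in> A"
  then have a': "a \<in> fvs.span A"
    by (rule fvs.span_base)
  show "f a w = g a w"
    using eq[OF a] by (rule linear_on_span_eq[OF f2[OF a'] g2[OF a'] _ w])
qed

text \<open>Provides a witness for the choice in \<open>tensor_map\<close>: a linear map prescribed
  on tensors of basis vectors, which bilinearity then determines on all pure tensors.\<close>

lemma tensor_map_spec:
  fixes b :: "'i \<Rightarrow> 'x \<Rightarrow> 'k::field" and F :: "('x \<Rightarrow> 'k) \<Rightarrow> 'y \<Rightarrow> 'k"
  assumes dual: "dual_points I b pt" and V: "V = fvs.span (b ` I)"
    and F: "linear_on fscale fscale V F"
  shows "linear_on fscale fscale (tensor_space V V) (tensor_map V F) \<and>
    (\<forall>v\<in>V. \<forall>w\<in>V. tensor_map V F (tensor v w) = tensor (F v) (F w))"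
proof -
  obtain T where T: "linear_on fscale fscale UNIV T"
    "\<And>i j. i \<in> I \<Longrightarrow> j \<in> I \<Longrightarrow> T (tensor (b i) (b j)) = tensor (F (b i)) (F (b j))"
    using bilinear_extension[OF dual, of "\<lambda>i j. tensor (F (b i)) (F (b j))"] by blast
  have "T (tensor v w) = tensor (F v) (F w)" if "v \<in> V" "w \<in> V" for v w
  proof (rule bilinear_span_eq[where A = "b ` I" and B = "b ` I" and sc = fscale and
        f = "\<lambda>v w. T (tensor v w)" and g = "\<lambda>v w. tensor (F v) (F w)"])
    show "linear_on fscale fscale (fvs.span (b ` I)) (\<lambda>v. T (tensor v w))" for w
      by (rule linear_on_compose[OF linear_on_tensor_left T(1)]) simp
    show "linear_on fscale fscale (fvs.span (b ` I)) (\<lambda>w. T (tensor v w))" for v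
      by (rule linear_on_compose[OF linear_on_tensor_right T(1)]) simp
    show "linear_on fscale fscale (fvs.span (b ` I)) (\<lambda>v. tensor (F v) (F w))" for w
      by (rule linear_on_compose[OF F[unfolded V] linear_on_tensor_left[of UNIV]]) simp
    show "linear_on fscale fscale (fvs.span (b ` I)) (\<lambda>w. tensor (F v) (F w))" for v
      by (rule linear_on_compose[OF F[unfolded V] linear_on_tensor_right[of UNIV]]) simp
    show "T (tensor v w) = tensor (F v) (F w)" if "v \<in> b ` I" "w \<in> b ` I" for v w
      using that T(2) by blast
    show "v \<in> fvs.span (b ` I)" "w \<in> fvs.span (b ` I)"
      using that by (simp_all only: V)
  qed
  then have "linear_on fscale fscale (tensor_space V V) T \<and>
      (\<forall>v\<in>V. \<forall>w\<in>V. T (tensor v w) = tensor (F v) (F w))"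
    using linear_on_subset[OF T(1) subset_UNIV] by blast
  then show ?thesis
    by (rule eq_Eps_spec[OF tensor_map_def])
qed

lemma subspace_tensor_space: "fvs.subspace (tensor_space V W)"
  by (simp add: tensor_space_def)

section \<open>Structure constants of \<open>G\<^sub>0\<close>\<close>

abbreviation pairs :: "(nat \<times> setpart) set"
  where "pairs \<equiv> Sigma UNIV set_partitions"

abbreviation simple_basis :: "nat \<times> setpart \<Rightarrow> 'k::field_char_0 G0_vec"
  where "simple_basis \<equiv> \<lambda>(n, A). simple_class n A"

lemma simple_class_apply:
  assumes "A \<in> set_partitions n" "B \<in> set_partitions m"
  shows "(simple_class n A :: 'k::field_char_0 G0_vec) (m, iso_class m B) = (if n = m \<and> A = B then 1 else 0)"
  using assms iso_class_inject[of B n A] by (auto simp: simple_class_def delta_apply)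

lemma dual_points_simple:
  "dual_points pairs (simple_basis :: _ \<Rightarrow> 'k::field_char_0 G0_vec) (\<lambda>(n, A). (n, iso_class n A))"
  by (auto simp: dual_points_def simple_class_apply)

lemma G0_space_span: "(G0_space :: 'k::field_char_0 G0_vec set) = fvs.span (simple_basis ` pairs)"
proof -
  have "{simple_class n A |n A. A \<in> set_partitions n} = (simple_basis ` pairs :: 'k G0_vec set)"
    by (auto simp: image_iff)
  then show ?thesis
    by (simp only: G0_space_def)
qed

lemma subspace_G0: "fvs.subspace G0_space"
  by (simp add: G0_space_span)

lemma simple_class_in: "A \<in> set_partitions n \<Longrightarrow> simple_class n A \<in> G0_space"
  unfolding G0_space_def by (intro fvs.span_base) blast

text \<open>The witness is a linear map on tensors composed with \<open>tensor\<close>. It exists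
  whatever the prescribed classes are, so their evaluation can be left to
  \<open>G0_mult_simple\<close>.\<close>

lemma G0_mult_spec:
  "(\<forall>v\<in>G0_space. linear_on fscale fscale G0_space (G0_mult (v :: 'k::field_char_0 G0_vec))) \<and>
   (\<forall>w\<in>G0_space. linear_on fscale fscale G0_space (\<lambda>v. G0_mult v (w :: 'k G0_vec))) \<and>
   (\<forall>n m. \<forall>A\<in>set_partitions n. \<forall>B\<in>set_partitions m.
      G0_mult (simple_class n A) (simple_class m B) =
        (G0_class (n + m) (induced_module n m (outer_tensor n m A B)) :: 'k G0_vec))"
proof -
  let ?h = "\<lambda>(n, A) (m, B). G0_class (n + m) (induced_module n m (outer_tensor n m A B)) :: 'k G0_vec"
  obtain T where T: "linear_on fscale fscale UNIV T"
    "\<And>i j. i \<in> pairs \<Longrightarrow> j \<in> pairs \<Longrightarrow> T (tensor (simple_basis i) (simple_basis j)) = ?h i j"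
    using bilinear_extension[OF dual_points_simple, of ?h] by blast
  have "linear_on fscale fscale G0_space (\<lambda>w. T (tensor v w))" for v
    by (rule linear_on_compose[OF linear_on_tensor_right T(1)]) simp
  moreover have "linear_on fscale fscale G0_space (\<lambda>v. T (tensor v w))" for w
    by (rule linear_on_compose[OF linear_on_tensor_left T(1)]) simp
  moreover have "T (tensor (simple_class n A) (simple_class m B)) =
      G0_class (n + m) (induced_module n m (outer_tensor n m A B))"
    if "A \<in> set_partitions n" "B \<in> set_partitions m" for n m A B
    using T(2)[of "(n, A)" "(m, B)"] that by simp
  ultimately show ?thesis
    by (intro eq_Eps_spec[OF G0_mult_def, where a = "\<lambda>v w. T (tensor v w)"] conjI ballI allI) simp_all
qed

lemma G0_mult_simple:
  assumes "A \<in> set_partitions n" "B \<in> set_partitions m"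
  shows "G0_mult (simple_class n A) (simple_class m B) =
    (simple_class (n + m) (part_concat n A B) :: 'k::field_char_0 G0_vec)"
proof -
  have "G0_mult (simple_class n A) (simple_class m B) =
      (G0_class (n + m) (induced_module n m (outer_tensor n m A B)) :: 'k G0_vec)"
    using G0_mult_spec assms by blast
  then show ?thesis
    by (simp only: character_module.G0_class_M[OF induced_module_character[OF assms]])
qed

text \<open>The map \<open>F\<close> is only known to be linear on \<open>G0_space\<close>, so
  composing it with the product presupposes closure.\<close>

lemma G0_mult_in:
  assumes "v \<in> G0_space" "w \<in> G0_space"
  shows "G0_mult v w \<in> (G0_space :: 'k::field_char_0 G0_vec set)"
proof -
  have lin: "linear_on fscale fscale G0_space (G0_mult u)" "linear_on fscale fscale G0_space (\<lambda>v. G0_mult v u)"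
    if "u \<in> G0_space" for u :: "'k G0_vec"
    using G0_mult_spec that by blast+
  let ?B = "{simple_class n A |n A. A \<in> set_partitions n} :: 'k G0_vec set"
  have B: "fvs.span ?B = G0_space"
    by (simp only: G0_space_def)
  have B_in: "b \<in> G0_space" if "b \<in> ?B" for b
    using fvs.span_base[OF that] by (simp only: B)
  have basis: "G0_mult b c \<in> G0_space" if b: "b \<in> ?B" and c: "c \<in> ?B" for b c
  proof -
    obtain n A where A: "b = simple_class n A" "A \<in> set_partitions n"
      using b by blast
    obtain m C where C: "c = simple_class m C" "C \<in> set_partitions m"
      using c by blast
    show ?thesis
      unfolding A(1) C(1) G0_mult_simple[OF A(2) C(2)] by (intro simple_class_in part_concat_in A C)
  qed
  have "G0_mult b w \<in> G0_space" if b: "b \<in> ?B" for b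
    by (rule linear_on_span_in[where B = ?B and f = "G0_mult b", unfolded B,
          OF lin(1)[OF B_in[OF b]] subspace_G0 basis[OF b] assms(2)])
  then show ?thesis
    by (rule linear_on_span_in[where B = ?B and f = "\<lambda>v. G0_mult v w", unfolded B,
          OF lin(2)[OF assms(2)] subspace_G0 _ assms(1)])
qed

lemma G0_comult_spec:
  "linear_on fscale fscale (G0_space :: 'k::field_char_0 G0_vec set) G0_comult \<and>
   (\<forall>n. \<forall>C\<in>set_partitions n. G0_comult (simple_class n C :: 'k G0_vec) =
     (\<Sum>A\<in>set_partitions n. \<Sum>B\<in>set_partitions n.
       fscale (G0_class n (inner_tensor n A B :: ('k part_vec, 'k part_vec2) module) (n, iso_class n C))
         (tensor (simple_class n A) (simple_class n B))))"
proof -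
  let ?h = "\<lambda>(n, C). (\<Sum>A\<in>set_partitions n. \<Sum>B\<in>set_partitions n.
       fscale (G0_class n (inner_tensor n A B :: ('k part_vec, 'k part_vec2) module) (n, iso_class n C))
         (tensor (simple_class n A) (simple_class n B)))"
  obtain D where D: "linear_on fscale fscale UNIV D" "\<forall>i\<in>pairs. D (simple_basis i :: 'k G0_vec) = ?h i"
    using linear_extension[OF dual_points_simple fvs.vector_space_axioms, of ?h] by blast
  have "D (simple_class n C) = ?h (n, C)" if "C \<in> set_partitions n" for n C
    using D(2)[rule_format, of "(n, C)"] that by simp
  then show ?thesis
    using linear_on_subset[OF D(1) subset_UNIV]
    by (intro eq_Eps_spec[OF G0_comult_def, where a = D] conjI ballI allI) simp_all
qed

text \<open>The diagonal tensor product is a single line, so its multiplicities are 0 or 1 and pick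
  out the pairs whose join is \<open>C\<close>.\<close>

lemma G0_comult_simple:
  assumes C: "C \<in> set_partitions n"
  shows "G0_comult (simple_class n C :: 'k::field_char_0 G0_vec) =
    (\<Sum>p | p \<in> set_partitions n \<times> set_partitions n \<and> part_join n (fst p) (snd p) = C.
      tensor (simple_class n (fst p)) (simple_class n (snd p)))"
proof -
  have "G0_comult (simple_class n C :: 'k G0_vec) = (\<Sum>A\<in>set_partitions n. \<Sum>B\<in>set_partitions n.
      if part_join n A B = C then tensor (simple_class n A) (simple_class n B) else 0)"
  proof -
    have "G0_comult (simple_class n C :: 'k G0_vec) =
      (\<Sum>A\<in>set_partitions n. \<Sum>B\<in>set_partitions n.
       fscale (G0_class n (inner_tensor n A B :: ('k part_vec, 'k part_vec2) module) (n, iso_class n C))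
         (tensor (simple_class n A) (simple_class n B)))"
      using G0_comult_spec C by blast
    also have "\<dots> = (\<Sum>A\<in>set_partitions n. \<Sum>B\<in>set_partitions n.
      if part_join n A B = C then tensor (simple_class n A) (simple_class n B) else 0)"
      by (intro sum.cong refl)
        (simp add: character_module.G0_class_M[OF inner_tensor_character] simple_class_apply part_join_in C)
    finally show ?thesis .
  qed
  also have "\<dots> = (\<Sum>p\<in>set_partitions n \<times> set_partitions n.
      if part_join n (fst p) (snd p) = C then tensor (simple_class n (fst p)) (simple_class n (snd p)) else 0)"
    by (simp only: sum.cartesian_product split_def)
  also have "\<dots> = (\<Sum>p | p \<in> set_partitions n \<times> set_partitions n \<and> part_join n (fst p) (snd p) = C.
      tensor (simple_class n (fst p)) (simple_class n (snd p)))"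
    by (intro sum.inter_filter[symmetric] finite_cartesian_product finite_set_partitions)
  finally show ?thesis .
qed

lemma G0_counit_spec:
  "linear_on fscale (*) G0_space (G0_counit :: 'k::field_char_0 G0_vec \<Rightarrow> 'k) \<and>
   (\<forall>n. \<forall>A\<in>set_partitions n.
      G0_counit (simple_class n A :: 'k G0_vec) = (if A = \<bottom>\<^bsub>part_lattice n\<^esub> then 1 else 0))"
proof -
  obtain e :: "'k G0_vec \<Rightarrow> 'k" where e: "linear_on fscale (*) UNIV e"
    "\<forall>i\<in>pairs. e (simple_basis i) = (\<lambda>(n, A). if A = \<bottom>\<^bsub>part_lattice n\<^esub> then 1 else 0) i"
    using linear_extension[OF dual_points_simple vector_space_mult] by blast
  have "e (simple_class n A) = (if A = \<bottom>\<^bsub>part_lattice n\<^esub> then 1 else 0)" if "A \<in> set_partitions n" for n A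
    using e(2)[rule_format, of "(n, A)"] that by simp
  then show ?thesis
    using linear_on_subset[OF e(1) subset_UNIV]
    by (intro eq_Eps_spec[OF G0_counit_def, where a = e] conjI ballI allI) simp_all
qed

section \<open>Symmetric functions in noncommuting variables\<close>

text \<open>The classes of positions carrying equal letters; position \<open>a\<close> is list index
  \<open>a - 1\<close>. The words occurring in m_A are the positive ones with kernel A.\<close>

definition word_kernel :: "nat \<Rightarrow> nat list \<Rightarrow> setpart"
  where "word_kernel n w = fibre_partition n (\<lambda>a. w ! (a - 1))"

definition positive_word :: "nat \<Rightarrow> nat list \<Rightarrow> bool"
  where "positive_word n w \<longleftrightarrow> length w = n \<and> (\<forall>i\<in>set w. 1 \<le> i)"

lemma word_kernel_in: "word_kernel n w \<in> set_partitions n"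
  by (simp add: word_kernel_def fibre_partition_in)

lemma ncsym_m_apply:
  assumes A: "A \<in> set_partitions n"
  shows "ncsym_m n A w = (if positive_word n w \<and> A = word_kernel n w then 1 else 0)"
proof -
  have "(\<forall>a\<in>{1..n}. \<forall>b\<in>{1..n}. w ! (a - 1) = w ! (b - 1) \<longleftrightarrow> (\<exists>P\<in>A. a \<in> P \<and> b \<in> P)) \<longleftrightarrow>
      A = word_kernel n w"
    unfolding same_block_def[symmetric]
  proof
    assume h: "\<forall>a\<in>{1..n}. \<forall>b\<in>{1..n}. w ! (a - 1) = w ! (b - 1) \<longleftrightarrow> same_block A a b"
    show "A = word_kernel n w"
    proof (rule set_partition_eqI[OF A word_kernel_in])
      show "same_block A a b \<longleftrightarrow> same_block (word_kernel n w) a b" for a b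
        unfolding word_kernel_def same_block_fibre_partition using h same_block_bounds[OF A, of a b] by blast
    qed
  next
    assume "A = word_kernel n w"
    then show "\<forall>a\<in>{1..n}. \<forall>b\<in>{1..n}. w ! (a - 1) = w ! (b - 1) \<longleftrightarrow> same_block A a b"
      by (simp add: word_kernel_def same_block_fibre_partition)
  qed
  then show ?thesis
    by (simp add: ncsym_m_def positive_word_def)
qed

lemma ncsym_p_apply:
  assumes A: "A \<in> set_partitions n"
  shows "(ncsym_p n A w :: 'k::field_char_0) = (if positive_word n w \<and> refines {1..n} A (word_kernel n w) then 1 else 0)"
proof -
  have "(ncsym_p n A w :: 'k) = (\<Sum>B | refines {1..n} A B. if B = word_kernel n w then
      (if positive_word n w then 1 else 0) else 0)"
    unfolding ncsym_p_def fun_sum_apply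
  proof (intro sum.cong refl)
    fix B assume "B \<in> {B. refines {1..n} A B}"
    then have "B \<in> set_partitions n"
      using refines_in_set_partitions by blast
    then show "(ncsym_m n B w :: 'k) = (if B = word_kernel n w then (if positive_word n w then 1 else 0) else 0)"
      by (simp add: ncsym_m_apply)
  qed
  also have "\<dots> = (if refines {1..n} A (word_kernel n w) then (if positive_word n w then 1 else 0) else 0)"
    by (simp add: finite_upper)
  finally show ?thesis
    by simp
qed

lemma ex_word_kernel:
  assumes A: "A \<in> set_partitions n"
  shows "\<exists>w. positive_word n w \<and> word_kernel n w = A"
proof -
  \<comment> \<open>Each position receives the least element of its block as its letter: equal
    within a block, different across blocks, and positive.\<close>
  define f where "f a = Min {b. same_block A a b}" for a
  have fin: "finite {b. same_block A a b}" for a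
    by (rule finite_subset[of _ "{1..n}"]) (use same_block_bounds[OF A] in auto)
  have f: "same_block A a (f a)" if "a \<in> {1..n}" for a
    using Min_in[OF fin[of a]] same_block_refl[OF A that] unfolding f_def by blast
  have f_eq: "f a = f b \<longleftrightarrow> same_block A a b" if "a \<in> {1..n}" "b \<in> {1..n}" for a b
  proof
    assume "f a = f b"
    then show "same_block A a b"
      using f[OF that(1)] f[OF that(2)] same_block_sym same_block_trans[OF A] by metis
  next
    assume "same_block A a b"
    then have "{c. same_block A a c} = {c. same_block A b c}"
      using same_block_sym same_block_trans[OF A] by blast
    then show "f a = f b"
      by (simp add: f_def)
  qed
  define w where "w = map (\<lambda>i. f (i + 1)) [0..<n]"
  have w: "w ! (a - 1) = f a" if "a \<in> {1..n}" for a
  proof -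
    have "a - 1 < n" "a - 1 + 1 = a"
      using that by auto
    then show ?thesis
      unfolding w_def by (subst nth_map) simp_all
  qed
  have "positive_word n w"
    using same_block_bounds[OF A f] by (auto simp: positive_word_def w_def)
  moreover have "word_kernel n w = A"
  proof (rule set_partition_eqI[OF word_kernel_in A])
    show "same_block (word_kernel n w) a b \<longleftrightarrow> same_block A a b" for a b
      unfolding word_kernel_def same_block_fibre_partition
      using f_eq[of a b] w same_block_bounds[OF A, of a b] by metis
  qed
  ultimately show ?thesis
    by blast
qed

section \<open>Independence of the monomial functions and changes of basis\<close>

abbreviation m_basis :: "nat \<times> setpart \<Rightarrow> 'k::field_char_0 nc_series"
  where "m_basis \<equiv> \<lambda>(n, A). ncsym_m n A"

text \<open>A positive word occurs only in the monomial function indexed by its length and its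
  kernel, so words with prescribed kernels serve as dual points.\<close>

lemma dual_points_m: "\<exists>pt. dual_points pairs (m_basis :: _ \<Rightarrow> 'k::field_char_0 nc_series) pt"
proof -
  have "\<forall>i\<in>pairs. \<exists>w. positive_word (fst i) w \<and> word_kernel (fst i) w = snd i"
    using ex_word_kernel by auto
  then obtain pt where pt: "\<And>i. i \<in> pairs \<Longrightarrow> positive_word (fst i) (pt i) \<and> word_kernel (fst i) (pt i) = snd i"
    by metis
  have "m_basis (n, A) (pt (m, B)) = (if (n, A) = (m, B) then 1 else 0 :: 'k)"
    if "A \<in> set_partitions n" "B \<in> set_partitions m" for n m A B
    using that pt[of "(m, B)"] by (auto simp: ncsym_m_apply positive_word_def)
  then show ?thesis
    unfolding dual_points_def by (intro exI[of _ pt]) auto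
qed

lemma ncsym_space_span: "(ncsym_space :: 'k::field_char_0 nc_series set) = fvs.span (m_basis ` pairs)"
proof -
  have "{ncsym_m n A |n A. A \<in> set_partitions n} = (m_basis ` pairs :: 'k nc_series set)"
    by (auto simp: image_iff)
  then show ?thesis
    by (simp only: ncsym_space_def)
qed

lemma subspace_ncsym: "fvs.subspace ncsym_space"
  by (simp add: ncsym_space_span)

lemma ncsym_m_in: "A \<in> set_partitions n \<Longrightarrow> ncsym_m n A \<in> ncsym_space"
  unfolding ncsym_space_def by (intro fvs.span_base) blast

lemma ncsym_p_in: "ncsym_p n A \<in> ncsym_space"
  unfolding ncsym_p_def using refines_in_set_partitions
  by (intro fvs.subspace_sum[OF subspace_ncsym] ncsym_m_in) blast

lemma ncsym_x_in: "ncsym_x n A \<in> ncsym_space"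
  unfolding ncsym_x_def
  by (intro fvs.subspace_sum[OF subspace_ncsym] fvs.subspace_scale[OF subspace_ncsym] ncsym_p_in)

lemma ncsym_p_eq_sum_x:
  assumes "A \<in> set_partitions n"
  shows "ncsym_p n A = (\<Sum>B | refines {1..n} B A. ncsym_x n B)"
  by (rule moebius_inversion_lower_converse[OF assms, symmetric]) (simp add: ncsym_x_def)

lemma ncsym_m_eq_sum_p:
  assumes "A \<in> set_partitions n"
  shows "ncsym_m n A = (\<Sum>B | refines {1..n} A B. fscale (of_int (moebius n A B)) (ncsym_p n B))"
  by (rule moebius_inversion_upper[OF assms, symmetric]) (simp add: ncsym_p_def)

section \<open>The product on power sums and on the x-basis\<close>

lemma ncsym_mult_linear_left: "linear_on fscale fscale V (\<lambda>f. ncsym_mult f g)"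
  by (simp add: linear_on_def ncsym_mult_def fun_eq_iff fscale_apply distrib_right sum.distrib mult.assoc
      sum_distrib_left)

lemma ncsym_mult_linear_right: "linear_on fscale fscale V (ncsym_mult g)"
  by (simp add: linear_on_def ncsym_mult_def fun_eq_iff fscale_apply distrib_left sum.distrib mult.left_commute
      sum_distrib_left)

text \<open>Refining a kernel means that letters are constant on blocks, and each block of A|B lies
  entirely in the prefix or entirely in the suffix of the word.\<close>

lemma concat_refines_word_kernel:
  assumes A: "A \<in> set_partitions n" and B: "B \<in> set_partitions m" and len: "length w = n + m"
  shows "refines {1..n + m} (part_concat n A B) (word_kernel (n + m) w) \<longleftrightarrow>
    refines {1..n} A (word_kernel n (take n w)) \<and> refines {1..m} B (word_kernel m (drop n w))"
proof -
  have tk: "take n w ! (a - 1) = w ! (a - 1)" if "a \<in> {1..n}" for a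
    using that by (intro nth_take) auto
  have dr: "drop n w ! (a - 1) = w ! (a + n - 1)" if "a \<in> {1..m}" for a
  proof -
    have "n + (a - 1) = a + n - 1"
      using that by auto
    then show ?thesis
      using len by (subst nth_drop) simp_all
  qed
  have A_iff: "(\<forall>a b. same_block A a b \<longrightarrow> take n w ! (a - 1) = take n w ! (b - 1)) \<longleftrightarrow>
      (\<forall>a b. same_block A a b \<longrightarrow> w ! (a - 1) = w ! (b - 1))"
  proof (intro iff_allI imp_cong refl)
    fix a b assume "same_block A a b"
    from same_block_bounds[OF A this]
    show "(take n w ! (a - 1) = take n w ! (b - 1)) \<longleftrightarrow> (w ! (a - 1) = w ! (b - 1))"
      by (simp only: tk)
  qed
  have B_iff: "(\<forall>a b. same_block B a b \<longrightarrow> drop n w ! (a - 1) = drop n w ! (b - 1)) \<longleftrightarrow>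
      (\<forall>a b. same_block B a b \<longrightarrow> w ! (a + n - 1) = w ! (b + n - 1))"
  proof (intro iff_allI imp_cong refl)
    fix a b assume "same_block B a b"
    from same_block_bounds[OF B this]
    show "(drop n w ! (a - 1) = drop n w ! (b - 1)) \<longleftrightarrow> (w ! (a + n - 1) = w ! (b + n - 1))"
      by (simp only: dr)
  qed
  have "(\<forall>a b. n \<le> a \<and> n \<le> b \<and> same_block B (a - n) (b - n) \<longrightarrow> w ! (a - 1) = w ! (b - 1)) \<longleftrightarrow>
      (\<forall>a b. same_block B a b \<longrightarrow> w ! (a + n - 1) = w ! (b + n - 1))" (is "?l \<longleftrightarrow> ?r")
  proof
    assume h: ?l
    show ?r
    proof (intro allI impI)
      fix a b assume "same_block B a b"
      then show "w ! (a + n - 1) = w ! (b + n - 1)"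
        using h[rule_format, of "a + n" "b + n"] by simp
    qed
  next
    assume h: ?r
    show ?l
    proof (intro allI impI)
      fix a b assume "n \<le> a \<and> n \<le> b \<and> same_block B (a - n) (b - n)"
      then show "w ! (a - 1) = w ! (b - 1)"
        using h[rule_format, of "a - n" "b - n"] by simp
    qed
  qed
  then show ?thesis
    unfolding word_kernel_def refines_fibre_partition_iff[OF A] refines_fibre_partition_iff[OF B]
      refines_fibre_partition_iff[OF part_concat_in[OF A B]] same_block_concat A_iff B_iff
    by blast
qed

lemma ncsym_p_mult:
  assumes A: "A \<in> set_partitions n" and B: "B \<in> set_partitions m"
  shows "ncsym_mult (ncsym_p n A) (ncsym_p m B) =
    (ncsym_p (n + m) (part_concat n A B) :: 'k::field_char_0 nc_series)"
proof
  fix w :: "nat list"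
  \<comment> \<open>Homogeneity of the left factor leaves only the cut after position
    \<open>n\<close>.\<close>
  have "(ncsym_mult (ncsym_p n A) (ncsym_p m B) :: 'k nc_series) w =
      (\<Sum>i\<le>length w. if i = n then ncsym_p n A (take n w) * ncsym_p m B (drop n w) else 0)"
    unfolding ncsym_mult_def
    by (intro sum.cong refl) (auto simp: ncsym_p_apply[OF A] positive_word_def)
  also have "\<dots> = (if n \<le> length w then ncsym_p n A (take n w) * ncsym_p m B (drop n w) else 0)"
    by simp
  also have "\<dots> = ncsym_p (n + m) (part_concat n A B) w"
  proof (cases "length w = n + m")
    case True
    have "set w = set (take n w) \<union> set (drop n w)"
      by (metis append_take_drop_id set_append)
    then have "positive_word (n + m) w \<longleftrightarrow> positive_word n (take n w) \<and> positive_word m (drop n w)"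
      using True by (auto simp: positive_word_def)
    with True show ?thesis
      by (simp add: ncsym_p_apply A B part_concat_in concat_refines_word_kernel[OF A B True])
  next
    case False
    then show ?thesis
      by (auto simp: ncsym_p_apply A B part_concat_in positive_word_def)
  qed
  finally show "(ncsym_mult (ncsym_p n A) (ncsym_p m B) :: 'k nc_series) w =
      ncsym_p (n + m) (part_concat n A B) w" .
qed

text \<open>Expanding both factors of a product of power sums in the x-basis gives a double sum over
  lower sets; inversion over concatenations isolates its top term.\<close>

lemma ncsym_x_mult:
  assumes A: "A \<in> set_partitions n" and B: "B \<in> set_partitions m"
  shows "ncsym_mult (ncsym_x n A) (ncsym_x m B) =
    (ncsym_x (n + m) (part_concat n A B) :: 'k::field_char_0 nc_series)"
proof -
  have "ncsym_p (n + m) (part_concat n C D) =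
      (\<Sum>C' | refines {1..n} C' C. \<Sum>D' | refines {1..m} D' D.
        ncsym_mult (ncsym_x n C') (ncsym_x m D') :: 'k nc_series)"
    if C: "C \<in> set_partitions n" and D: "D \<in> set_partitions m" for C D
  proof -
    have "ncsym_p (n + m) (part_concat n C D) =
        ncsym_mult (\<Sum>C' | refines {1..n} C' C. ncsym_x n C')
          (\<Sum>D' | refines {1..m} D' D. ncsym_x m D' :: 'k nc_series)"
      unfolding ncsym_p_mult[OF C D, symmetric] ncsym_p_eq_sum_x[OF C] ncsym_p_eq_sum_x[OF D] ..
    also have "\<dots> = (\<Sum>C' | refines {1..n} C' C. ncsym_mult (ncsym_x n C')
          (\<Sum>D' | refines {1..m} D' D. ncsym_x m D'))"
      by (rule linear_on_sum[OF ncsym_mult_linear_left[of UNIV] fvs.subspace_UNIV]) simp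
    also have "\<dots> = (\<Sum>C' | refines {1..n} C' C. \<Sum>D' | refines {1..m} D' D.
        ncsym_mult (ncsym_x n C') (ncsym_x m D'))"
      by (intro sum.cong refl linear_on_sum[OF ncsym_mult_linear_right[of UNIV] fvs.subspace_UNIV]) simp
    finally show ?thesis .
  qed
  from moebius_inversion_concat[OF A B, where g = "\<lambda>C D. ncsym_mult (ncsym_x n C) (ncsym_x m D)", OF this]
  show ?thesis
    by (simp only: ncsym_x_def[of "n + m"])
qed

section \<open>Comultiplication and counit of NCSym\<close>

lemma ncsym_comult_spec:
  "linear_on fscale fscale (ncsym_space :: 'k::field_char_0 nc_series set) ncsym_comult \<and>
   (\<forall>n. \<forall>A\<in>set_partitions n. ncsym_comult (ncsym_m n A :: 'k nc_series) =
      (\<Sum>(B, C) \<in> {(B, C) \<in> set_partitions n \<times> set_partitions n.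
          B \<sqinter>\<^bsub>part_lattice n\<^esub> C = A}. tensor (ncsym_m n B) (ncsym_m n C)))"
proof -
  let ?h = "\<lambda>(n, A). (\<Sum>(B, C) \<in> {(B, C) \<in> set_partitions n \<times> set_partitions n.
          B \<sqinter>\<^bsub>part_lattice n\<^esub> C = A}. tensor (ncsym_m n B) (ncsym_m n C)) :: nat list \<times> nat list \<Rightarrow> 'k"
  obtain pt where pt: "dual_points pairs (m_basis :: _ \<Rightarrow> 'k nc_series) pt"
    using dual_points_m by blast
  obtain D where D: "linear_on fscale fscale UNIV D" "\<forall>i\<in>pairs. D (m_basis i :: 'k nc_series) = ?h i"
    using linear_extension[OF pt fvs.vector_space_axioms, of ?h] by blast
  have "D (ncsym_m n A) = ?h (n, A)" if "A \<in> set_partitions n" for n A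
    using D(2)[rule_format, of "(n, A)"] that by simp
  then show ?thesis
    using linear_on_subset[OF D(1) subset_UNIV]
    by (intro eq_Eps_spec[OF ncsym_comult_def, where a = D] conjI ballI allI) simp_all
qed

lemma ncsym_counit_spec:
  "linear_on fscale (*) ncsym_space (ncsym_counit :: 'k::field_char_0 nc_series \<Rightarrow> 'k) \<and>
   (\<forall>n. \<forall>A\<in>set_partitions n.
      ncsym_counit (ncsym_m n A :: 'k nc_series) = (if A = \<top>\<^bsub>part_lattice n\<^esub> then 1 else 0))"
proof -
  obtain pt where pt: "dual_points pairs (m_basis :: _ \<Rightarrow> 'k nc_series) pt"
    using dual_points_m by blast
  obtain e :: "'k nc_series \<Rightarrow> 'k" where e: "linear_on fscale (*) UNIV e"
    "\<forall>i\<in>pairs. e (m_basis i) = (\<lambda>(n, A). if A = \<top>\<^bsub>part_lattice n\<^esub> then 1 else 0) i"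
    using linear_extension[OF pt vector_space_mult] by blast
  have "e (ncsym_m n A) = (if A = \<top>\<^bsub>part_lattice n\<^esub> then 1 else 0)" if "A \<in> set_partitions n" for n A
    using e(2)[rule_format, of "(n, A)"] that by simp
  then show ?thesis
    using linear_on_subset[OF e(1) subset_UNIV]
    by (intro eq_Eps_spec[OF ncsym_counit_def, where a = e] conjI ballI allI) simp_all
qed

text \<open>A meet lies above \<open>A\<close> exactly when both of its arguments do. Grouping the
  pairs above \<open>A\<close> by their meet therefore turns the sum of comultiplications into a
  full product.\<close>

lemma ncsym_comult_p:
  assumes A: "A \<in> set_partitions n"
  shows "ncsym_comult (ncsym_p n A :: 'k::field_char_0 nc_series) = tensor (ncsym_p n A) (ncsym_p n A)"
proof -
  let ?U = "{B. refines {1..n} A B}"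
  let ?t = "\<lambda>p. tensor (ncsym_m n (fst p)) (ncsym_m n (snd p)) :: nat list \<times> nat list \<Rightarrow> 'k"
  have inU: "B \<in> set_partitions n" if "B \<in> ?U" for B
    using that refines_in_set_partitions by blast
  have "ncsym_comult (ncsym_p n A :: 'k nc_series) = (\<Sum>B\<in>?U. ncsym_comult (ncsym_m n B))"
    unfolding ncsym_p_def using ncsym_comult_spec ncsym_m_in inU
    by (intro linear_on_sum[OF _ subspace_ncsym]) blast+
  also have "\<dots> = (\<Sum>B\<in>?U. \<Sum>p | p \<in> ?U \<times> ?U \<and> fst p \<sqinter>\<^bsub>part_lattice n\<^esub> snd p = B. ?t p)"
  proof (intro sum.cong refl)
    fix B assume B: "B \<in> ?U"
    have "{(B', C) \<in> set_partitions n \<times> set_partitions n. B' \<sqinter>\<^bsub>part_lattice n\<^esub> C = B} =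
        {p. p \<in> ?U \<times> ?U \<and> fst p \<sqinter>\<^bsub>part_lattice n\<^esub> snd p = B}"
      using B inU refines_meet_iff by fastforce
    moreover have "ncsym_comult (ncsym_m n B :: 'k nc_series) =
      (\<Sum>(B', C) \<in> {(B', C) \<in> set_partitions n \<times> set_partitions n.
          B' \<sqinter>\<^bsub>part_lattice n\<^esub> C = B}. tensor (ncsym_m n B') (ncsym_m n C))"
      using ncsym_comult_spec inU[OF B] by blast
    ultimately show "ncsym_comult (ncsym_m n B) =
        (\<Sum>p | p \<in> ?U \<times> ?U \<and> fst p \<sqinter>\<^bsub>part_lattice n\<^esub> snd p = B. ?t p)"
      by (simp only: split_def)
  qed
  also have "\<dots> = (\<Sum>p\<in>?U \<times> ?U. ?t p)"
    using inU refines_meet_iff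
    by (intro sum.group finite_cartesian_product finite_upper) fastforce
  also have "\<dots> = tensor (ncsym_p n A) (ncsym_p n A)"
    by (simp only: ncsym_p_def tensor_sum_left) (simp only: tensor_sum_right sum.cartesian_product split_def)
  finally show ?thesis .
qed

text \<open>Dually, a join lies below B exactly when both arguments do. Grouping p_B \<otimes> p_B
  by joins writes it as a lower sum of the proposed values, and Moebius inversion extracts them one
  by one.\<close>

lemma ncsym_comult_x:
  assumes C: "C \<in> set_partitions n"
  shows "ncsym_comult (ncsym_x n C :: 'k::field_char_0 nc_series) =
    (\<Sum>p | p \<in> set_partitions n \<times> set_partitions n \<and> part_join n (fst p) (snd p) = C.
      tensor (ncsym_x n (fst p)) (ncsym_x n (snd p)))"
proof -
  let ?t = "\<lambda>p. tensor (ncsym_x n (fst p)) (ncsym_x n (snd p)) :: nat list \<times> nat list \<Rightarrow> 'k"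
  define g where "g C = (\<Sum>p | p \<in> set_partitions n \<times> set_partitions n \<and> part_join n (fst p) (snd p) = C. ?t p)" for C
  have p: "ncsym_comult (ncsym_p n B) = (\<Sum>A | refines {1..n} A B. g A)" if B: "B \<in> set_partitions n" for B
  proof -
    let ?L = "{A. refines {1..n} A B}"
    have inL: "A \<in> set_partitions n" if "A \<in> ?L" for A
      using that refines_in_set_partitions by blast
    have "ncsym_comult (ncsym_p n B) = (\<Sum>p\<in>?L \<times> ?L. ?t p)"
      unfolding ncsym_comult_p[OF B] unfolding ncsym_p_eq_sum_x[OF B] tensor_sum_left
      by (simp only: tensor_sum_right sum.cartesian_product split_def)
    also have "\<dots> = (\<Sum>A\<in>?L. \<Sum>p | p \<in> ?L \<times> ?L \<and> part_join n (fst p) (snd p) = A. ?t p)"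
      using inL part_join_refines_iff
      by (intro sum.group[symmetric] finite_cartesian_product finite_lower) fastforce
    also have "\<dots> = (\<Sum>A\<in>?L. g A)"
    proof (intro sum.cong refl)
      fix A assume A: "A \<in> ?L"
      have "{p. p \<in> ?L \<times> ?L \<and> part_join n (fst p) (snd p) = A} =
          {p. p \<in> set_partitions n \<times> set_partitions n \<and> part_join n (fst p) (snd p) = A}"
        using A inL part_join_refines_iff by fastforce
      then show "(\<Sum>p | p \<in> ?L \<times> ?L \<and> part_join n (fst p) (snd p) = A. ?t p) = g A"
        by (simp only: g_def)
    qed
    finally show ?thesis .
  qed
  have "ncsym_comult (ncsym_x n C :: 'k nc_series) =
      (\<Sum>B | refines {1..n} B C. fscale (of_int (moebius n B C)) (ncsym_comult (ncsym_p n B)))"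
    unfolding ncsym_x_def using ncsym_comult_spec ncsym_p_in
    by (intro linear_on_sum_scale[OF _ subspace_ncsym]) blast+
  also have "\<dots> = g C"
    using p refines_in_set_partitions by (intro moebius_inversion_lower[OF C]) blast
  finally show ?thesis
    by (simp only: g_def)
qed

text \<open>Every power sum has counit 1, since only its summand at the top contributes. So the
  value is the sum of mu(B, A) over the whole interval from the bottom to A, which vanishes unless A
  is the bottom.\<close>

lemma ncsym_counit_x:
  assumes A: "A \<in> set_partitions n"
  shows "ncsym_counit (ncsym_x n A :: 'k::field_char_0 nc_series) = (if A = \<bottom>\<^bsub>part_lattice n\<^esub> then 1 else 0)"
proof -
  have counit: "linear_on fscale (*) ncsym_space (ncsym_counit :: 'k nc_series \<Rightarrow> 'k)"
    using ncsym_counit_spec by blast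
  have p: "ncsym_counit (ncsym_p n B :: 'k nc_series) = 1" if B: "B \<in> set_partitions n" for B
  proof -
    have inU: "C \<in> set_partitions n" if "C \<in> {C. refines {1..n} B C}" for C
      using that refines_in_set_partitions by blast
    have "ncsym_counit (ncsym_p n B :: 'k nc_series) =
        (\<Sum>C | refines {1..n} B C. ncsym_counit (ncsym_m n C))"
      unfolding ncsym_p_def using inU by (intro linear_on_sum[OF counit subspace_ncsym] ncsym_m_in)
    also have "\<dots> = (\<Sum>C | refines {1..n} B C. if C = \<top>\<^bsub>part_lattice n\<^esub> then 1 else 0)"
      using inU ncsym_counit_spec by (intro sum.cong refl) blast
    also have "\<dots> = 1"
      using part_lattice_top B by (simp add: finite_upper)
    finally show ?thesis .
  qed
  have "ncsym_counit (ncsym_x n A :: 'k nc_series) =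
      (\<Sum>B | refines {1..n} B A. of_int (moebius n B A) * ncsym_counit (ncsym_p n B))"
    unfolding ncsym_x_def by (intro linear_on_sum_scale[OF counit subspace_ncsym] ncsym_p_in)
  also have "\<dots> = (\<Sum>B | refines {1..n} B A. of_int (moebius n B A))"
  proof (intro sum.cong refl)
    fix B assume "B \<in> {B. refines {1..n} B A}"
    then have "B \<in> set_partitions n"
      using refines_in_set_partitions by blast
    then show "of_int (moebius n B A) * ncsym_counit (ncsym_p n B :: 'k nc_series) = of_int (moebius n B A)"
      by (simp add: p)
  qed
  also have "\<dots> = of_int (\<Sum>B | refines {1..n} \<bottom>\<^bsub>part_lattice n\<^esub> B \<and> refines {1..n} B A. moebius n B A)"
  proof -
    have "{B. refines {1..n} B A} = {B. refines {1..n} \<bottom>\<^bsub>part_lattice n\<^esub> B \<and> refines {1..n} B A}"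
      using part_lattice_bottom refines_in_set_partitions by blast
    then show ?thesis
      by simp
  qed
  also have "\<dots> = (if A = \<bottom>\<^bsub>part_lattice n\<^esub> then 1 else 0)"
    using sum_moebius_upper_fixed[of n "\<bottom>\<^bsub>part_lattice n\<^esub>" A] part_lattice_bottom A by auto
  finally show ?thesis .
qed

lemma set_partitions_0: "set_partitions 0 = {{}}"
  by (auto simp: set_partitions_def partition_on_def)

lemma ncsym_x_0: "ncsym_x 0 {} = (ncsym_m 0 {} :: 'k::field_char_0 nc_series)"
proof -
  have "{B. refines {1..0::nat} B {}} = {{}}" "{B. refines {1..0::nat} {} B} = {{}}"
    using refines_in_set_partitions[of 0] refines_self[of "{}" 0] unfolding set_partitions_0 by blast+
  then show ?thesis
    by (simp add: ncsym_x_def ncsym_p_def set_partitions_0)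
qed

section \<open>The isomorphism\<close>

text \<open>\<open>is_F\<close> constrains a map only on \<open>G0_space\<close>, so the final claim
  quantifies over all such maps; existence keeps that quantification from being vacuous.\<close>

lemma ex_is_F: "\<exists>F :: 'k::field_char_0 G0_vec \<Rightarrow> 'k nc_series. is_F F"
proof -
  obtain F :: "'k G0_vec \<Rightarrow> 'k nc_series" where F: "linear_on fscale fscale UNIV F"
    "\<forall>i\<in>pairs. F (simple_basis i) = (\<lambda>(n, A). ncsym_x n A) i"
    using linear_extension[OF dual_points_simple fvs.vector_space_axioms] by blast
  have "F (simple_class n A) = ncsym_x n A" if "A \<in> set_partitions n" for n A
    using F(2)[rule_format, of "(n, A)"] that by simp
  then have "is_F F"
    using linear_on_subset[OF F(1) subset_UNIV] by (simp add: is_F_def)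
  then show ?thesis
    by blast
qed

context
  fixes F :: "'k::field_char_0 G0_vec \<Rightarrow> 'k nc_series"
  assumes is_F: "is_F F"
begin

lemma is_F_linear: "linear_on fscale fscale G0_space F"
  and is_F_simple: "A \<in> set_partitions n \<Longrightarrow> F (simple_class n A) = ncsym_x n A"
  using is_F by (auto simp: is_F_def)

lemma is_F_in: "v \<in> G0_space \<Longrightarrow> F v \<in> ncsym_space"
  using is_F_linear is_F_simple ncsym_x_in unfolding G0_space_def
  by (elim linear_on_span_in[OF _ subspace_ncsym, rotated -1]) auto

text \<open>An explicit inverse \<open>G\<close> is obtained by undoing both triangular changes of
  basis, from m to p and from p to x. The two composites are then compared with the identity on
  spanning sets.\<close>

lemma is_F_bij: "bij_betw F G0_space ncsym_space"
proof -
  \<comment> \<open>The intended preimage of the power sum at \<open>B\<close>, mirroring its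
    expansion in the x-basis.\<close>
  define q where "q n B = (\<Sum>C | refines {1..n} C B. simple_class n C :: 'k G0_vec)" for n B
  obtain pt where pt: "dual_points pairs (m_basis :: _ \<Rightarrow> 'k nc_series) pt"
    using dual_points_m by blast
  \<comment> \<open>The coefficients are those of m_A in the power sums. \<open>G\<close> is
    prescribed on the monomial functions because dual points are available for them.\<close>
  let ?h = "\<lambda>(n, A). \<Sum>B | refines {1..n} A B. fscale (of_int (moebius n A B)) (q n B)"
  obtain G where G: "linear_on fscale fscale UNIV G" "\<forall>i\<in>pairs. G (m_basis i :: 'k nc_series) = ?h i"
    using linear_extension[OF pt fvs.vector_space_axioms, of ?h] by blast
  have G_m: "G (ncsym_m n A) = ?h (n, A)" if "A \<in> set_partitions n" for n A
    using G(2)[rule_format, of "(n, A)"] that by simp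
  have q_in: "q n B \<in> G0_space" for n B
    unfolding q_def using refines_in_set_partitions
    by (intro fvs.subspace_sum[OF subspace_G0] simple_class_in) blast
  have G_in_m: "G (ncsym_m n A) \<in> G0_space" if "A \<in> set_partitions n" for n A
    unfolding G_m[OF that] split
    by (intro fvs.subspace_sum[OF subspace_G0] fvs.subspace_scale[OF subspace_G0] q_in)
  have G_in: "G w \<in> G0_space" if "w \<in> ncsym_space" for w
    using that unfolding ncsym_space_def
    by (rule linear_on_span_in[OF linear_on_subset[OF G(1) subset_UNIV] subspace_G0, rotated])
      (use G_in_m in blast)
  have G_p: "G (ncsym_p n A) = q n A" if A: "A \<in> set_partitions n" for n A
  proof -
    have "G (ncsym_p n A) = (\<Sum>B | refines {1..n} A B. G (ncsym_m n B))"
      unfolding ncsym_p_def by (rule linear_on_sum[OF G(1) fvs.subspace_UNIV]) simp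
    also have "\<dots> = q n A"
      using G_m refines_in_set_partitions by (intro moebius_inversion_upper_converse[OF A]) auto
    finally show ?thesis .
  qed
  have GF: "G (F v) = v" if "v \<in> G0_space" for v
  proof (rule linear_on_span_eq[of fscale "{simple_class n A |n A. A \<in> set_partitions n}" "\<lambda>v. G (F v)" "\<lambda>v. v"])
    show "linear_on fscale fscale (fvs.span {simple_class n A |n A. A \<in> set_partitions n}) (\<lambda>v. G (F v))"
      by (rule linear_on_compose[OF is_F_linear[unfolded G0_space_def] G(1)]) simp
    show "linear_on fscale fscale (fvs.span {simple_class n A |n A. A \<in> set_partitions n}) (\<lambda>v. v :: 'k G0_vec)"
      by (simp add: linear_on_def)
    show "v \<in> fvs.span {simple_class n A |n A. A \<in> set_partitions n}"
      using that by (simp only: G0_space_def)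
    fix b :: "'k G0_vec" assume "b \<in> {simple_class n A |n A. A \<in> set_partitions n}"
    then obtain n A where b: "b = simple_class n A" and A: "A \<in> set_partitions n"
      by blast
    have "G (ncsym_x n A) = (\<Sum>B | refines {1..n} B A. fscale (of_int (moebius n B A)) (G (ncsym_p n B)))"
      unfolding ncsym_x_def by (rule linear_on_sum_scale[OF G(1) fvs.subspace_UNIV]) simp
    also have "\<dots> = simple_class n A"
      using G_p refines_in_set_partitions unfolding q_def by (intro moebius_inversion_lower[OF A]) blast
    finally show "G (F b) = b"
      by (simp only: b is_F_simple[OF A])
  qed
  have FG: "F (G w) = w" if "w \<in> ncsym_space" for w
  proof (rule linear_on_span_eq[of fscale "{ncsym_m n A |n A. A \<in> set_partitions n}" "\<lambda>w. F (G w)" "\<lambda>w. w"])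
    show "linear_on fscale fscale (fvs.span {ncsym_m n A |n A. A \<in> set_partitions n}) (\<lambda>w. F (G w))"
      using G_in unfolding ncsym_space_def
      by (intro linear_on_compose[OF linear_on_subset[OF G(1) subset_UNIV] is_F_linear])
    show "linear_on fscale fscale (fvs.span {ncsym_m n A |n A. A \<in> set_partitions n}) (\<lambda>w. w :: 'k nc_series)"
      by (simp add: linear_on_def)
    show "w \<in> fvs.span {ncsym_m n A |n A. A \<in> set_partitions n}"
      using that by (simp only: ncsym_space_def)
    fix b :: "'k nc_series" assume "b \<in> {ncsym_m n A |n A. A \<in> set_partitions n}"
    then obtain n A where b: "b = ncsym_m n A" and A: "A \<in> set_partitions n"
      by blast
    have F_q: "F (q n B) = ncsym_p n B" if B: "B \<in> set_partitions n" for B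
    proof -
      have inL: "C \<in> set_partitions n" if "C \<in> {C. refines {1..n} C B}" for C
        using that refines_in_set_partitions by blast
      have "F (q n B) = (\<Sum>C | refines {1..n} C B. F (simple_class n C))"
        unfolding q_def using inL by (intro linear_on_sum[OF is_F_linear subspace_G0] simple_class_in)
      also have "\<dots> = ncsym_p n B"
        unfolding ncsym_p_eq_sum_x[OF B] using inL is_F_simple by (intro sum.cong refl) blast
      finally show ?thesis .
    qed
    have "F (G b) = (\<Sum>B | refines {1..n} A B. fscale (of_int (moebius n A B)) (F (q n B)))"
      unfolding b G_m[OF A] split by (rule linear_on_sum_scale[OF is_F_linear subspace_G0 q_in])
    also have "\<dots> = (\<Sum>B | refines {1..n} A B. fscale (of_int (moebius n A B)) (ncsym_p n B))"
      using F_q refines_in_set_partitions by (intro sum.cong refl) (metis mem_Collect_eq)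
    also have "\<dots> = b"
      by (simp only: b ncsym_m_eq_sum_p[OF A])
    finally show "F (G b) = b" .
  qed
  show ?thesis
    by (rule bij_betwI[where g = G]) (use is_F_in G_in GF FG in auto)
qed

text \<open>Both sides are bilinear on \<open>G0_space\<close>, and on simple classes both products
  concatenate the indices.\<close>

lemma is_F_mult:
  assumes v: "v \<in> G0_space" and w: "w \<in> G0_space"
  shows "F (G0_mult v w) = ncsym_mult (F v) (F w)"
proof (rule bilinear_span_eq[where A = "{simple_class n A |n A. A \<in> set_partitions n}"
      and B = "{simple_class n A |n A. A \<in> set_partitions n}" and sc = fscale
      and f = "\<lambda>v w. F (G0_mult v w)" and g = "\<lambda>v w. ncsym_mult (F v) (F w)", folded G0_space_def])
  have lin: "linear_on fscale fscale G0_space (G0_mult u)" "linear_on fscale fscale G0_space (\<lambda>v. G0_mult v u)"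
    if "u \<in> G0_space" for u :: "'k G0_vec"
    using G0_mult_spec that by blast+
  show "linear_on fscale fscale G0_space (\<lambda>v. F (G0_mult v u))"
    "linear_on fscale fscale G0_space (\<lambda>v. F (G0_mult u v))" if u: "u \<in> G0_space" for u
    using G0_mult_in u by (auto intro: linear_on_compose[OF lin(2)[OF u] is_F_linear] linear_on_compose[OF lin(1)[OF u] is_F_linear])
  show "linear_on fscale fscale G0_space (\<lambda>v. ncsym_mult (F v) (F u))"
    "linear_on fscale fscale G0_space (\<lambda>v. ncsym_mult (F u) (F v))" for u
    by (rule linear_on_compose[OF is_F_linear ncsym_mult_linear_left[of UNIV]], simp,
        rule linear_on_compose[OF is_F_linear ncsym_mult_linear_right[of UNIV]], simp)
  fix a b :: "'k G0_vec"
  assume "a \<in> {simple_class n A |n A. A \<in> set_partitions n}" "b \<in> {simple_class n A |n A. A \<in> set_partitions n}"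
  then show "F (G0_mult a b) = ncsym_mult (F a) (F b)"
    by (auto simp: G0_mult_simple is_F_simple part_concat_in ncsym_x_mult)
qed (use v w in simp_all)

lemma is_F_comult:
  assumes "v \<in> G0_space"
  shows "tensor_map G0_space F (G0_comult v) = ncsym_comult (F v)"
proof -
  let ?B = "{simple_class n A |n A. A \<in> set_partitions n} :: 'k G0_vec set"
  let ?T = "tensor_space G0_space G0_space :: (_ \<Rightarrow> 'k) set"
  have tm: "linear_on fscale fscale ?T (tensor_map G0_space F)"
    "\<And>v w. v \<in> G0_space \<Longrightarrow> w \<in> G0_space \<Longrightarrow> tensor_map G0_space F (tensor v w) = tensor (F v) (F w)"
    using tensor_map_spec[OF dual_points_simple G0_space_span is_F_linear] by blast+
  have lin: "linear_on fscale fscale (G0_space :: 'k G0_vec set) G0_comult"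
    using G0_comult_spec by blast
  have simple_tensor: "tensor (simple_class n (fst p)) (simple_class n (snd p)) \<in> ?T"
    if "p \<in> set_partitions n \<times> set_partitions n" for n p
    using that by (intro tensor_in_tensor_space simple_class_in) auto
  \<comment> \<open>\<open>tensor_map\<close> is specified only on the tensor square, so the
    comultiplication must be known to land there before the two are composed.\<close>
  have comult_in: "G0_comult v \<in> ?T" if "v \<in> G0_space" for v :: "'k G0_vec"
  proof (rule linear_on_span_in[OF lin[unfolded G0_space_def] subspace_tensor_space])
    show "v \<in> fvs.span ?B"
      using that by (simp only: G0_space_def)
    fix b assume "b \<in> ?B"
    then obtain n C where b: "b = simple_class n C" and C: "C \<in> set_partitions n"
      by blast
    show "G0_comult b \<in> ?T"
      unfolding b G0_comult_simple[OF C]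
      by (intro fvs.subspace_sum[OF subspace_tensor_space] simple_tensor) blast
  qed
  show ?thesis
  proof (rule linear_on_span_eq[of fscale ?B "\<lambda>v. tensor_map G0_space F (G0_comult v)" "\<lambda>v. ncsym_comult (F v)",
        folded G0_space_def])
    show "linear_on fscale fscale G0_space (\<lambda>v. tensor_map G0_space F (G0_comult v))"
      by (rule linear_on_compose[OF lin tm(1) comult_in])
    show "linear_on fscale fscale G0_space (\<lambda>v. ncsym_comult (F v))"
      using ncsym_comult_spec by (intro linear_on_compose[OF is_F_linear _ is_F_in]) blast+
    fix b assume "b \<in> ?B"
    then obtain n C where b: "b = simple_class n C" and C: "C \<in> set_partitions n"
      by blast
    let ?S = "{p. p \<in> set_partitions n \<times> set_partitions n \<and> part_join n (fst p) (snd p) = C}"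
    have "tensor_map G0_space F (G0_comult b) =
        (\<Sum>p\<in>?S. tensor_map G0_space F (tensor (simple_class n (fst p)) (simple_class n (snd p))))"
      unfolding b G0_comult_simple[OF C]
      by (intro linear_on_sum[OF tm(1) subspace_tensor_space] simple_tensor) blast
    also have "\<dots> = (\<Sum>p\<in>?S. tensor (ncsym_x n (fst p)) (ncsym_x n (snd p)))"
      by (intro sum.cong refl) (auto simp: tm(2) simple_class_in is_F_simple)
    also have "\<dots> = ncsym_comult (F b)"
      unfolding b is_F_simple[OF C] ncsym_comult_x[OF C] ..
    finally show "tensor_map G0_space F (G0_comult b) = ncsym_comult (F b)" .
  qed (rule assms)
qed

lemma is_F_counit:
  assumes "v \<in> G0_space"
  shows "ncsym_counit (F v) = G0_counit v"
proof (rule linear_on_span_eq[of "(*)" "{simple_class n A |n A. A \<in> set_partitions n}"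
      "\<lambda>v. ncsym_counit (F v)" G0_counit, folded G0_space_def])
  show "linear_on fscale (*) G0_space (\<lambda>v. ncsym_counit (F v))"
    using ncsym_counit_spec by (intro linear_on_compose[OF is_F_linear _ is_F_in]) blast+
  show "linear_on fscale (*) G0_space (G0_counit :: 'k G0_vec \<Rightarrow> 'k)"
    using G0_counit_spec by blast
  fix b :: "'k G0_vec" assume "b \<in> {simple_class n A |n A. A \<in> set_partitions n}"
  then obtain n A where b: "b = simple_class n A" and A: "A \<in> set_partitions n"
    by blast
  show "ncsym_counit (F b) = G0_counit b"
    using G0_counit_spec A unfolding b is_F_simple[OF A] ncsym_counit_x[OF A] by (metis (no_types, lifting))
qed (rule assms)

lemma is_F_bialg_iso: "bialg_iso G0_bialg ncsym_bialg F"
  unfolding bialg_iso_def G0_bialg_def ncsym_bialg_def bialg.simps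
  using is_F_linear is_F_bij is_F_mult is_F_comult is_F_counit is_F_simple[of "{}" 0] ncsym_x_0
  by (auto simp: set_partitions_0)

end

theorem theorem2p6:
  shows "(\<exists>F :: 'k::field_char_0 G0_vec \<Rightarrow> 'k nc_series. is_F F) \<and>
    (\<forall>F :: 'k G0_vec \<Rightarrow> 'k nc_series. is_F F \<longrightarrow> bialg_iso G0_bialg ncsym_bialg F)"
  using ex_is_F is_F_bialg_iso by blast

end
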